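(* Let $d\in\mathbb N$ and let $t_2,\dots,t_{d+1}$ be complex numbers with $|t_2|<\frac12$. Then there exists $\delta>0$ such that for all $t_0\in\mathbb R$, $t_1\in\mathbb C$ with $0<t_0<\delta$ and $|t_1|^2<t_0\left(\frac12-|t_2|\right)$ there exists a unique positively oriented polynomial curve of degree less than or equal to $d$ encircling the origin whose interior has area $\pi t_0$ and whose exterior harmonic moments are $(t_k)_{k=1}^\infty$, where $t_k=0$ for $k>d+1$.
   Context: A polynomial curve of degree $d$ is a smooth simple closed curve in $\mathbb C$ with a parametrisation $h:S^1\to\mathbb C$ of the form $h(w)=rw+\sum_{j=0}^d a_jw^{-j}$, $|w|=1$, with $r>0$ and $a_d\neq0$; "degree less than or equal to $d$" means that a parametrisation of this form exists with $a_d=0$ allowed (so circles are included). It is positively oriented if the orientation induced by the counterclockwise orientation of $S^1$ is counterclockwise. The exterior harmonic moments of a polynomial curve $\gamma$ encircling the origin are $t_k=\frac1{2\pi\mathrm ik}\oint_\gamma\bar zz^{-k}\,dz$, $k\in\mathbb N$. *)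

theory Defs
  imports "HOL-Complex_Analysis.Complex_Analysis"
begin

definition laurent_map :: "nat \<Rightarrow> real \<Rightarrow> (nat \<Rightarrow> complex) \<Rightarrow> complex \<Rightarrow> complex" where
  "laurent_map d r a w = of_real r * w + (\<Sum>j\<le>d. a j / w ^ j)"

text \<open>
  Smoothness of a closed curve means that it is regularly parametrised, i.e. the derivative of
  \<open>h\<close> has no zero on the unit circle; a cusped curve is not smooth.  The coefficient
  \<open>a d\<close> may vanish, so the degree is at most \<open>d\<close>.  A map \<open>h\<close> is determined on the
  whole punctured plane by its values on the unit circle.
\<close>

definition polynomial_parametrisation :: "nat \<Rightarrow> (complex \<Rightarrow> complex) \<Rightarrow> bool" where
  "polynomial_parametrisation d h \<longleftrightarrow>
     (\<exists>r a. r > 0 \<and> h = laurent_map d r a) \<and>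
     inj_on h (sphere 0 1) \<and>
     (\<forall>w\<in>sphere 0 1. deriv h w \<noteq> 0)"

definition boundary_loop :: "(complex \<Rightarrow> complex) \<Rightarrow> real \<Rightarrow> complex" where
  "boundary_loop h = h \<circ> circlepath 0 1"

text \<open>Meant for simple closed paths, whose winding number around inside points is
  either constantly 1 (counterclockwise) or constantly -1 (clockwise).\<close>

definition positively_oriented :: "(real \<Rightarrow> complex) \<Rightarrow> bool" where
  "positively_oriented g \<longleftrightarrow> (\<forall>z\<in>inside (path_image g). winding_number g z = 1)"

text \<open>
  A curve is a point set.  The same set may also have a clockwise parametrisation of the above
  form: for \<open>0 < r < s\<close>, the maps \<open>s * w + r / w\<close> and \<open>r * w + s / w\<close> trace the
  same ellipse in opposite directions.  Hence the orientation, and the moments defined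
  below, refer to the parametrisation.
\<close>

definition pos_polynomial_curve_param :: "nat \<Rightarrow> (complex \<Rightarrow> complex) \<Rightarrow> complex set \<Rightarrow> bool" where
  "pos_polynomial_curve_param d h C \<longleftrightarrow>
     polynomial_parametrisation d h \<and> C = h ` sphere 0 1 \<and> positively_oriented (boundary_loop h)"

definition exterior_moment :: "(real \<Rightarrow> complex) \<Rightarrow> nat \<Rightarrow> complex" where
  "exterior_moment g k =
     contour_integral g (\<lambda>z. cnj z / z ^ k) / (2 * of_real pi * \<i> * of_nat k)"

end

theory Submission
  imports Defs
begin

text \<open>
  Write \<open>h = r w + \<Sum> a j / w ^ j\<close>, let \<open>P z = \<Sum> k * t k * z ^ (k - 1)\<close>, and note that on the
  unit circle \<open>cnj (h w)\<close> is a Laurent polynomial.  If \<open>h\<close> has no zero outside the disc (which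
  winding number 1 about the origin forces), the moment equations say exactly that
  \<open>cnj (h w) - P (h w)\<close> vanishes at infinity, that is, \<open>cnj (a j)\<close> is the coefficient of \<open>w ^ j\<close>
  in \<open>P (h w)\<close> for all \<open>j \<le> d\<close>.  The area equation reads \<open>t0 = r ^ 2 - \<Sum> j * norm (a j) ^ 2\<close>.

  After scaling by \<open>s = sqrt t0\<close> these equations become a fixed point problem for \<open>b j = a j / s\<close>
  whose map is a contraction with factor \<open>2 * norm (t 2) + O(s)\<close> in the norm
  \<open>norm (b 0) + \<Sum> j * norm (b j)\<close>.  The fixed point is a small perturbation of an ellipse, so it is
  a simple positively oriented curve, and the bound on \<open>t1\<close> keeps the origin inside.

  For uniqueness, every solution must lie where the contraction applies.  By the Cauchy-Pompeiu
  formula \<open>norm (cnj z - P z) \<le> 3 * sqrt t0\<close> inside the curve; since \<open>2 * norm (t 2) < 1\<close>, this keeps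
  the domain in a disc of radius \<open>O(sqrt t0)\<close>.  Both the area formula and the Cauchy-Pompeiu formula
  come from Fubini's theorem applied to the winding number integral, together with the fact that
  the Cauchy transform of a disc is \<open>- pi * cnj z\<close> inside that disc.
\<close>

section \<open>The Cauchy transform and plane area\<close>

text \<open>Contraction gives uniqueness only within a bounded ball of coefficients, and the area
  equation fixes the difference of \<open>r ^ 2\<close> and a sum without bounding \<open>r\<close>.
  Hence uniqueness needs an estimate drawn from the geometry of the curve; the plane integrals serve
  to supply it.

  The weights \<open>j\<close> in the norm have two origins. The radius obtained from the area
  equation is Lipschitz with constant 1 in \<open>\<Sum> j * norm (b j)\<close>, so the affine part
  of the iteration contributes no more than \<open>2 * norm (t 2)\<close>; and
  \<open>\<Sum> j * norm (a j) < r\<close> is the criterion for a simple regular curve.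

  The bound on \<open>t1\<close> leaves room to spare. Put \<open>\<tau> = t1 / s\<close>. The
  unperturbed ellipse has scaled radius \<open>\<rho>\<close> with
  \<open>\<rho> ^ 2 * (1 - 4 * norm (t 2) ^ 2) = 1\<close> and contains the origin iff
  \<open>\<rho> * norm \<tau> < 1\<close>. The hypothesis yields
  \<open>(\<rho> * norm \<tau>) ^ 2 < 1 / 2\<close>, and this margin absorbs the
  perturbation.\<close>

definition vec_complex :: "real^2 \<Rightarrow> complex" where
  "vec_complex v = Complex (vec_nth v 1) (vec_nth v 2)"

lemma vec_complex_borel [measurable]: "vec_complex \<in> borel_measurable borel"
proof -
  have "continuous_on UNIV vec_complex"
    unfolding vec_complex_def Complex_eq by (intro continuous_intros)
  then show ?thesis by (rule borel_measurable_continuous_onI)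
qed

text \<open>Both measures agree on boxes. The identification makes the invariance under orthogonal
  maps of \<open>real^2\<close> available for complex multiplication.\<close>

lemma lborel_complex_eq_distr: "(lborel :: complex measure) = distr lborel borel vec_complex"
proof (rule lborel_eqI)
  fix l u :: complex
  assume lu: "\<And>b. b \<in> Basis \<Longrightarrow> l \<bullet> b \<le> u \<bullet> b"
  define L U :: "real^2" where "L = vector [Re l, Im l]" and "U = vector [Re u, Im u]"
  have le: "Re l \<le> Re u" "Im l \<le> Im u"
    using lu[of 1] lu[of \<i>] by (auto simp: Basis_complex_def inner_complex_def)
  have "vec_complex -` box l u = box L U"
    by (auto simp: vec_complex_def in_box_complex_iff mem_box_cart forall_2 L_def U_def)
  moreover have "emeasure lborel (box L U) = ennreal ((Re u - Re l) * (Im u - Im l))"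
  proof -
    have "L \<in> cbox L U"
      using le by (simp add: mem_box_cart L_def U_def forall_2)
    then have "measure lborel (cbox L U) = (Re u - Re l) * (Im u - Im l)"
      by (subst content_cbox_cart) (auto simp: UNIV_2 L_def U_def)
    then show ?thesis
      by (metis emeasure_lborel_box_eq emeasure_lborel_cbox_eq emeasure_eq_ennreal_measure
          emeasure_lborel_cbox_finite less_top infinity_ennreal_def)
  qed
  ultimately show "emeasure (distr lborel borel vec_complex) (box l u) = ennreal (\<Prod>b\<in>Basis. (u - l) \<bullet> b)"
    by (subst emeasure_distr) (auto simp: Basis_complex_def inner_complex_def)
qed simp

text \<open>Under \<open>vec_complex\<close>, multiplication by \<open>cnj c\<close> becomes the
  orthogonal map \<open>g\<close>. Since \<open>c * cnj c = 1\<close>, the preimage of a box under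
  multiplication by \<open>c\<close> is its image under \<open>g\<close>, which has the same
  measure.\<close>

lemma distr_lborel_rotation:
  fixes c :: complex
  assumes "norm c = 1"
  shows "distr lborel borel ((*) c) = (lborel :: complex measure)"
proof (rule lborel_eqI[symmetric])
  fix l u :: complex
  assume lu: "\<And>b. b \<in> Basis \<Longrightarrow> l \<bullet> b \<le> u \<bullet> b"
  define g :: "real^2 \<Rightarrow> real^2" where
    "g v = vector [Re (cnj c * vec_complex v), Im (cnj c * vec_complex v)]" for v
  have cc: "c * cnj c = 1"
    using assms by (metis complex_norm_square of_real_1 power_one)
  have Tg: "vec_complex (g v) = cnj c * vec_complex v" for v
    by (simp add: g_def vec_complex_def[of "vector _"] complex_eq_iff)
  have inj: "vec_complex v = vec_complex w \<Longrightarrow> v = w" for v w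
    by (auto simp: vec_complex_def vec_eq_iff forall_2)
  have lin: "linear g"
    by (rule linearI) (auto simp: g_def vec_complex_def vec_eq_iff forall_2 algebra_simps)
  have nrm: "norm v = norm (vec_complex v)" for v
    by (simp add: vec_complex_def norm_vec_def L2_set_def UNIV_2 complex_norm)
  have orth: "orthogonal_transformation g"
    using lin unfolding orthogonal_transformation
    by (simp add: nrm Tg norm_mult assms)
  have bx: "emeasure lborel (vec_complex -` box l u) = ennreal (\<Prod>b\<in>Basis. (u - l) \<bullet> b)"
    (is "emeasure lborel ?B = _")
  proof -
    have "emeasure (lborel::complex measure) (box l u) = ennreal (\<Prod>b\<in>Basis. (u - l) \<bullet> b)"
      using lu by (subst emeasure_lborel_box_eq) auto
    then show ?thesis
      by (subst (asm) lborel_complex_eq_distr) (simp add: emeasure_distr)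
  qed
  have Bs: "?B \<in> sets borel"
    using measurable_sets[OF vec_complex_borel, of "box l u"] by simp
  have Blm: "?B \<in> lmeasurable"
    using bx Bs by (simp add: fmeasurable_def emeasure_completion)
  have im: "g ` ?B = vec_complex -` ((*) c -` box l u)"
  proof (intro equalityI subsetI)
    fix v assume "v \<in> g ` ?B"
    then show "v \<in> vec_complex -` ((*) c -` box l u)"
      using cc by (auto simp: Tg mult.assoc[symmetric])
  next
    fix v assume v: "v \<in> vec_complex -` ((*) c -` box l u)"
    define w where "w = (vector [Re (c * vec_complex v), Im (c * vec_complex v)] :: real^2)"
    have Tw: "vec_complex w = c * vec_complex v"
      by (simp add: w_def vec_complex_def[of "vector _"] complex_eq_iff)
    have "g w = v"
      by (rule inj) (use cc in \<open>simp add: Tg Tw mult.assoc[symmetric] mult.commute[of "cnj c"]\<close>)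
    then show "v \<in> g ` ?B" using v Tw by (auto intro!: image_eqI[of _ _ w])
  qed
  have "emeasure (distr lborel borel ((*) c)) (box l u) = emeasure lborel ((*) c -` box l u)"
    by (subst emeasure_distr) auto
  also have "\<dots> = emeasure lborel (g ` ?B)"
    unfolding im by (subst lborel_complex_eq_distr, subst emeasure_distr)
      (use measurable_sets[of "(*) c" borel borel "box l u"] in auto)
  also have "\<dots> = emeasure lebesgue (g ` ?B)"
  proof -
    have "g ` ?B \<in> sets borel" unfolding im
      using measurable_sets[OF vec_complex_borel, of "(*) c -` box l u"]
        measurable_sets[of "(*) c" borel borel "box l u"] by auto
    then show ?thesis by (simp add: emeasure_completion)
  qed
  also have "\<dots> = emeasure lebesgue ?B"
    using measure_orthogonal_image[OF orth Blm] measurable_orthogonal_image[OF orth Blm] Blm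
    by (simp add: emeasure_eq_measure2 fmeasurableD2)
  also have "\<dots> = ennreal (\<Prod>b\<in>Basis. (u - l) \<bullet> b)"
    using bx Bs by (simp add: emeasure_completion)
  finally show "emeasure (distr lborel borel ((*) c)) (box l u) = ennreal (\<Prod>b\<in>Basis. (u - l) \<bullet> b)" .
qed simp

section \<open>Integrability of the Cauchy kernel near its pole\<close>

lemma ball_in_borel [measurable]: "ball (z::complex) r \<in> sets borel"
  by simp

lemma emeasure_complex_ball:
  "r \<ge> 0 \<Longrightarrow> emeasure lborel (ball (z::complex) r) = ennreal (pi * r\<^sup>2)"
  by (simp add: emeasure_ball unit_ball_vol_2)

text \<open>Layer-cake argument: \<open>1 / norm \<zeta>\<close> is the length of the interval of
  all \<open>t\<close> with \<open>0 < t < 1 / norm \<zeta>\<close>. After the integrals are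
  exchanged, the section at height \<open>t\<close> is a punctured disc whose radius is the smaller
  of \<open>R\<close> and \<open>1 / t\<close>; the ranges below and above \<open>1 / R\<close>
  contribute \<open>pi * R\<close> each.\<close>

lemma nn_integral_inverse_norm_ball_0:
  assumes R: "R > 0"
  shows "(\<integral>\<^sup>+\<zeta>. indicator (ball 0 R) \<zeta> * ennreal (1 / norm (\<zeta>::complex)) \<partial>lborel) \<le> ennreal (2 * pi * R)"
proof -
  \<comment> \<open>Excluding \<open>\<zeta> = 0\<close> matches the value \<open>1 / 0 = 0\<close>;
    otherwise the section there would be a half-line.\<close>
  define f :: "complex \<Rightarrow> real \<Rightarrow> ennreal" where
    "f \<zeta> t = indicator (ball 0 R) \<zeta> * (if 0 < t \<and> t * norm \<zeta> < 1 \<and> \<zeta> \<noteq> 0 then 1 else 0)" for \<zeta> t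
  have [measurable]: "case_prod f \<in> borel_measurable (lborel \<Otimes>\<^sub>M lborel)"
    unfolding f_def by measurable
  have "(\<integral>\<^sup>+\<zeta>. indicator (ball 0 R) \<zeta> * ennreal (1 / norm (\<zeta>::complex)) \<partial>lborel)
      = (\<integral>\<^sup>+\<zeta>. (\<integral>\<^sup>+t. f \<zeta> t \<partial>lborel) \<partial>lborel)"
  proof (rule nn_integral_cong)
    fix \<zeta> :: complex
    show "indicator (ball 0 R) \<zeta> * ennreal (1 / norm \<zeta>) = (\<integral>\<^sup>+t. f \<zeta> t \<partial>lborel)"
    proof (cases "\<zeta> = 0")
      case False
      have "(\<integral>\<^sup>+t. f \<zeta> t \<partial>lborel) = (\<integral>\<^sup>+t. indicator (ball 0 R) \<zeta> * indicator {0<..<1 / norm \<zeta>} t \<partial>lborel)"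
        using False by (intro nn_integral_cong) (auto simp: f_def indicator_def field_simps)
      also have "\<dots> = indicator (ball 0 R) \<zeta> * ennreal (1 / norm \<zeta>)"
        by (simp add: nn_integral_cmult)
      finally show ?thesis by simp
    qed (simp add: f_def)
  qed
  also have "\<dots> = (\<integral>\<^sup>+t. (\<integral>\<^sup>+\<zeta>. f \<zeta> t \<partial>lborel) \<partial>lborel)"
    by (rule lborel_pair.Fubini'[symmetric]) measurable
  also have "\<dots> \<le> (\<integral>\<^sup>+t. ennreal (pi * R\<^sup>2) * indicator {0..1/R} t + ennreal (pi / t\<^sup>2) * indicator {1/R..} t \<partial>lborel)"
  proof (rule nn_integral_mono)
    fix t :: real
    consider "t \<le> 0" | "0 < t" "t \<le> 1/R" | "t > 0" "t > 1/R" by linarith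
    then show "(\<integral>\<^sup>+\<zeta>. f \<zeta> t \<partial>lborel) \<le> ennreal (pi * R\<^sup>2) * indicator {0..1/R} t + ennreal (pi / t\<^sup>2) * indicator {1/R..} t"
    proof cases
      case 1
      then have "f \<zeta> t = 0" for \<zeta> by (simp add: f_def)
      then show ?thesis by simp
    next
      case 2
      have "(\<integral>\<^sup>+\<zeta>. f \<zeta> t \<partial>lborel) \<le> (\<integral>\<^sup>+\<zeta>. indicator (ball (0::complex) R) \<zeta> \<partial>lborel)"
        by (intro nn_integral_mono) (auto simp: f_def indicator_def)
      also have "\<dots> = ennreal (pi * R\<^sup>2)" using R by (simp add: emeasure_complex_ball)
      also have "\<dots> \<le> ennreal (pi * R\<^sup>2) * indicator {0..1/R} t + ennreal (pi / t\<^sup>2) * indicator {1/R..} t"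
        using 2 by simp
      finally show ?thesis .
    next
      case 3
      have "(\<integral>\<^sup>+\<zeta>. f \<zeta> t \<partial>lborel) \<le> (\<integral>\<^sup>+\<zeta>. indicator (ball (0::complex) (1/t)) \<zeta> \<partial>lborel)"
        using 3 by (intro nn_integral_mono) (auto simp: f_def indicator_def field_simps)
      also have "\<dots> = ennreal (pi / t\<^sup>2)" using 3 by (simp add: emeasure_complex_ball power_divide)
      also have "\<dots> \<le> ennreal (pi * R\<^sup>2) * indicator {0..1/R} t + ennreal (pi / t\<^sup>2) * indicator {1/R..} t"
        using 3 by simp
      finally show ?thesis .
    qed
  qed
  also have "\<dots> = (\<integral>\<^sup>+t. ennreal (pi * R\<^sup>2) * indicator {0..1/R} t \<partial>lborel) + (\<integral>\<^sup>+t. ennreal (pi / t\<^sup>2) * indicator {1/R..} t \<partial>lborel)"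
    by (rule nn_integral_add) measurable
  also have "(\<integral>\<^sup>+t. ennreal (pi * R\<^sup>2) * indicator {0..1/R} t \<partial>lborel) = ennreal (pi * R)"
    using R by (simp add: nn_integral_cmult ennreal_mult'[symmetric] power2_eq_square)
  also have "(\<integral>\<^sup>+t. ennreal (pi / t\<^sup>2) * indicator {1/R..} t \<partial>lborel) = ennreal (0 - (- pi / (1/R)))"
  proof (rule nn_integral_FTC_atLeast)
    fix t :: real assume "1/R \<le> t"
    then have "t > 0" using R by (meson divide_pos_pos less_le_trans zero_less_one)
    then show "((\<lambda>t. - pi / t) has_real_derivative pi / t\<^sup>2) (at t)"
      by (auto intro!: derivative_eq_intros simp: power2_eq_square)
  next
    show "((\<lambda>t. - pi / t) \<longlongrightarrow> 0) at_top" by real_asymp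
  qed (use R in auto)
  also have "ennreal (pi * R) + ennreal (0 - (- pi / (1/R))) = ennreal (2 * pi * R)"
    using R by (simp flip: ennreal_plus)
  finally show ?thesis .
qed

lemma integrable_inverse_norm_ball_0:
  shows "integrable lborel (\<lambda>\<zeta>::complex. indicator (ball 0 R) \<zeta> / norm \<zeta>)"
    and "R > 0 \<Longrightarrow> (\<integral>\<zeta>. indicator (ball (0::complex) R) \<zeta> / norm \<zeta> \<partial>lborel) \<le> 2 * pi * R"
proof -
  have eq: "(\<integral>\<^sup>+\<zeta>. ennreal (indicator (ball (0::complex) R) \<zeta> / norm \<zeta>) \<partial>lborel)
     = (\<integral>\<^sup>+\<zeta>. indicator (ball 0 R) \<zeta> * ennreal (1 / norm (\<zeta>::complex)) \<partial>lborel)"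
    by (intro nn_integral_cong) (auto simp: indicator_def)
  show int: "integrable lborel (\<lambda>\<zeta>::complex. indicator (ball 0 R) \<zeta> / norm \<zeta>)"
  proof (cases "R > 0")
    case True
    show ?thesis
      using nn_integral_inverse_norm_ball_0[OF True] eq
      by (intro integrableI_bounded) (measurable, auto simp: less_top[symmetric] top_unique)
  qed (simp add: ball_empty)
  show "(\<integral>\<zeta>. indicator (ball (0::complex) R) \<zeta> / norm \<zeta> \<partial>lborel) \<le> 2 * pi * R" if "R > 0"
  proof -
    have "ennreal (\<integral>\<zeta>. indicator (ball (0::complex) R) \<zeta> / norm \<zeta> \<partial>lborel) \<le> ennreal (2 * pi * R)"
      using nn_integral_inverse_norm_ball_0[OF that] eq nn_integral_eq_integral[OF int] by simp
    then show ?thesis using that by (subst (asm) ennreal_le_iff) auto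
  qed
qed

lemma integrable_inverse_norm_ball:
  fixes z :: complex
  shows "integrable lborel (\<lambda>\<zeta>::complex. indicator (ball z R) \<zeta> / norm (\<zeta> - z))"
    and "R > 0 \<Longrightarrow> (\<integral>\<zeta>. indicator (ball z R) \<zeta> / norm (\<zeta> - z) \<partial>lborel) \<le> 2 * pi * R"
proof -
  have eq: "(\<lambda>\<zeta>::complex. indicator (ball z R) (z + \<zeta>) / norm (z + \<zeta> - z)) = (\<lambda>\<zeta>. indicator (ball 0 R) \<zeta> / norm \<zeta>)"
    by (auto simp: fun_eq_iff indicator_def dist_norm)
  have "integrable (distr lborel borel ((+) z)) (\<lambda>\<zeta>::complex. indicator (ball z R) \<zeta> / norm (\<zeta> - z))"
    by (subst integrable_distr_eq) (measurable, use eq integrable_inverse_norm_ball_0(1)[of R] in \<open>simp only:\<close>)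
  then show "integrable lborel (\<lambda>\<zeta>::complex. indicator (ball z R) \<zeta> / norm (\<zeta> - z))"
    by (simp add: lborel_distr_plus)
  have "(\<integral>\<zeta>. indicator (ball z R) \<zeta> / norm (\<zeta> - z) \<partial>lborel)
     = (\<integral>\<zeta>. indicator (ball z R) \<zeta> / norm (\<zeta> - z) \<partial>distr lborel borel ((+) z))"
    by (simp add: lborel_distr_plus)
  also have "\<dots> = (\<integral>\<zeta>. indicator (ball (0::complex) R) \<zeta> / norm \<zeta> \<partial>lborel)"
    by (subst integral_distr) (measurable, simp only: eq)
  finally show "R > 0 \<Longrightarrow> (\<integral>\<zeta>. indicator (ball z R) \<zeta> / norm (\<zeta> - z) \<partial>lborel) \<le> 2 * pi * R"
    using integrable_inverse_norm_ball_0(2)[of R] by simp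
qed

lemma integrable_Cauchy_kernel:
  fixes z :: complex
  assumes D: "D \<in> sets borel" "D \<subseteq> ball 0 R"
  shows "integrable lborel (\<lambda>\<zeta>. indicator D \<zeta> *\<^sub>R (1 / (\<zeta> - z)))"
proof (rule Bochner_Integration.integrable_bound[OF integrable_inverse_norm_ball(1)[of z "R + norm z"]])
  show "(\<lambda>\<zeta>. indicator D \<zeta> *\<^sub>R (1 / (\<zeta> - z))) \<in> borel_measurable lborel"
    using D(1) by measurable
  have "\<zeta> \<in> ball z (R + norm z)" if "\<zeta> \<in> D" for \<zeta>
    using D(2) that norm_triangle_ineq4[of \<zeta> z] by (auto simp: dist_norm norm_minus_commute)
  then show "AE \<zeta> in lborel. norm (indicator D \<zeta> *\<^sub>R (1 / (\<zeta> - z))) \<le> norm (indicator (ball z (R + norm z)) \<zeta> / norm (\<zeta> - z))"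
    by (intro AE_I2) (auto simp: indicator_def norm_divide)
qed

text \<open>Within \<open>ball z s\<close> the kernel integrates to at most
  \<open>2 * pi * s\<close>; beyond it the kernel is at most \<open>1 / s\<close>. The free radius
  \<open>s\<close> is later set to \<open>sqrt t0\<close>.\<close>

lemma norm_Cauchy_transform_le:
  fixes z :: complex
  assumes D: "D \<in> sets borel" "D \<subseteq> ball 0 R" and s: "s > 0"
  shows "norm (\<integral>\<zeta>. indicator D \<zeta> *\<^sub>R (1 / (\<zeta> - z)) \<partial>lborel) \<le> 2 * pi * s + measure lborel D / s"
proof -
  have fin: "emeasure lborel D < \<infinity>"
    by (rule le_less_trans[OF emeasure_mono[OF D(2)]]) (use emeasure_bounded_finite[OF bounded_ball] in auto)
  have iD: "integrable lborel (\<lambda>\<zeta>. indicator D \<zeta> / s)"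
    using D(1) fin by (intro integrable_divide_zero integrable_real_indicator) auto
  have "norm (\<integral>\<zeta>. indicator D \<zeta> *\<^sub>R (1 / (\<zeta> - z)) \<partial>lborel)
      \<le> (\<integral>\<zeta>. norm (indicator D \<zeta> *\<^sub>R (1 / (\<zeta> - z))) \<partial>lborel)"
    by (rule integral_norm_bound)
  also have "\<dots> \<le> (\<integral>\<zeta>. indicator (ball z s) \<zeta> / norm (\<zeta> - z) + indicator D \<zeta> / s \<partial>lborel)"
  proof (rule integral_mono)
    show "integrable lborel (\<lambda>\<zeta>. norm (indicator D \<zeta> *\<^sub>R (1 / (\<zeta> - z))))"
      by (intro integrable_norm integrable_Cauchy_kernel[OF D])
    show "integrable lborel (\<lambda>\<zeta>. indicator (ball z s) \<zeta> / norm (\<zeta> - z) + indicator D \<zeta> / s)"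
      by (intro Bochner_Integration.integrable_add integrable_inverse_norm_ball iD)
    show "norm (indicator D \<zeta> *\<^sub>R (1 / (\<zeta> - z))) \<le> indicator (ball z s) \<zeta> / norm (\<zeta> - z) + indicator D \<zeta> / s" for \<zeta>
      using s by (cases "\<zeta> = z") (auto simp: indicator_def dist_norm norm_minus_commute norm_divide field_simps)
  qed
  also have "\<dots> = (\<integral>\<zeta>. indicator (ball z s) \<zeta> / norm (\<zeta> - z) \<partial>lborel) + measure lborel D / s"
    using iD D(1) fin by (subst Bochner_Integration.integral_add) (auto intro: integrable_inverse_norm_ball)
  also have "\<dots> \<le> 2 * pi * s + measure lborel D / s"
    using integrable_inverse_norm_ball(2)[OF s] by simp
  finally show ?thesis .
qed

section \<open>The Cauchy transform of a disc\<close>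

definition disc_transform :: "real \<Rightarrow> complex \<Rightarrow> complex" where
  "disc_transform R z = (\<integral>\<zeta>. indicator (ball 0 R) \<zeta> *\<^sub>R (1 / (\<zeta> - z)) \<partial>lborel)"

text \<open>The substitution of \<open>c * \<zeta>\<close> preserves the measure and the disc and
  pulls a factor \<open>1 / c\<close> out of the kernel. Thus one value determines the transform on
  a whole circle about 0.\<close>

lemma disc_transform_rotation:
  assumes "norm c = 1"
  shows "c * disc_transform R (c * z) = disc_transform R z"
proof -
  have c0: "c \<noteq> 0" using assms by auto
  have "disc_transform R (c * z) = (\<integral>\<zeta>. indicator (ball 0 R) \<zeta> *\<^sub>R (1 / (\<zeta> - c * z)) \<partial>distr lborel borel ((*) c))"
    by (simp add: disc_transform_def distr_lborel_rotation[OF assms])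
  also have "\<dots> = (\<integral>\<zeta>. indicator (ball 0 R) (c * \<zeta>) *\<^sub>R (1 / (c * \<zeta> - c * z)) \<partial>lborel)"
    by (rule integral_distr) measurable
  also have "\<dots> = (\<integral>\<zeta>. (1 / c) * indicator (ball 0 R) \<zeta> *\<^sub>R (1 / (\<zeta> - z)) \<partial>lborel)"
    using c0 assms by (intro Bochner_Integration.integral_cong)
      (auto simp: indicator_def norm_mult right_diff_distrib[symmetric])
  also have "\<dots> = (1 / c) * disc_transform R z"
    unfolding disc_transform_def by (rule Bochner_Integration.integral_mult_right_zero)
  finally show ?thesis using c0 by simp
qed

text \<open>The kernel is singular where \<open>\<zeta>\<close> meets the curve, but its absolute
  integral over the ball is bounded uniformly in \<open>x\<close>, so the double integral converges
  absolutely. As \<open>J\<close> is prescribed only off the null set \<open>N\<close>, the curve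
  and a further pole can be left out. The lemma serves for circles, which yields the value of
  \<open>disc_transform\<close>, and then for general loops, where that value is put in.\<close>

lemma Cauchy_kernel_Fubini:
  fixes u \<gamma> :: "real \<Rightarrow> complex"
  assumes R: "R > 0" and u: "continuous_on {0..1} u" and g: "continuous_on {0..1} \<gamma>"
    and null: "negligible N" "\<gamma> ` {0..1} \<subseteq> N"
    and J: "J \<in> borel_measurable borel"
    and J_eq: "\<And>\<zeta>. norm \<zeta> < R \<Longrightarrow> \<zeta> \<notin> N \<Longrightarrow> J \<zeta> = integral {0..1} (\<lambda>x. u x / (\<zeta> - \<gamma> x))"
  shows "(\<integral>\<zeta>. indicator (ball 0 R) \<zeta> *\<^sub>R J \<zeta> \<partial>lborel) = integral {0..1} (\<lambda>x. u x * disc_transform R (\<gamma> x))"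
proof -
  \<comment> \<open>Extension by zero makes both functions Borel on the whole line, so that Fubini
    applies to two full Lebesgue measures.\<close>
  define u' \<gamma>' where "u' x = indicator {0..1} x *\<^sub>R u x" and "\<gamma>' x = indicator {0..1} x *\<^sub>R \<gamma> x" for x
  define k where "k x \<zeta> = u' x * (indicator (ball 0 R) \<zeta> *\<^sub>R (1 / (\<zeta> - \<gamma>' x)))" for x \<zeta>
  have u'_eq [simp]: "x \<in> {0..1} \<Longrightarrow> u' x = u x" "x \<notin> {0..1} \<Longrightarrow> u' x = 0" for x by (auto simp: u'_def)
  have \<gamma>'_eq [simp]: "x \<in> {0..1} \<Longrightarrow> \<gamma>' x = \<gamma> x" for x by (auto simp: \<gamma>'_def)
  have [measurable]: "u' \<in> borel_measurable borel" "\<gamma>' \<in> borel_measurable borel"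
    using u g by (auto intro!: borel_measurable_continuous_on_indicator simp: u'_def[abs_def] \<gamma>'_def[abs_def])
  have [measurable]: "case_prod k \<in> borel_measurable (lborel \<Otimes>\<^sub>M lborel)"
    unfolding k_def by measurable
  note [measurable] = J
  obtain U where U: "\<And>x. x \<in> {0..1} \<Longrightarrow> norm (u x) \<le> U"
    using compact_imp_bounded[OF compact_continuous_image[OF u compact_Icc]] by (fastforce simp: bounded_iff)
  obtain G where G: "\<And>x. x \<in> {0..1} \<Longrightarrow> norm (\<gamma> x) \<le> G"
    using compact_imp_bounded[OF compact_continuous_image[OF g compact_Icc]] by (fastforce simp: bounded_iff)
  have k_eq: "(\<integral>\<zeta>. k x \<zeta> \<partial>lborel) = indicator {0..1} x *\<^sub>R (u x * disc_transform R (\<gamma> x))" for x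
  proof (cases "x \<in> {0..1}")
    case True
    have "(\<integral>\<zeta>. k x \<zeta> \<partial>lborel) = u' x * (\<integral>\<zeta>. indicator (ball 0 R) \<zeta> *\<^sub>R (1 / (\<zeta> - \<gamma>' x)) \<partial>lborel)"
      unfolding k_def by (rule Bochner_Integration.integral_mult_right_zero)
    then show ?thesis unfolding disc_transform_def using True by (simp only: u'_eq \<gamma>'_eq) simp
  qed (simp add: k_def)
  have k_int: "integrable lborel (k x)" for x
    unfolding k_def by (intro integrable_mult_right integrable_Cauchy_kernel) auto
  have k_norm: "(\<integral>\<zeta>. norm (k x \<zeta>) \<partial>lborel) \<le> indicator {0..1} x * (U * (2 * pi * (R + G)))" for x
  proof (cases "x \<in> {0..1}")
    case True
    let ?z = "\<gamma> x"
    have U0: "0 \<le> U" and G0: "0 \<le> G" using U[OF True] G[OF True] by (metis norm_ge_zero order_trans)+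
    have "(\<integral>\<zeta>. norm (k x \<zeta>) \<partial>lborel) \<le> (\<integral>\<zeta>. U * (indicator (ball ?z (R + G)) \<zeta> / norm (\<zeta> - ?z)) \<partial>lborel)"
    proof (rule integral_mono)
      show "integrable lborel (\<lambda>\<zeta>. norm (k x \<zeta>))" by (intro integrable_norm k_int)
      show "integrable lborel (\<lambda>\<zeta>. U * (indicator (ball ?z (R + G)) \<zeta> / norm (\<zeta> - ?z)))"
        by (intro integrable_mult_right integrable_inverse_norm_ball)
      fix \<zeta> :: complex
      show "norm (k x \<zeta>) \<le> U * (indicator (ball ?z (R + G)) \<zeta> / norm (\<zeta> - ?z))"
      proof (cases "norm \<zeta> < R")
        case in_ball: True
        have "norm (\<zeta> - ?z) < R + G" using in_ball G[OF True] norm_triangle_ineq4[of \<zeta> ?z] by linarith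
        then have "norm (k x \<zeta>) = norm (u x) * (indicator (ball ?z (R + G)) \<zeta> / norm (\<zeta> - ?z))"
          using True in_ball by (simp add: k_def norm_mult norm_divide dist_norm norm_minus_commute)
        also have "\<dots> \<le> U * (indicator (ball ?z (R + G)) \<zeta> / norm (\<zeta> - ?z))"
          using U[OF True] by (intro mult_right_mono) auto
        finally show ?thesis .
      qed (use U0 in \<open>simp add: k_def\<close>)
    qed
    also have "\<dots> \<le> U * (2 * pi * (R + G))"
      using integrable_inverse_norm_ball(2)[of "R + G" ?z] R U0 G0
      by (subst Bochner_Integration.integral_mult_right_zero) (auto intro!: mult_left_mono)
    finally show ?thesis using True by simp
  qed (simp add: k_def)
  have int: "integrable (lborel \<Otimes>\<^sub>M lborel) (case_prod k)"
  proof (rule lborel_pair.Fubini_integrable)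
    have "integrable lborel (\<lambda>x. \<integral>\<zeta>. norm (k x \<zeta>) \<partial>lborel)"
    proof (rule Bochner_Integration.integrable_bound)
      show "integrable lborel (\<lambda>x::real. indicator {0..1} x * (U * (2 * pi * (R + G))))"
        by (intro integrable_mult_left integrable_real_indicator) auto
      show "AE x in lborel. norm (\<integral>\<zeta>. norm (k x \<zeta>) \<partial>lborel) \<le> norm (indicator {0..1} x * (U * (2 * pi * (R + G))))"
      proof (rule AE_I2)
        fix x
        have "0 \<le> (\<integral>\<zeta>. norm (k x \<zeta>) \<partial>lborel)" by simp
        then show "norm (\<integral>\<zeta>. norm (k x \<zeta>) \<partial>lborel) \<le> norm (indicator {0..1} x * (U * (2 * pi * (R + G))))"
          using k_norm[of x] by simp
      qed
    qed measurable
    then show "integrable lborel (\<lambda>x. \<integral>\<zeta>. norm (case (x, \<zeta>) of (x, \<zeta>) \<Rightarrow> k x \<zeta>) \<partial>lborel)" by simp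
  qed (auto simp: k_int)
  have swap: "(\<integral>\<zeta>. (\<integral>x. k x \<zeta> \<partial>lborel) \<partial>lborel) = (\<integral>x. (\<integral>\<zeta>. k x \<zeta> \<partial>lborel) \<partial>lborel)"
    by (rule lborel_pair.Fubini_integral[OF int])
  have inner: "(\<integral>x. k x \<zeta> \<partial>lborel) = indicator (ball 0 R) \<zeta> *\<^sub>R J \<zeta>" if "\<zeta> \<notin> N" for \<zeta>
  proof (cases "norm \<zeta> < R")
    case True
    have "continuous_on {0..1} (\<lambda>x. u x / (\<zeta> - \<gamma> x))"
      using that null(2) by (intro continuous_intros u g) auto
    then have "set_integrable lborel {0..1} (\<lambda>x. u x / (\<zeta> - \<gamma> x))"
      by (rule borel_integrable_atLeastAtMost')
    from set_borel_integral_eq_integral(2)[OF this]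
    have "integral {0..1} (\<lambda>x. u x / (\<zeta> - \<gamma> x)) = (\<integral>x. indicator {0..1} x *\<^sub>R (u x / (\<zeta> - \<gamma> x)) \<partial>lborel)"
      by (simp add: set_lebesgue_integral_def)
    also have "\<dots> = (\<integral>x. k x \<zeta> \<partial>lborel)"
      using True by (intro Bochner_Integration.integral_cong) (auto simp: k_def indicator_def)
    finally show ?thesis using J_eq[OF True that] True by simp
  qed (simp add: k_def)
  have "(\<integral>\<zeta>. indicator (ball 0 R) \<zeta> *\<^sub>R J \<zeta> \<partial>lborel) = (\<integral>\<zeta>. (\<integral>x. k x \<zeta> \<partial>lborel) \<partial>lborel)"
  proof (rule integral_cong_AE)
    have "AE \<zeta> in lebesgue. \<zeta> \<notin> N"
      using null(1) by (simp add: negligible_iff_null_sets AE_not_in)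
    then have "AE \<zeta> in lebesgue. indicator (ball 0 R) \<zeta> *\<^sub>R J \<zeta> = (\<integral>x. k x \<zeta> \<partial>lborel)"
      by eventually_elim (simp add: inner)
    then show "AE \<zeta> in lborel. indicator (ball 0 R) \<zeta> *\<^sub>R J \<zeta> = (\<integral>x. k x \<zeta> \<partial>lborel)"
      by (simp add: AE_completion_iff)
  qed measurable
  also have "\<dots> = (\<integral>x. (\<integral>\<zeta>. k x \<zeta> \<partial>lborel) \<partial>lborel)" by (rule swap)
  also have "\<dots> = (\<integral>x. indicator {0..1} x *\<^sub>R (u x * disc_transform R (\<gamma> x)) \<partial>lborel)"
    by (simp only: k_eq)
  also have "\<dots> = integral {0..1} (\<lambda>x. u x * disc_transform R (\<gamma> x))"
  proof -
    have "integrable lborel (\<lambda>x. \<integral>\<zeta>. k x \<zeta> \<partial>lborel)"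
      using lborel_pair.integrable_fst'[OF int] by simp
    also have "(\<lambda>x. \<integral>\<zeta>. k x \<zeta> \<partial>lborel) = (\<lambda>x. indicator {0..1} x *\<^sub>R (u x * disc_transform R (\<gamma> x)))"
      by (simp only: k_eq)
    finally have "set_integrable lborel {0..1} (\<lambda>x. u x * disc_transform R (\<gamma> x))"
      by (simp add: set_integrable_def)
    from set_borel_integral_eq_integral(2)[OF this] show ?thesis
      by (simp add: set_lebesgue_integral_def)
  qed
  finally show ?thesis .
qed

text \<open>The exchange of integrals is applied to the circle of radius
  \<open>\<rho> = norm z\<close>. Its winding number is the indicator of
  \<open>ball 0 \<rho>\<close>, so one side is a multiple of the area
  \<open>pi * \<rho>\<^sup>2\<close>; by rotation symmetry the integrand on the other side is
  constant. Comparison gives \<open>- pi * \<rho>\<close> at the point \<open>\<rho>\<close>, and a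
  rotation carries this to \<open>z\<close>.\<close>

lemma disc_transform_eq:
  assumes z: "norm z < R"
  shows "disc_transform R z = - of_real pi * cnj z"
proof (cases "z = 0")
  case True
  \<comment> \<open>A circle of radius 0 carries no information; here rotation by \<open>-1\<close>
    shows that the value is its own negative.\<close>
  have "disc_transform R 0 = - disc_transform R 0"
    using disc_transform_rotation[of "-1" R 0] by simp
  then show ?thesis using True by simp
next
  case False
  define \<rho> where "\<rho> = norm z"
  have \<rho>: "0 < \<rho>" "\<rho> < R" using False z by (auto simp: \<rho>_def)
  define e where "e x = exp (2 * of_real pi * \<i> * of_real x)" for x :: real
  define u where "u x = 2 * of_real pi * \<i> * of_real \<rho> * e x" for x
  have ne: "norm (e x) = 1" for x by (simp add: e_def norm_exp_eq_Re)
  have circ: "circlepath 0 \<rho> x = of_real \<rho> * e x" for x by (simp add: circlepath e_def)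
  have vd: "vector_derivative (circlepath 0 \<rho>) (at x) = u x" for x
    by (simp add: vector_derivative_circlepath u_def e_def)
  define J :: "complex \<Rightarrow> complex" where "J \<zeta> = indicator (ball 0 \<rho>) \<zeta> *\<^sub>R (- (2 * of_real pi * \<i>))" for \<zeta>
  have "(\<integral>\<zeta>. indicator (ball 0 R) \<zeta> *\<^sub>R J \<zeta> \<partial>lborel) = integral {0..1} (\<lambda>x. u x * disc_transform R (circlepath 0 \<rho> x))"
  proof (rule Cauchy_kernel_Fubini[where N = "sphere 0 \<rho>"])
    show "continuous_on {0..1} u" unfolding u_def e_def by (intro continuous_intros)
    show "continuous_on {0..1} (circlepath 0 \<rho>)" unfolding circlepath by (intro continuous_intros)
    show "circlepath 0 \<rho> ` {0..1} \<subseteq> sphere 0 \<rho>" using ne \<rho> by (auto simp: circ norm_mult)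
    show "J \<in> borel_measurable borel" unfolding J_def by measurable
    fix \<zeta> :: complex assume \<zeta>: "norm \<zeta> < R" "\<zeta> \<notin> sphere 0 \<rho>"
    have notin: "\<zeta> \<notin> path_image (circlepath 0 \<rho>)" using \<zeta>(2) \<rho> by simp
    have "integral {0..1} (\<lambda>x. u x / (\<zeta> - circlepath 0 \<rho> x))
        = integral {0..1} (\<lambda>x. - (1 / (circlepath 0 \<rho> x - \<zeta>) * vector_derivative (circlepath 0 \<rho>) (at x)))"
      unfolding vd
    proof (rule integral_cong)
      fix x
      show "u x / (\<zeta> - circlepath 0 \<rho> x) = - (1 / (circlepath 0 \<rho> x - \<zeta>) * u x)"
        by (metis (no_types) minus_diff_eq minus_divide_right mult.commute mult_1 times_divide_eq_right)
    qed
    also have "\<dots> = - contour_integral (circlepath 0 \<rho>) (\<lambda>w. 1 / (w - \<zeta>))"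
      by (simp add: contour_integral_integral)
    also have "\<dots> = - (2 * of_real pi * \<i> * winding_number (circlepath 0 \<rho>) \<zeta>)"
      using winding_number_valid_path[OF valid_path_circlepath notin] by simp
    also have "\<dots> = J \<zeta>"
    proof (cases "norm \<zeta> < \<rho>")
      case True
      then show ?thesis using winding_number_circlepath[of \<zeta> 0 \<rho>] by (simp add: J_def)
    next
      case False
      then have "winding_number (circlepath 0 \<rho>) \<zeta> = 0"
        using \<zeta>(2) \<rho> by (intro winding_number_zero_outside[of _ "cball 0 \<rho>"]) auto
      then show ?thesis using False by (simp add: J_def)
    qed
    finally show "J \<zeta> = integral {0..1} (\<lambda>x. u x / (\<zeta> - circlepath 0 \<rho> x))" ..
  qed (use \<rho> negligible_sphere in auto)
  also have "(\<lambda>x. u x * disc_transform R (circlepath 0 \<rho> x)) = (\<lambda>x. 2 * of_real pi * \<i> * of_real \<rho> * disc_transform R (of_real \<rho>))"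
  proof
    fix x
    show "u x * disc_transform R (circlepath 0 \<rho> x) = 2 * of_real pi * \<i> * of_real \<rho> * disc_transform R (of_real \<rho>)"
      using disc_transform_rotation[OF ne, of x R "of_real \<rho>"] by (simp add: u_def circ mult_ac)
  qed
  finally have "(\<integral>\<zeta>. indicator (ball 0 R) \<zeta> *\<^sub>R J \<zeta> \<partial>lborel) = 2 * of_real pi * \<i> * of_real \<rho> * disc_transform R (of_real \<rho>)"
    by simp
  moreover have "(\<integral>\<zeta>. indicator (ball 0 R) \<zeta> *\<^sub>R J \<zeta> \<partial>lborel) = (\<integral>\<zeta>. indicator (ball (0::complex) \<rho>) \<zeta> *\<^sub>R (- (2 * of_real pi * \<i>)) \<partial>lborel)"
    using \<rho> by (intro Bochner_Integration.integral_cong) (auto simp: J_def indicator_def)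
  moreover have "\<dots> = measure lborel (ball (0::complex) \<rho>) *\<^sub>R (- (2 * of_real pi * \<i>))"
    using emeasure_bounded_finite[OF bounded_ball, of "0::complex" \<rho>] by (subst Bochner_Integration.integral_scaleR_left) auto
  moreover have "measure lborel (ball (0::complex) \<rho>) = pi * \<rho>\<^sup>2"
    using \<rho> by (simp add: measure_def emeasure_complex_ball)
  ultimately have "(2 * of_real pi * \<i> * of_real \<rho>) * disc_transform R (of_real \<rho>) = (2 * of_real pi * \<i> * of_real \<rho>) * (- of_real (pi * \<rho>))"
    by (simp only: scaleR_conv_of_real of_real_mult of_real_power power2_eq_square mult_ac mult_minus_right)
  then have F\<rho>: "disc_transform R (of_real \<rho>) = - of_real (pi * \<rho>)"
    by (subst (asm) mult_left_cancel) (use \<rho> in auto)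
  define c where "c = z / of_real \<rho>"
  have nc: "norm c = 1" using \<rho> by (simp add: c_def norm_divide \<rho>_def)
  have cz: "c * of_real \<rho> = z" using \<rho> by (simp add: c_def)
  have cc: "cnj c * c = 1" using nc by (metis complex_norm_square mult.commute of_real_1 power_one)
  have "disc_transform R z = cnj c * (c * disc_transform R (c * of_real \<rho>))"
    using cc by (simp add: cz mult.assoc[symmetric])
  also have "\<dots> = - of_real pi * cnj (c * of_real \<rho>)"
    by (simp add: disc_transform_rotation[OF nc] F\<rho>)
  finally show ?thesis by (simp add: cz)
qed

section \<open>Area and Cauchy-Pompeiu formulas for a Jordan curve\<close>

text \<open>This is where \<open>cnj z\<close> enters: once the curve lies in the ball, the disc
  transform in the exchanged integral is \<open>- pi * cnj z\<close>. The density 1 gives the area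
  and \<open>1 / (z - z0)\<close> the Cauchy-Pompeiu formula; in the latter case the exceptional
  point \<open>p\<close> takes care of the pole of \<open>J\<close>.\<close>

lemma Cauchy_transform_contour_integral:
  fixes \<gamma> :: "real \<Rightarrow> complex"
  assumes R: "R > 0" and im: "path_image \<gamma> \<subseteq> ball 0 R"
    and deriv: "\<And>x. x \<in> {0..1} \<Longrightarrow> (\<gamma> has_vector_derivative \<gamma>' x) (at x)"
    and cont: "continuous_on {0..1} \<gamma>'"
    and \<psi>: "continuous_on (path_image \<gamma>) \<psi>"
    and J: "J \<in> borel_measurable borel"
    and J_eq: "\<And>\<zeta>. norm \<zeta> < R \<Longrightarrow> \<zeta> \<notin> path_image \<gamma> \<Longrightarrow> \<zeta> \<noteq> p \<Longrightarrow> J \<zeta> = contour_integral \<gamma> (\<lambda>z. \<psi> z / (\<zeta> - z))"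
  shows "(\<integral>\<zeta>. indicator (ball 0 R) \<zeta> *\<^sub>R J \<zeta> \<partial>lborel) = - of_real pi * contour_integral \<gamma> (\<lambda>z. \<psi> z * cnj z)"
proof -
  have vd: "vector_derivative \<gamma> (at x) = \<gamma>' x" if "x \<in> {0..1}" for x
    using deriv[OF that] by (rule vector_derivative_at)
  have cont_\<gamma>: "continuous_on {0..1} \<gamma>"
    by (meson continuous_at_imp_continuous_on deriv has_vector_derivative_continuous)
  have "(\<integral>\<zeta>. indicator (ball 0 R) \<zeta> *\<^sub>R J \<zeta> \<partial>lborel) = integral {0..1} (\<lambda>x. (\<psi> (\<gamma> x) * \<gamma>' x) * disc_transform R (\<gamma> x))"
  proof (rule Cauchy_kernel_Fubini[where N = "insert p (path_image \<gamma>)"])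
    show "continuous_on {0..1} (\<lambda>x. \<psi> (\<gamma> x) * \<gamma>' x)"
      using \<psi> by (intro continuous_on_mult cont continuous_on_compose2[OF \<psi> cont_\<gamma>]) (auto simp: path_image_def)
    have "\<gamma> differentiable_on {0..1}"
      using deriv by (meson differentiable_at_imp_differentiable_on has_vector_derivative_def differentiable_def)
    then have "negligible (\<gamma> ` {0..1})"
      by (intro negligible_differentiable_image_lowdim) simp_all
    then show "negligible (insert p (path_image \<gamma>))" by (simp add: path_image_def)
    fix \<zeta> assume "norm \<zeta> < R" "\<zeta> \<notin> insert p (path_image \<gamma>)"
    then show "J \<zeta> = integral {0..1} (\<lambda>x. \<psi> (\<gamma> x) * \<gamma>' x / (\<zeta> - \<gamma> x))"
      using J_eq[of \<zeta>] by (auto simp: contour_integral_integral vd intro!: integral_cong)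
  qed (use R J cont_\<gamma> in \<open>auto simp: path_image_def\<close>)
  also have "\<dots> = integral {0..1} (\<lambda>x. - of_real pi * (\<psi> (\<gamma> x) * cnj (\<gamma> x) * vector_derivative \<gamma> (at x)))"
  proof (rule integral_cong)
    fix x :: real assume x: "x \<in> {0..1}"
    then have "norm (\<gamma> x) < R" using im by (force simp: path_image_def)
    then show "\<psi> (\<gamma> x) * \<gamma>' x * disc_transform R (\<gamma> x) = - of_real pi * (\<psi> (\<gamma> x) * cnj (\<gamma> x) * vector_derivative \<gamma> (at x))"
      using x by (simp add: vd disc_transform_eq)
  qed
  finally show ?thesis
    by (simp add: contour_integral_integral)
qed

context
  fixes \<gamma> \<gamma>' :: "real \<Rightarrow> complex"
  assumes deriv: "\<And>x. x \<in> {0..1} \<Longrightarrow> (\<gamma> has_vector_derivative \<gamma>' x) (at x)"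
    and cont: "continuous_on {0..1} \<gamma>'"
    and valid: "valid_path \<gamma>"
    and simple: "simple_path \<gamma>"
    and closed: "pathfinish \<gamma> = pathstart \<gamma>"
    and positive: "\<And>z. z \<in> inside (path_image \<gamma>) \<Longrightarrow> winding_number \<gamma> z = 1"
begin

lemma loop_winding_integral:
  assumes "\<zeta> \<notin> path_image \<gamma>"
  shows "contour_integral \<gamma> (\<lambda>z. 1 / (\<zeta> - z)) = indicator (inside (path_image \<gamma>)) \<zeta> *\<^sub>R (- (2 * of_real pi * \<i>))"
proof -
  have "winding_number \<gamma> \<zeta> = indicator (inside (path_image \<gamma>)) \<zeta>"
  proof (cases "\<zeta> \<in> inside (path_image \<gamma>)")
    case False
    then have "\<zeta> \<in> outside (path_image \<gamma>)" using assms inside_Un_outside by blast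
    then show ?thesis
      using False winding_number_zero_in_outside[OF simple_path_imp_path[OF simple] closed] by simp
  qed (simp add: positive)
  moreover have "contour_integral \<gamma> (\<lambda>z. 1 / (\<zeta> - z)) = - contour_integral \<gamma> (\<lambda>z. 1 / (z - \<zeta>))"
  proof -
    have "(\<lambda>z. 1 / (\<zeta> - z)) = (\<lambda>z. - (1 / (z - \<zeta>)))"
      by (metis minus_diff_eq minus_divide_right)
    then show ?thesis
      by (simp add: contour_integral_integral)
  qed
  ultimately show ?thesis
    using winding_number_valid_path[OF valid assms] by (auto simp: indicator_def field_simps split: if_splits)
qed

lemma loop_inside:
  "open (inside (path_image \<gamma>))" "inside (path_image \<gamma>) \<in> sets borel" "bounded (inside (path_image \<gamma>))"
  using Jordan_inside_outside[OF simple closed] by auto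

lemma loop_ball:
  obtains R where "R > 0" "path_image \<gamma> \<subseteq> ball 0 R" "inside (path_image \<gamma>) \<subseteq> ball 0 R"
proof -
  have "bounded (path_image \<gamma> \<union> inside (path_image \<gamma>))"
    using loop_inside bounded_path_image[OF simple_path_imp_path[OF simple]] by simp
  then obtain R where "R > 0" "path_image \<gamma> \<union> inside (path_image \<gamma>) \<subseteq> ball 0 R"
    using bounded_subset_ballD by blast
  then show ?thesis using that by auto
qed

text \<open>With density 1 the inner contour integral is \<open>-2 pi i\<close> times the indicator
  of the inside, so its plane integral is a multiple of the area.\<close>

lemma area_inside:
  "2 * \<i> * of_real (measure lebesgue (inside (path_image \<gamma>))) = contour_integral \<gamma> cnj"
proof -
  define D where "D = inside (path_image \<gamma>)"
  obtain R where R: "R > 0" "path_image \<gamma> \<subseteq> ball 0 R" "D \<subseteq> ball 0 R"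
    using loop_ball D_def by metis
  note [measurable] = loop_inside(2)[folded D_def]
  have fin: "emeasure lborel D < \<infinity>" using emeasure_bounded_finite[OF loop_inside(3)] by (simp add: D_def)
  define J :: "complex \<Rightarrow> complex" where "J \<zeta> = indicator D \<zeta> *\<^sub>R (- (2 * of_real pi * \<i>))" for \<zeta>
  have "(\<integral>\<zeta>. indicator (ball 0 R) \<zeta> *\<^sub>R J \<zeta> \<partial>lborel) = - of_real pi * contour_integral \<gamma> (\<lambda>z. 1 * cnj z)"
    by (rule Cauchy_transform_contour_integral[OF R(1,2) deriv cont])
      (auto simp: J_def loop_winding_integral[folded D_def])
  also have "(\<integral>\<zeta>. indicator (ball 0 R) \<zeta> *\<^sub>R J \<zeta> \<partial>lborel) = (\<integral>\<zeta>. J \<zeta> \<partial>lborel)"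
    using R(3) by (intro Bochner_Integration.integral_cong) (auto simp: J_def indicator_def)
  also have "\<dots> = measure lborel D *\<^sub>R (- (2 * of_real pi * \<i>))"
    unfolding J_def using fin by (subst Bochner_Integration.integral_scaleR_left) auto
  finally show ?thesis
    by (simp add: D_def[symmetric] scaleR_conv_of_real mult_ac)
qed

text \<open>With density \<open>1 / (z - z0)\<close>, partial fractions turn the inner contour
  integral into \<open>1 / (\<zeta> - z0)\<close> times the difference of the winding integrals at
  \<open>\<zeta>\<close> and \<open>z0\<close>. The difference vanishes for \<open>\<zeta>\<close>
  inside and is \<open>2 pi i\<close> outside, so the plane integral runs over the ball minus the
  inside, and the ball contributes its known transform. No small disc around \<open>z0\<close> has
  to be cut out.\<close>

lemma Cauchy_Pompeiu_inside:
  assumes z0: "z0 \<in> inside (path_image \<gamma>)"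
  shows "(\<integral>\<zeta>. indicator (inside (path_image \<gamma>)) \<zeta> *\<^sub>R (1 / (\<zeta> - z0)) \<partial>lborel)
     = contour_integral \<gamma> (\<lambda>z. cnj z / (z - z0)) / (2 * \<i>) - of_real pi * cnj z0"
proof -
  define D where "D = inside (path_image \<gamma>)"
  obtain R where R: "R > 0" "path_image \<gamma> \<subseteq> ball 0 R" "D \<subseteq> ball 0 R"
    using loop_ball D_def by metis
  note [measurable] = loop_inside(2)[folded D_def]
  have z0': "z0 \<notin> path_image \<gamma>" using z0 inside_no_overlap by blast
  define I where "I A = (\<integral>\<zeta>. indicator A \<zeta> *\<^sub>R (1 / (\<zeta> - z0)) \<partial>lborel)" for A
  define J where "J \<zeta> = (2 * of_real pi * \<i>) * (indicator (- D) \<zeta> *\<^sub>R (1 / (\<zeta> - z0)))" for \<zeta>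
  have eq: "(\<integral>\<zeta>. indicator (ball 0 R) \<zeta> *\<^sub>R J \<zeta> \<partial>lborel) = - of_real pi * contour_integral \<gamma> (\<lambda>z. 1 / (z - z0) * cnj z)"
  proof (rule Cauchy_transform_contour_integral[OF R(1,2) deriv cont, where p = z0])
    show "continuous_on (path_image \<gamma>) (\<lambda>z. 1 / (z - z0))"
      using z0' by (intro continuous_intros) auto
    show "J \<in> borel_measurable borel" unfolding J_def by measurable
    fix \<zeta> assume \<zeta>: "norm \<zeta> < R" "\<zeta> \<notin> path_image \<gamma>" "\<zeta> \<noteq> z0"
    have integrable: "(\<lambda>z. 1 / (w - z)) contour_integrable_on \<gamma>" if "w \<notin> path_image \<gamma>" for w
    proof -
      have "(\<lambda>z. - (1 / (z - w))) contour_integrable_on \<gamma>"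
        using contour_integrable_inversediff[OF valid that] by (rule contour_integrable_neg)
      then show ?thesis by (metis (no_types, lifting) contour_integrable_eq minus_diff_eq minus_divide_right)
    qed
    have "contour_integral \<gamma> (\<lambda>z. 1 / (z - z0) / (\<zeta> - z))
       = contour_integral \<gamma> (\<lambda>z. 1 / (\<zeta> - z0) * (1 / (\<zeta> - z) - 1 / (z0 - z)))"
    proof (rule contour_integral_eq)
      fix z assume "z \<in> path_image \<gamma>"
      then have "z \<noteq> z0" "z \<noteq> \<zeta>" using z0' \<zeta> by auto
      then show "1 / (z - z0) / (\<zeta> - z) = 1 / (\<zeta> - z0) * (1 / (\<zeta> - z) - 1 / (z0 - z))"
        using \<zeta>(3) by (simp add: divide_simps) (simp add: algebra_simps)
    qed
    also have "\<dots> = 1 / (\<zeta> - z0) * (contour_integral \<gamma> (\<lambda>z. 1 / (\<zeta> - z)) - contour_integral \<gamma> (\<lambda>z. 1 / (z0 - z)))"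
      using integrable[OF \<zeta>(2)] integrable[OF z0']
      by (simp only: contour_integral_lmul contour_integral_diff contour_integrable_diff)
    also have "\<dots> = J \<zeta>"
      using z0 by (simp add: loop_winding_integral \<zeta>(2) z0' J_def D_def indicator_def)
    finally show "J \<zeta> = contour_integral \<gamma> (\<lambda>z. 1 / (z - z0) / (\<zeta> - z))" ..
  qed
  have "(\<integral>\<zeta>. indicator (ball 0 R) \<zeta> *\<^sub>R J \<zeta> \<partial>lborel)
     = (\<integral>\<zeta>. (2 * of_real pi * \<i>) * (indicator (ball 0 R) \<zeta> *\<^sub>R (1 / (\<zeta> - z0)) - indicator D \<zeta> *\<^sub>R (1 / (\<zeta> - z0))) \<partial>lborel)"
    using R(3) by (intro Bochner_Integration.integral_cong) (auto simp: J_def indicator_def)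
  also have "\<dots> = (2 * of_real pi * \<i>) * (I (ball 0 R) - I D)"
    unfolding I_def
    by (subst Bochner_Integration.integral_mult_right_zero, subst Bochner_Integration.integral_diff)
      (use integrable_Cauchy_kernel[of "ball 0 R" R z0] integrable_Cauchy_kernel[of D R z0] R(3) in auto)
  also have "I (ball 0 R) = - of_real pi * cnj z0"
    using disc_transform_eq[of z0 R] z0 R(3) by (auto simp: disc_transform_def I_def D_def)
  finally have "of_real pi * (2 * \<i> * (- of_real pi * cnj z0 - I D)) = of_real pi * (- contour_integral \<gamma> (\<lambda>z. cnj z / (z - z0)))"
    using eq by (simp add: mult_ac)
  then have "2 * \<i> * (- of_real pi * cnj z0 - I D) = - contour_integral \<gamma> (\<lambda>z. cnj z / (z - z0))"
    by (subst (asm) mult_left_cancel) auto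
  then show ?thesis
    unfolding I_def[symmetric] D_def[symmetric] by (simp add: field_simps)
qed

text \<open>The difference is \<open>-1 / pi\<close> times the Cauchy transform of the inside.
  Splitting at radius \<open>sqrt t0\<close> bounds that transform by
  \<open>2 * pi * sqrt t0 + pi * sqrt t0\<close>, whence the factor 3.\<close>

lemma Cauchy_integral_cnj_bound:
  assumes area: "measure lebesgue (inside (path_image \<gamma>)) = pi * t0" and t0: "t0 > 0"
    and z0: "z0 \<in> inside (path_image \<gamma>)"
  shows "norm (cnj z0 - contour_integral \<gamma> (\<lambda>z. cnj z / (z - z0)) / (2 * of_real pi * \<i>)) \<le> 3 * sqrt t0"
proof -
  define D where "D = inside (path_image \<gamma>)"
  define I where "I = (\<integral>\<zeta>. indicator D \<zeta> *\<^sub>R (1 / (\<zeta> - z0)) \<partial>lborel)"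
  obtain R where R: "R > 0" "path_image \<gamma> \<subseteq> ball 0 R" "D \<subseteq> ball 0 R"
    using loop_ball D_def by metis
  have "measure lborel D = pi * t0"
    using area loop_inside(2) by (simp add: D_def)
  then have "norm I \<le> 2 * pi * sqrt t0 + pi * t0 / sqrt t0"
    using norm_Cauchy_transform_le[of D R "sqrt t0" z0] loop_inside(2) R(3) t0 by (simp add: D_def I_def)
  also have "\<dots> = pi * (3 * sqrt t0)"
    using t0 by (simp add: real_div_sqrt field_simps)
  finally have "norm I \<le> pi * (3 * sqrt t0)" .
  moreover have "cnj z0 - contour_integral \<gamma> (\<lambda>z. cnj z / (z - z0)) / (2 * of_real pi * \<i>) = - I / of_real pi"
  proof -
    define c where "c = contour_integral \<gamma> (\<lambda>z. cnj z / (z - z0))"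
    have "c / (2 * of_real pi * \<i>) = c / (2 * \<i>) / of_real pi"
      by (simp only: divide_divide_eq_left mult_ac)
    then show ?thesis
      unfolding I_def D_def Cauchy_Pompeiu_inside[OF z0] c_def[symmetric]
      by (simp only: diff_divide_distrib minus_divide_left[symmetric] minus_diff_eq) simp
  qed
  ultimately show ?thesis
    by (simp only: norm_divide norm_minus_cancel) (simp add: field_simps)
qed

end

section \<open>Laurent polynomials on the unit circle\<close>

abbreviation unit_circle :: "real \<Rightarrow> complex" where "unit_circle \<equiv> circlepath 0 1"

lemma norm_unit_circle [simp]: "norm (unit_circle x) = 1"
  by (simp add: circlepath norm_exp_eq_Re)

lemma unit_circle_nonzero [simp]: "unit_circle x \<noteq> 0"
  using norm_unit_circle[of x] by (metis norm_zero zero_neq_one)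

lemma circle_integrable:
  "continuous_on (sphere 0 1) f \<Longrightarrow> f contour_integrable_on unit_circle"
  by (intro contour_integrable_continuous_circlepath) simp

lemma circle_integral_cong:
  "(\<And>w. norm w = 1 \<Longrightarrow> f w = g w) \<Longrightarrow> contour_integral unit_circle f = contour_integral unit_circle g"
  by (rule contour_integral_eq) simp

text \<open>The substitution reverses the circle and has derivative \<open>- 1 / u\<^sup>2\<close>;
  the two signs cancel. It moves behaviour at infinity to the origin, where Cauchy's theorem in the
  disc applies.\<close>

lemma circle_integral_inversion:
  "contour_integral unit_circle f = contour_integral unit_circle (\<lambda>u. f (1 / u) / u\<^sup>2)"
proof -
  have eq: "(\<lambda>u. 1 / u) \<circ> unit_circle = reversepath unit_circle"
    by (auto simp: fun_eq_iff reversepath_def circlepath exp_diff right_diff_distrib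
        exp_minus divide_inverse exp_two_pi_i')
  have "- contour_integral unit_circle f = contour_integral (reversepath unit_circle) f"
    by (simp add: contour_integral_reversepath)
  also have "\<dots> = contour_integral unit_circle (\<lambda>u. deriv (\<lambda>u. 1 / u) u * f (1 / u))"
    unfolding eq[symmetric]
    by (rule contour_integral_comp_analyticW[where s = "-{0}"])
      (auto intro!: analytic_intros)
  also have "\<dots> = contour_integral unit_circle (\<lambda>u. - (f (1 / u) / u\<^sup>2))"
  proof (rule circle_integral_cong)
    fix u :: complex assume "norm u = 1"
    then have "u \<noteq> 0" by auto
    then have "((\<lambda>u. 1 / u) has_field_derivative - 1 / u\<^sup>2) (at u)"
      by (auto intro!: derivative_eq_intros simp: power2_eq_square)
    then show "deriv (\<lambda>u. 1 / u) u * f (1 / u) = - (f (1 / u) / u\<^sup>2)"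
      by (simp add: DERIV_imp_deriv)
  qed
  finally show ?thesis by (simp add: contour_integral_integral)
qed

lemma circle_integral_holomorphic:
  "f holomorphic_on cball 0 1 \<Longrightarrow> contour_integral unit_circle f = 0"
  by (rule contour_integral_unique, rule Cauchy_theorem_convex_simple[of _ "cball 0 1"]) auto

lemma circle_integral_simple_pole:
  assumes "f holomorphic_on cball 0 1"
  shows "contour_integral unit_circle (\<lambda>w. f w / w) = 2 * of_real pi * \<i> * f 0"
proof -
  have "((\<lambda>w. f w / (w - 0)) has_contour_integral (2 * pi * \<i> * winding_number unit_circle 0 * f 0)) unit_circle"
    by (rule Cauchy_integral_formula_convex_simple[of "cball 0 1"]) (use assms in auto)
  then show ?thesis
    by (simp add: contour_integral_unique winding_number_circlepath_centre)
qed

text \<open>Quotients of natural powers stand for integer powers of \<open>w\<close>. Exponents from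
  0 on are holomorphic, \<open>-1\<close> gives the residue, and inversion makes exponents up to
  \<open>-2\<close> nonnegative.\<close>

lemma circle_integral_monomial:
  "contour_integral unit_circle (\<lambda>w. w ^ i / w ^ l) = (if l = Suc i then 2 * of_real pi * \<i> else 0)"
proof -
  consider "l \<le> i" | "l = Suc i" | n where "l = i + 2 + n"
    by (metis add_2_eq_Suc' add_Suc_right le_Suc_ex not_less_eq_eq order_antisym_conv le_add1 not_less_eq_eq add_Suc nat_le_linear)
  then show ?thesis
  proof cases
    case 1
    have "contour_integral unit_circle (\<lambda>w. w ^ i / w ^ l) = contour_integral unit_circle (\<lambda>w. w ^ (i - l))"
    proof (rule circle_integral_cong)
      fix w :: complex assume "norm w = 1"
      then have "w \<noteq> 0" by auto
      then show "w ^ i / w ^ l = w ^ (i - l)" using 1 by (simp add: power_diff)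
    qed
    also have "\<dots> = 0" by (rule circle_integral_holomorphic) (intro holomorphic_intros)
    finally show ?thesis using 1 by simp
  next
    case 2
    have "contour_integral unit_circle (\<lambda>w. w ^ i / w ^ l) = contour_integral unit_circle (\<lambda>w. 1 / w)"
      by (intro circle_integral_cong) (auto simp: 2)
    then show ?thesis using 2 circle_integral_simple_pole[of "\<lambda>_. 1"] by simp
  next
    case (3 n)
    have "contour_integral unit_circle (\<lambda>w. w ^ i / w ^ l) = contour_integral unit_circle (\<lambda>u. (1 / u) ^ i / (1 / u) ^ l / u\<^sup>2)"
      by (rule circle_integral_inversion)
    also have "\<dots> = contour_integral unit_circle (\<lambda>u. u ^ n)"
    proof (rule circle_integral_cong)
      fix u :: complex assume "norm u = 1"
      then have "u \<noteq> 0" by auto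
      then show "(1 / u) ^ i / (1 / u) ^ l / u\<^sup>2 = u ^ n"
        by (simp add: 3 power_add power_divide field_simps power2_eq_square)
    qed
    also have "\<dots> = 0" by (rule circle_integral_holomorphic) (intro holomorphic_intros)
    finally show ?thesis using 3 by simp
  qed
qed

lemma circle_integral_poly_quotient:
  assumes f: "continuous_on (sphere 0 1) f"
  shows "contour_integral unit_circle (\<lambda>w. poly p w / w ^ M * f w)
       = (\<Sum>i\<le>degree p. coeff p i * contour_integral unit_circle (\<lambda>w. w ^ i / w ^ M * f w))"
proof -
  have int: "(\<lambda>w. w ^ i / w ^ M * f w) contour_integrable_on unit_circle" for i
    by (intro circle_integrable continuous_intros f) auto
  have "contour_integral unit_circle (\<lambda>w. poly p w / w ^ M * f w)
      = contour_integral unit_circle (\<lambda>w. \<Sum>i\<le>degree p. coeff p i * (w ^ i / w ^ M * f w))"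
    by (simp add: poly_altdef sum_divide_distrib sum_distrib_right mult.assoc)
  also have "\<dots> = (\<Sum>i\<le>degree p. contour_integral unit_circle (\<lambda>w. coeff p i * (w ^ i / w ^ M * f w)))"
    by (intro contour_integral_sum contour_integrable_lmul int) auto
  also have "\<dots> = (\<Sum>i\<le>degree p. coeff p i * contour_integral unit_circle (\<lambda>w. w ^ i / w ^ M * f w))"
    by (simp only: contour_integral_lmul[OF int])
  finally show ?thesis .
qed

section \<open>Fourier coefficients and zeros of polynomials in the disc\<close>

text \<open>Only nonnegative powers are addressed. On the circle
  \<open>cnj (laurent_map d r a w)\<close> equals \<open>r / w + \<Sum> cnj (a j) * w ^ j\<close>,
  so these are exactly the powers that carry the unknowns.\<close>

definition fourier_coeff :: "nat \<Rightarrow> (complex \<Rightarrow> complex) \<Rightarrow> complex" where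
  "fourier_coeff j f = contour_integral unit_circle (\<lambda>w. f w / w ^ Suc j) / (2 * of_real pi * \<i>)"

lemma fourier_coeff_cong:
  "(\<And>w. norm w = 1 \<Longrightarrow> f w = g w) \<Longrightarrow> fourier_coeff j f = fourier_coeff j g"
  unfolding fourier_coeff_def by (intro arg_cong2[of _ _ _ _ "(/)"] circle_integral_cong) auto

text \<open>Laurent polynomials are carried as \<open>poly p w / w ^ M\<close> with natural
  \<open>M\<close>, so that degree arguments can use polynomials; the shift by \<open>M\<close>
  recovers the true exponent.\<close>

lemma fourier_coeff_poly_quotient:
  "fourier_coeff j (\<lambda>w. poly p w / w ^ M) = coeff p (M + j)"
proof -
  have "contour_integral unit_circle (\<lambda>w. poly p w / w ^ M / w ^ Suc j)
     = contour_integral unit_circle (\<lambda>w. poly p w / w ^ (M + Suc j) * 1)"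
    by (simp add: power_add mult_ac)
  also have "\<dots> = (\<Sum>i\<le>degree p. coeff p i * (if M + Suc j = Suc i then 2 * of_real pi * \<i> else 0))"
    by (subst circle_integral_poly_quotient)
      (simp_all only: mult_1_right circle_integral_monomial continuous_on_const)
  also have "\<dots> = (\<Sum>i\<le>degree p. if i = M + j then coeff p i * (2 * of_real pi * \<i>) else 0)"
    by (intro sum.cong) auto
  also have "\<dots> = coeff p (M + j) * (2 * of_real pi * \<i>)"
    by (auto simp: coeff_eq_0)
  finally show ?thesis by (simp add: fourier_coeff_def)
qed

lemma fourier_coeff_diff:
  assumes "continuous_on (sphere 0 1) f" "continuous_on (sphere 0 1) g"
  shows "fourier_coeff j (\<lambda>w. f w - g w) = fourier_coeff j f - fourier_coeff j g"
proof -
  have "contour_integral unit_circle (\<lambda>w. f w / w ^ Suc j - g w / w ^ Suc j)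
      = contour_integral unit_circle (\<lambda>w. f w / w ^ Suc j) - contour_integral unit_circle (\<lambda>w. g w / w ^ Suc j)"
    by (intro contour_integral_diff circle_integrable continuous_intros assms) auto
  then show ?thesis unfolding fourier_coeff_def by (simp add: diff_divide_distrib)
qed

lemma fourier_coeff_add:
  assumes "continuous_on (sphere 0 1) f" "continuous_on (sphere 0 1) g"
  shows "fourier_coeff j (\<lambda>w. f w + g w) = fourier_coeff j f + fourier_coeff j g"
proof -
  have "contour_integral unit_circle (\<lambda>w. f w / w ^ Suc j + g w / w ^ Suc j)
      = contour_integral unit_circle (\<lambda>w. f w / w ^ Suc j) + contour_integral unit_circle (\<lambda>w. g w / w ^ Suc j)"
    by (intro contour_integral_add circle_integrable continuous_intros assms) auto
  then show ?thesis unfolding fourier_coeff_def by (simp add: add_divide_distrib)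
qed

lemma fourier_coeff_cmult:
  assumes "continuous_on (sphere 0 1) f"
  shows "fourier_coeff j (\<lambda>w. c * f w) = c * fourier_coeff j f"
proof -
  have "contour_integral unit_circle (\<lambda>w. c * (f w / w ^ Suc j)) = c * contour_integral unit_circle (\<lambda>w. f w / w ^ Suc j)"
    by (intro contour_integral_lmul circle_integrable continuous_intros assms) auto
  then show ?thesis unfolding fourier_coeff_def by simp
qed

lemma norm_fourier_coeff_le:
  assumes cont: "continuous_on (sphere 0 1) f" and B: "\<And>w. norm w = 1 \<Longrightarrow> norm (f w) \<le> B"
  shows "norm (fourier_coeff j f) \<le> B"
proof -
  have B0: "0 \<le> B" using B[of 1] norm_ge_zero[of "f 1"] by (simp del: norm_ge_zero)
  have "(\<lambda>w. f w / w ^ Suc j) contour_integrable_on unit_circle"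
    by (intro circle_integrable continuous_intros cont) auto
  from has_contour_integral_bound_circlepath[OF has_contour_integral_integral[OF this] B0]
  have "norm (contour_integral unit_circle (\<lambda>w. f w / w ^ Suc j)) \<le> B * (2 * pi * 1)"
    using B by (simp add: norm_divide norm_power norm_mult)
  then show ?thesis by (simp add: fourier_coeff_def norm_divide norm_mult field_simps)
qed

text \<open>Argument principle for polynomials by removal of roots: each root in the open disc
  splits off a term \<open>1 / (w - z)\<close> with integral \<open>2 pi i\<close>, and a quotient
  without roots in the closed disc integrates to 0. The second conjunct is meant for its
  contrapositive: a vanishing integral forbids zeros in the disc.\<close>

lemma log_derivative_integral:
  fixes p :: "complex poly"
  assumes "\<And>w. norm w = 1 \<Longrightarrow> poly p w \<noteq> 0"
  shows "\<exists>n::nat. contour_integral unit_circle (\<lambda>w. poly (pderiv p) w / poly p w) = 2 * of_real pi * \<i> * of_nat n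
     \<and> ((\<exists>z. norm z < 1 \<and> poly p z = 0) \<longrightarrow> n > 0)"
  using assms
proof (induction "degree p" arbitrary: p rule: less_induct)
  case less
  show ?case
  proof (cases "\<exists>z. norm z < 1 \<and> poly p z = 0")
    case False
    have "(\<lambda>w. poly (pderiv p) w / poly p w) holomorphic_on cball 0 1"
      using False less.prems by (intro holomorphic_intros) (force simp: order_le_less)
    then show ?thesis using False circle_integral_holomorphic by (intro exI[of _ 0]) auto
  next
    case True
    then obtain z where z: "norm z < 1" "poly p z = 0" by blast
    then obtain q where q: "p = [:- z, 1:] * q" by (auto simp: poly_eq_0_iff_dvd)
    have "p \<noteq> 0" using less.prems[of 1] by auto
    then have "degree q < degree p" unfolding q by (subst degree_mult_eq) auto
    moreover have q0: "poly q w \<noteq> 0" if "norm w = 1" for w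
      using less.prems[OF that] by (auto simp: q)
    ultimately obtain n :: nat where n: "contour_integral unit_circle (\<lambda>w. poly (pderiv q) w / poly q w) = 2 * of_real pi * \<i> * of_nat n"
      using less.hyps[of q] by blast
    have "contour_integral unit_circle (\<lambda>w. poly (pderiv p) w / poly p w)
        = contour_integral unit_circle (\<lambda>w. 1 / (w - z) + poly (pderiv q) w / poly q w)"
    proof (rule circle_integral_cong)
      fix w :: complex assume w: "norm w = 1"
      have "pderiv p = q + [:- z, 1:] * pderiv q"
        unfolding q pderiv_mult by (simp add: pderiv_pCons)
      then have "poly (pderiv p) w = poly q w + (w - z) * poly (pderiv q) w"
        by (simp only: poly_add poly_mult) simp
      moreover have "poly p w = (w - z) * poly q w" by (simp add: q algebra_simps)
      moreover have "w - z \<noteq> 0" using z(1) w by auto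
      ultimately show "poly (pderiv p) w / poly p w = 1 / (w - z) + poly (pderiv q) w / poly q w"
        using q0[OF w] by (simp only: add_divide_distrib) simp
    qed
    also have "\<dots> = contour_integral unit_circle (\<lambda>w. 1 / (w - z)) + contour_integral unit_circle (\<lambda>w. poly (pderiv q) w / poly q w)"
      using z(1) q0 by (intro contour_integral_add circle_integrable continuous_intros) auto
    also have "contour_integral unit_circle (\<lambda>w. 1 / (w - z)) = 2 * of_real pi * \<i>"
    proof -
      have "winding_number unit_circle z = 1" using z(1) by (simp add: winding_number_circlepath)
      moreover have "z \<notin> path_image unit_circle" using z(1) by auto
      ultimately show ?thesis
        using winding_number_valid_path[OF valid_path_circlepath, of z 0 1] by (simp add: field_simps)
    qed
    finally show ?thesis
      by (intro exI[of _ "Suc n"]) (simp add: n algebra_simps)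
  qed
qed

section \<open>Laurent maps and their boundary loops\<close>

definition laurent_deriv :: "nat \<Rightarrow> real \<Rightarrow> (nat \<Rightarrow> complex) \<Rightarrow> complex \<Rightarrow> complex" where
  "laurent_deriv d r a w = of_real r - (\<Sum>j\<le>d. of_nat j * a j / w ^ Suc j)"

lemma laurent_map_has_derivative:
  assumes "w \<noteq> 0"
  shows "(laurent_map d r a has_field_derivative laurent_deriv d r a w) (at w)"
proof -
  have "((\<lambda>w. a j / w ^ j) has_field_derivative - (of_nat j * a j / w ^ Suc j)) (at w)" for j
  proof (cases j)
    case (Suc n)
    have "((\<lambda>w. a j / w ^ j) has_field_derivative - (a j * (of_nat j * w ^ n) / (w ^ j)\<^sup>2)) (at w)"
    proof -
      have "j - Suc 0 = n" using Suc by simp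
      then show ?thesis
        using assms by (auto intro!: derivative_eq_intros simp: power2_eq_square)
    qed
    also have "a j * (of_nat j * w ^ n) / (w ^ j)\<^sup>2 = of_nat j * a j / w ^ Suc j"
      using assms by (simp add: Suc power2_eq_square field_simps)
    finally show ?thesis .
  qed auto
  then have "((\<lambda>w. of_real r * w + (\<Sum>j\<le>d. a j / w ^ j)) has_field_derivative of_real r + (\<Sum>j\<le>d. - (of_nat j * a j / w ^ Suc j))) (at w)"
    by (intro DERIV_add DERIV_sum) (auto intro!: derivative_eq_intros)
  then show ?thesis
    by (simp add: laurent_map_def[abs_def] laurent_deriv_def sum_negf)
qed

lemma deriv_laurent_map: "w \<noteq> 0 \<Longrightarrow> deriv (laurent_map d r a) w = laurent_deriv d r a w"
  by (intro DERIV_imp_deriv laurent_map_has_derivative)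

lemma laurent_map_analytic: "laurent_map d r a analytic_on -{0}"
  unfolding laurent_map_def[abs_def] by (auto intro!: analytic_intros)

lemma laurent_map_continuous_on: "0 \<notin> S \<Longrightarrow> continuous_on S (laurent_map d r a)"
  unfolding laurent_map_def[abs_def] by (intro continuous_intros) auto

lemma laurent_deriv_continuous_on: "0 \<notin> S \<Longrightarrow> continuous_on S (laurent_deriv d r a)"
  unfolding laurent_deriv_def[abs_def] by (intro continuous_intros) auto

lemma boundary_loop_facts:
  fixes d r a
  defines "h \<equiv> laurent_map d r a"
  shows "valid_path (boundary_loop h)" "path (boundary_loop h)"
    "pathfinish (boundary_loop h) = pathstart (boundary_loop h)"
    "path_image (boundary_loop h) = h ` sphere 0 1"
    "(boundary_loop h has_vector_derivative laurent_deriv d r a (unit_circle x) * (2 * of_real pi * \<i> * unit_circle x)) (at x)"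
    "continuous_on S (\<lambda>x. laurent_deriv d r a (unit_circle x) * (2 * of_real pi * \<i> * unit_circle x))"
    "contour_integral (boundary_loop h) f = contour_integral unit_circle (\<lambda>w. laurent_deriv d r a w * f (h w))"
proof -
  show valid: "valid_path (boundary_loop h)"
    unfolding boundary_loop_def h_def
    by (rule valid_path_compose_analytic[OF _ laurent_map_analytic]) auto
  then show "path (boundary_loop h)" by (rule valid_path_imp_path)
  show "pathfinish (boundary_loop h) = pathstart (boundary_loop h)"
    by (simp add: boundary_loop_def pathfinish_def pathstart_def circlepath)
  show "path_image (boundary_loop h) = h ` sphere 0 1"
    unfolding boundary_loop_def path_image_compose by simp
  have "(unit_circle has_vector_derivative (2 * of_real pi * \<i> * unit_circle x)) (at x)"
    using has_vector_derivative_circlepath[of 0 1 x UNIV] by (simp add: circlepath)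
  from field_vector_diff_chain_at[OF this laurent_map_has_derivative[OF unit_circle_nonzero]]
  show "(boundary_loop h has_vector_derivative laurent_deriv d r a (unit_circle x) * (2 * of_real pi * \<i> * unit_circle x)) (at x)"
    by (simp add: boundary_loop_def h_def mult_ac)
  have "continuous_on S unit_circle" unfolding circlepath by (intro continuous_intros)
  then show "continuous_on S (\<lambda>x. laurent_deriv d r a (unit_circle x) * (2 * of_real pi * \<i> * unit_circle x))"
    by (intro continuous_intros continuous_on_compose2[OF laurent_deriv_continuous_on[of "sphere 0 1"]]) auto
  have "contour_integral (boundary_loop h) f = contour_integral unit_circle (\<lambda>w. deriv h w * f (h w))"
    unfolding boundary_loop_def h_def
    by (rule contour_integral_comp_analyticW[OF laurent_map_analytic]) auto
  also have "\<dots> = contour_integral unit_circle (\<lambda>w. laurent_deriv d r a w * f (h w))"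
  proof (rule circle_integral_cong)
    fix w :: complex assume "norm w = 1"
    then have "w \<noteq> 0" by auto
    then show "deriv h w * f (h w) = laurent_deriv d r a w * f (h w)"
      by (simp add: h_def deriv_laurent_map)
  qed
  finally show "contour_integral (boundary_loop h) f = contour_integral unit_circle (\<lambda>w. laurent_deriv d r a w * f (h w))" .
qed

lemma simple_path_boundary_loop:
  assumes "inj_on (laurent_map d r a) (sphere 0 1)"
  shows "simple_path (boundary_loop (laurent_map d r a))"
proof -
  have "simple_path unit_circle" by (simp add: simple_path_circlepath)
  moreover have "laurent_map d r a (unit_circle x) = laurent_map d r a (unit_circle y) \<Longrightarrow> unit_circle x = unit_circle y" for x y
    using assms by (auto dest: inj_onD)
  ultimately show ?thesis
    using boundary_loop_facts(2)[of d r a]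
    unfolding simple_path_def loop_free_def boundary_loop_def by (auto simp: o_def)
qed

section \<open>Laurent maps in the exterior of the disc\<close>

text \<open>This is \<open>u * h (1 / u)\<close> for \<open>h = laurent_map d r a\<close>: zeros of
  \<open>h\<close> in the exterior become zeros of a polynomial in the disc, and infinity becomes 0,
  where the value is \<open>r\<close>. With conjugated coefficients the same polynomial is
  \<open>w * cnj (h w)\<close> on the circle.\<close>

definition inverted_poly :: "nat \<Rightarrow> real \<Rightarrow> (nat \<Rightarrow> complex) \<Rightarrow> complex poly" where
  "inverted_poly d r a = [:of_real r:] + (\<Sum>j\<le>d. monom (a j) (Suc j))"

lemma laurent_map_inverse:
  assumes "u \<noteq> 0"
  shows "laurent_map d r a (1 / u) = poly (inverted_poly d r a) u / u"
  using assms by (simp add: laurent_map_def inverted_poly_def poly_sum poly_monom add_divide_distrib sum_divide_distrib power_divide)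

lemma pderiv_sum: "pderiv (\<Sum>i\<in>A. f i) = (\<Sum>i\<in>A. pderiv (f i))"
  by (induction A rule: infinite_finite_induct) (simp_all add: pderiv_add)

text \<open>The formula is the derivative of \<open>h (1 / u) = Q u / u\<close>, cleared of the
  factor \<open>- 1 / u\<^sup>2\<close>, with \<open>Q\<close> the inverted polynomial.\<close>

lemma laurent_deriv_inverse:
  assumes "u \<noteq> 0"
  shows "laurent_deriv d r a (1 / u) = poly (inverted_poly d r a) u - u * poly (pderiv (inverted_poly d r a)) u"
proof -
  have "pderiv (\<Sum>j\<le>d. monom (a j) (Suc j)) = (\<Sum>j\<le>d. monom (of_nat (Suc j) * a j) j)"
    by (simp add: pderiv_sum pderiv_monom)
  then have "poly (pderiv (inverted_poly d r a)) u = (\<Sum>j\<le>d. of_nat (Suc j) * a j * u ^ j)"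
    by (simp add: inverted_poly_def pderiv_add pderiv_pCons poly_sum poly_monom)
  then show ?thesis
    by (simp add: laurent_deriv_def inverted_poly_def poly_sum poly_monom sum_distrib_left power_divide
       algebra_simps sum.distrib)
qed

text \<open>After inversion the logarithmic derivative of \<open>h\<close> becomes
  \<open>1 / u - Q' / Q\<close>, with \<open>Q\<close> the inverted polynomial. So the winding
  number about 0 is 1 minus the number of zeros of \<open>Q\<close> in the disc, and the value 1
  leaves room for none.\<close>

lemma laurent_map_nonzero_exterior:
  assumes r: "r > 0" and wn: "winding_number (boundary_loop (laurent_map d r a)) 0 = 1"
    and notin: "0 \<notin> laurent_map d r a ` sphere 0 1"
    and w: "norm w \<ge> 1"
  shows "laurent_map d r a w \<noteq> 0"
proof -
  let ?h = "laurent_map d r a" and ?Q = "inverted_poly d r a"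
  have Q0: "poly ?Q u \<noteq> 0" if "norm u = 1" for u
  proof -
    have "u \<noteq> 0" "norm (1 / u) = 1" using that by (auto simp: norm_divide)
    then show ?thesis using notin laurent_map_inverse[of u d r a] by (metis div_0 imageI mem_sphere_0)
  qed
  have "2 * of_real pi * \<i> = contour_integral (boundary_loop ?h) (\<lambda>w. 1 / (w - 0))"
    using winding_number_valid_path[OF boundary_loop_facts(1), of 0 d r a] wn notin
    by (simp add: boundary_loop_facts field_simps)
  also have "\<dots> = contour_integral unit_circle (\<lambda>w. laurent_deriv d r a w * (1 / ?h w))"
    by (simp add: boundary_loop_facts)
  also have "\<dots> = contour_integral unit_circle (\<lambda>u. laurent_deriv d r a (1 / u) * (1 / ?h (1 / u)) / u\<^sup>2)"
    by (rule circle_integral_inversion)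
  also have "\<dots> = contour_integral unit_circle (\<lambda>u. 1 / u - poly (pderiv ?Q) u / poly ?Q u)"
  proof (rule circle_integral_cong)
    fix u :: complex assume u: "norm u = 1"
    then have "u \<noteq> 0" by auto
    then show "laurent_deriv d r a (1 / u) * (1 / ?h (1 / u)) / u\<^sup>2 = 1 / u - poly (pderiv ?Q) u / poly ?Q u"
      using Q0[OF u] by (simp add: laurent_deriv_inverse laurent_map_inverse field_simps power2_eq_square)
  qed
  also have "\<dots> = contour_integral unit_circle (\<lambda>u. 1 / u) - contour_integral unit_circle (\<lambda>u. poly (pderiv ?Q) u / poly ?Q u)"
    using Q0 by (intro contour_integral_diff circle_integrable continuous_intros) auto
  also have "contour_integral unit_circle (\<lambda>u. 1 / u) = 2 * of_real pi * \<i>"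
    using circle_integral_simple_pole[of "\<lambda>_. 1"] by simp
  finally have "contour_integral unit_circle (\<lambda>u. poly (pderiv ?Q) u / poly ?Q u) = 0" by simp
  with log_derivative_integral[of ?Q] Q0 have no_zero: "poly ?Q u \<noteq> 0" if "norm u < 1" for u
    using that by auto
  have "w \<noteq> 0" using w by auto
  moreover have "norm (1 / w) \<le> 1" using w by (simp add: norm_divide divide_le_eq)
  ultimately show ?thesis
    using laurent_map_inverse[of "1 / w" d r a] Q0[of "1/w"] no_zero[of "1 / w"] by (auto simp: order_le_less)
qed

context
  fixes d :: nat and r :: real and a :: "nat \<Rightarrow> complex"
  assumes r: "r > 0" and nonzero: "\<forall>w. norm w \<ge> 1 \<longrightarrow> laurent_map d r a w \<noteq> 0"
begin

lemma inverted_poly_nonzero: "norm u \<le> 1 \<Longrightarrow> poly (inverted_poly d r a) u \<noteq> 0"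
proof (cases "u = 0")
  case True
  then show ?thesis using r by (simp add: inverted_poly_def poly_sum poly_monom)
next
  case False
  moreover assume "norm u \<le> 1"
  ultimately show ?thesis
    using nonzero[rule_format, of "1 / u"] laurent_map_inverse[of u d r a] by (auto simp: norm_divide field_simps)
qed

text \<open>The integrand behaves like the power of \<open>w\<close> with exponent
  \<open>i - M - k\<close> at infinity, and the assumption makes this at most \<open>-1\<close>. As
  \<open>h\<close> has no zero in the exterior, only the residue at infinity counts, which is
  nonzero exactly in the borderline case.\<close>

lemma exterior_residue:
  assumes "Suc i \<le> k + M"
  shows "contour_integral unit_circle (\<lambda>w. w ^ i / w ^ M * (laurent_deriv d r a w / laurent_map d r a w ^ k))
    = (if k + M = Suc i then 2 * of_real pi * \<i> * of_real r / of_real r ^ k else 0)"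
proof -
  let ?Q = "inverted_poly d r a"
  \<comment> \<open>This is \<open>h' (1 / u) / (u * h (1 / u)) ^ k\<close>, extended
    holomorphically across 0 with value \<open>r / r ^ k\<close>.\<close>
  define S where "S u = (poly ?Q u - u * poly (pderiv ?Q) u) / poly ?Q u ^ k" for u
  have S_hol: "S holomorphic_on cball 0 1"
    unfolding S_def using inverted_poly_nonzero by (intro holomorphic_intros) auto
  have "contour_integral unit_circle (\<lambda>w. w ^ i / w ^ M * (laurent_deriv d r a w / laurent_map d r a w ^ k))
      = contour_integral unit_circle (\<lambda>u. (1 / u) ^ i / (1 / u) ^ M * (laurent_deriv d r a (1 / u) / laurent_map d r a (1 / u) ^ k) / u\<^sup>2)"
    by (rule circle_integral_inversion)
  also have "\<dots> = contour_integral unit_circle (\<lambda>u. u ^ (k + M - Suc i) * S u / u)"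
  proof (rule circle_integral_cong)
    fix u :: complex assume "norm u = 1"
    then have u: "u \<noteq> 0" "poly ?Q u \<noteq> 0" using inverted_poly_nonzero[of u] by auto
    obtain n where n: "k + M = Suc i + n" using assms le_Suc_ex by blast
    have "u ^ k * u ^ M = u * u ^ i * u ^ n" using n by (metis power_Suc power_add)
    then have pw: "u ^ k * u ^ M / (u ^ i * u\<^sup>2) = u ^ n / u" using u by (simp add: power2_eq_square)
    have "(1 / u) ^ i / (1 / u) ^ M * (laurent_deriv d r a (1 / u) / laurent_map d r a (1 / u) ^ k) / u\<^sup>2
        = u ^ k * u ^ M / (u ^ i * u\<^sup>2) * S u"
      using u by (simp add: laurent_deriv_inverse laurent_map_inverse S_def power_divide mult_ac)
    also have "\<dots> = u ^ (k + M - Suc i) * S u / u"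
      unfolding pw using n by simp
    finally show "(1 / u) ^ i / (1 / u) ^ M * (laurent_deriv d r a (1 / u) / laurent_map d r a (1 / u) ^ k) / u\<^sup>2
       = u ^ (k + M - Suc i) * S u / u" .
  qed
  also have "\<dots> = 2 * of_real pi * \<i> * (0 ^ (k + M - Suc i) * S 0)"
    by (rule circle_integral_simple_pole) (intro holomorphic_intros S_hol)
  also have "S 0 = of_real r / of_real r ^ k"
    by (simp add: S_def inverted_poly_def poly_sum poly_monom)
  finally show ?thesis using assms by (auto simp: power_0_left)
qed

text \<open>Under the degree bound every monomial except the one of degree
  \<open>M + (k - 1)\<close> falls under the vanishing case of \<open>exterior_residue\<close>, so
  the integral reads off a single coefficient.\<close>

lemma exterior_integral_poly_quotient:
  assumes "k \<ge> 1" "p = 0 \<or> degree p < M + (k - 1) + 1"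
  shows "contour_integral unit_circle (\<lambda>w. poly p w / w ^ M * (laurent_deriv d r a w / laurent_map d r a w ^ k))
     = coeff p (M + (k - 1)) * (2 * of_real pi * \<i> * of_real r / of_real r ^ k)"
proof (cases "p = 0")
  case False
  have "contour_integral unit_circle (\<lambda>w. poly p w / w ^ M * (laurent_deriv d r a w / laurent_map d r a w ^ k))
     = (\<Sum>i\<le>degree p. coeff p i * contour_integral unit_circle (\<lambda>w. w ^ i / w ^ M * (laurent_deriv d r a w / laurent_map d r a w ^ k)))"
    by (rule circle_integral_poly_quotient)
      (use nonzero in \<open>auto intro!: continuous_intros laurent_map_continuous_on laurent_deriv_continuous_on\<close>)
  also have "\<dots> = (\<Sum>i\<le>degree p. if i = M + (k - 1) then coeff p i * (2 * of_real pi * \<i> * of_real r / of_real r ^ k) else 0)"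
    using assms False by (intro sum.cong refl, subst exterior_residue) auto
  also have "\<dots> = coeff p (M + (k - 1)) * (2 * of_real pi * \<i> * of_real r / of_real r ^ k)"
    by (auto simp: coeff_eq_0)
  finally show ?thesis .
qed simp

text \<open>A triangular system: if \<open>p / w ^ M\<close> has a polynomial part, of degree
  \<open>n\<close>, then the integral with \<open>k = n + 1\<close> is its leading coefficient times
  a nonzero factor. So all integrals vanish exactly if \<open>p / w ^ M\<close> tends to 0 at
  infinity.\<close>

lemma exterior_integrals_vanish_iff:
  "(\<forall>k\<ge>1. contour_integral unit_circle (\<lambda>w. poly p w / w ^ M * (laurent_deriv d r a w / laurent_map d r a w ^ k)) = 0)
     \<longleftrightarrow> (p = 0 \<or> degree p < M)"
proof
  assume *: "\<forall>k\<ge>1. contour_integral unit_circle (\<lambda>w. poly p w / w ^ M * (laurent_deriv d r a w / laurent_map d r a w ^ k)) = 0"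
  show "p = 0 \<or> degree p < M"
  proof (rule ccontr)
    assume "\<not> (p = 0 \<or> degree p < M)"
    then have p: "p \<noteq> 0" "degree p \<ge> M" by auto
    define k where "k = degree p - M + 1"
    have "coeff p (M + (k - 1)) * (2 * of_real pi * \<i> * of_real r / of_real r ^ k) = 0"
      using *[rule_format, of k] exterior_integral_poly_quotient[of k p M] p by (simp add: k_def)
    then show False using p r by (simp add: k_def)
  qed
next
  assume "p = 0 \<or> degree p < M"
  then show "\<forall>k\<ge>1. contour_integral unit_circle (\<lambda>w. poly p w / w ^ M * (laurent_deriv d r a w / laurent_map d r a w ^ k)) = 0"
    by (intro allI impI, subst exterior_integral_poly_quotient) (auto simp: coeff_eq_0)
qed

end

section \<open>Conjugate boundary values and their defect from a polynomial\<close>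

text \<open>Horner's scheme. The exponent \<open>M\<close> is existential because it grows by
  \<open>d\<close> with each step; what matters is that the quotient has no power above
  \<open>w ^ N\<close>.\<close>

lemma poly_laurent_map_quotient:
  assumes "degree P \<le> N"
  shows "\<exists>B M. (\<forall>w. w \<noteq> 0 \<longrightarrow> poly P (laurent_map d r a w) = poly B w / w ^ M) \<and> degree B \<le> M + N"
  using assms
proof (induction P arbitrary: N)
  case 0
  show ?case by (intro exI[of _ 0]) auto
next
  case (pCons c P)
  show ?case
  proof (cases "P = 0")
    case True
    show ?thesis by (intro exI[of _ "[:c:]"] exI[of _ 0]) (simp add: True)
  next
    case False
    then have deg: "degree P \<le> N - 1" "N \<ge> 1" using pCons.prems by auto
    from pCons.IH[OF deg(1)] obtain B M where B: "\<And>w. w \<noteq> 0 \<Longrightarrow> poly P (laurent_map d r a w) = poly B w / w ^ M"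
      and dB: "degree B \<le> M + (N - 1)" by blast
    define A where "A = monom (of_real r) (Suc d) + (\<Sum>j\<le>d. monom (a j) (d - j))"
    have A: "laurent_map d r a w = poly A w / w ^ d" if "w \<noteq> 0" for w
      using that by (simp add: A_def laurent_map_def poly_sum poly_monom add_divide_distrib sum_divide_distrib power_diff)
    have dA: "degree A \<le> Suc d"
      unfolding A_def by (intro degree_add_le degree_sum_le order_trans[OF degree_monom_le]) auto
    define C where "C = monom c (M + d) + A * B"
    have "degree C \<le> (M + d) + N"
      unfolding C_def
    proof (intro degree_add_le)
      show "degree (monom c (M + d)) \<le> M + d + N" using degree_monom_le[of c "M + d"] by simp
      show "degree (A * B) \<le> M + d + N" using degree_mult_le[of A B] dA dB deg(2) by simp
    qed
    moreover have "poly (pCons c P) (laurent_map d r a w) = poly C w / w ^ (M + d)" if "w \<noteq> 0" for w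
    proof -
      have "poly (pCons c P) (laurent_map d r a w) = c + laurent_map d r a w * poly P (laurent_map d r a w)" by simp
      also have "\<dots> = c + poly A w / w ^ d * (poly B w / w ^ M)"
        by (subst B[OF that], subst A[OF that]) simp
      also have "\<dots> = poly C w / w ^ (M + d)"
        using that by (simp add: C_def poly_monom add_divide_distrib power_add mult_ac)
      finally show ?thesis .
    qed
    ultimately show ?thesis by blast
  qed
qed

lemma poly_inverted_poly: "poly (inverted_poly d r a) w = of_real r + (\<Sum>j\<le>d. a j * w ^ Suc j)"
  by (simp add: inverted_poly_def poly_sum poly_monom)

lemma coeff_inverted_poly:
  "coeff (inverted_poly d r a) 0 = of_real r"
  "coeff (inverted_poly d r a) (Suc j) = (if j \<le> d then a j else 0)"
  by (auto simp: inverted_poly_def coeff_sum)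

lemma degree_inverted_poly: "degree (inverted_poly d r a) \<le> Suc d"
  unfolding inverted_poly_def
  by (intro degree_add_le degree_sum_le order_trans[OF degree_monom_le]) auto

lemma cnj_laurent_map:
  assumes "norm w = 1"
  shows "cnj (laurent_map d r a w) = poly (inverted_poly d r (\<lambda>j. cnj (a j))) w / w"
proof -
  have w0: "w \<noteq> 0" using assms by auto
  have cw: "cnj w = 1 / w"
    using assms w0 by (metis complex_norm_square nonzero_eq_divide_eq mult.commute of_real_1 power_one)
  show ?thesis
    using w0 by (simp add: laurent_map_def poly_inverted_poly cw power_divide add_divide_distrib sum_divide_distrib)
qed

lemma fourier_coeff_cnj_laurent_map:
  "fourier_coeff j (\<lambda>w. cnj (laurent_map d r a w)) = (if j \<le> d then cnj (a j) else 0)"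
proof -
  have "fourier_coeff j (\<lambda>w. cnj (laurent_map d r a w)) = fourier_coeff j (\<lambda>w. poly (inverted_poly d r (\<lambda>j. cnj (a j))) w / w ^ 1)"
    by (rule fourier_coeff_cong) (simp add: cnj_laurent_map)
  then show ?thesis
    by (simp only: fourier_coeff_poly_quotient) (simp add: coeff_inverted_poly)
qed

text \<open>In the product of \<open>h'\<close> and \<open>cnj h\<close> the exponent
  \<open>-1\<close> arises only from \<open>r\<close> with \<open>r / w\<close> and from
  \<open>- j * a j / w ^ Suc j\<close> with \<open>cnj (a j) * w ^ j\<close>. By
  \<open>area_inside\<close> the resulting sum is the enclosed area divided by \<open>pi\<close>
  when the loop is simple and positive.\<close>

lemma contour_integral_cnj_boundary_loop:
  "contour_integral (boundary_loop (laurent_map d r a)) cnj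
     = 2 * of_real pi * \<i> * of_real (r\<^sup>2 - (\<Sum>j\<le>d. j * (norm (a j))\<^sup>2))"
proof -
  let ?G = "inverted_poly d r (\<lambda>j. cnj (a j))"
  have G: "contour_integral unit_circle (\<lambda>w. poly ?G w / w ^ Suc n) = coeff ?G n * (2 * of_real pi * \<i>)" for n
    using fourier_coeff_poly_quotient[of n ?G 0] by (simp add: fourier_coeff_def field_simps)
  have int: "(\<lambda>w. poly ?G w / w ^ Suc n) contour_integrable_on unit_circle" for n
    by (intro circle_integrable continuous_intros) auto
  have "contour_integral (boundary_loop (laurent_map d r a)) cnj
      = contour_integral unit_circle (\<lambda>w. laurent_deriv d r a w * cnj (laurent_map d r a w))"
    by (rule boundary_loop_facts)
  also have "\<dots> = contour_integral unit_circle (\<lambda>w. of_real r * (poly ?G w / w ^ Suc 0)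
       - (\<Sum>j\<le>d. (of_nat j * a j) * (poly ?G w / w ^ Suc (Suc j))))"
  proof (rule circle_integral_cong)
    fix w :: complex assume w: "norm w = 1"
    have "(\<Sum>j\<le>d. of_nat j * a j / w ^ Suc j) * (poly ?G w / w) = (\<Sum>j\<le>d. (of_nat j * a j) * (poly ?G w / w ^ Suc (Suc j)))"
      unfolding sum_distrib_right by (intro sum.cong) (auto simp: mult_ac)
    then show "laurent_deriv d r a w * cnj (laurent_map d r a w) = of_real r * (poly ?G w / w ^ Suc 0)
       - (\<Sum>j\<le>d. (of_nat j * a j) * (poly ?G w / w ^ Suc (Suc j)))"
      by (simp only: cnj_laurent_map[OF w] laurent_deriv_def left_diff_distrib power_Suc0_right)
  qed
  also have "\<dots> = contour_integral unit_circle (\<lambda>w. of_real r * (poly ?G w / w ^ Suc 0))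
       - contour_integral unit_circle (\<lambda>w. \<Sum>j\<le>d. (of_nat j * a j) * (poly ?G w / w ^ Suc (Suc j)))"
    by (intro contour_integral_diff contour_integrable_lmul contour_integrable_sum int finite_atMost)
  also have "\<dots> = of_real r * contour_integral unit_circle (\<lambda>w. poly ?G w / w ^ Suc 0)
       - (\<Sum>j\<le>d. (of_nat j * a j) * contour_integral unit_circle (\<lambda>w. poly ?G w / w ^ Suc (Suc j)))"
  proof -
    have "contour_integral unit_circle (\<lambda>w. \<Sum>j\<le>d. (of_nat j * a j) * (poly ?G w / w ^ Suc (Suc j)))
        = (\<Sum>j\<le>d. contour_integral unit_circle (\<lambda>w. (of_nat j * a j) * (poly ?G w / w ^ Suc (Suc j))))"
      by (intro contour_integral_sum contour_integrable_lmul int finite_atMost)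
    then show ?thesis by (simp only: contour_integral_lmul[OF int])
  qed
  also have "\<dots> = of_real r * (of_real r * (2 * of_real pi * \<i>))
       - (\<Sum>j\<le>d. (of_nat j * a j) * (cnj (a j) * (2 * of_real pi * \<i>)))"
    unfolding G by (simp add: coeff_inverted_poly)
  also have "(\<Sum>j\<le>d. (of_nat j * a j) * (cnj (a j) * (2 * of_real pi * \<i>)))
       = (\<Sum>j\<le>d. of_real (j * (norm (a j))\<^sup>2) * (2 * of_real pi * \<i>))"
  proof (rule sum.cong)
    fix j
    have "a j * cnj (a j) = of_real ((norm (a j))\<^sup>2)" by (rule complex_norm_square[symmetric])
    then show "(of_nat j * a j) * (cnj (a j) * (2 * of_real pi * \<i>)) = of_real (j * (norm (a j))\<^sup>2) * (2 * of_real pi * \<i>)"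
      by (metis (no_types, lifting) mult.assoc of_real_mult of_real_of_nat_eq)
  qed simp
  also have "\<dots> = of_real (\<Sum>j\<le>d. j * (norm (a j))\<^sup>2) * (2 * of_real pi * \<i>)"
    by (simp only: sum_distrib_right[symmetric] of_real_sum)
  finally show ?thesis by (simp only: of_real_diff of_real_mult power2_eq_square right_diff_distrib mult_ac)
qed

text \<open>On a curve, \<open>cnj z\<close> is the boundary value of its Schwarz function; the
  defect is the difference from \<open>P\<close>. It is a Laurent polynomial without powers above
  \<open>w ^ d\<close>, so the \<open>d + 1\<close> coefficient equations amount to its vanishing at
  infinity, in the form \<open>degree p < M\<close>.\<close>

lemma schwarz_defect:
  assumes "degree P \<le> d"
  obtains p M where
    "\<And>w. norm w = 1 \<Longrightarrow> cnj (laurent_map d r a w) - poly P (laurent_map d r a w) = poly p w / w ^ M"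
    "(\<forall>j\<le>d. fourier_coeff j (\<lambda>w. poly P (laurent_map d r a w)) = cnj (a j)) \<longleftrightarrow> (p = 0 \<or> degree p < M)"
proof -
  let ?h = "laurent_map d r a" and ?G = "inverted_poly d r (\<lambda>j. cnj (a j))"
  obtain B M where B: "\<And>w. w \<noteq> 0 \<Longrightarrow> poly P (?h w) = poly B w / w ^ M" and dB: "degree B \<le> M + d"
    using poly_laurent_map_quotient[OF assms] by blast
  \<comment> \<open>Common denominator \<open>w ^ Suc M\<close> for \<open>?G / w\<close> and
    \<open>B / w ^ M\<close>.\<close>
  define p where "p = monom 1 M * ?G - monom 1 1 * B"
  have p: "cnj (?h w) - poly P (?h w) = poly p w / w ^ Suc M" if w: "norm w = 1" for w
  proof -
    have "w \<noteq> 0" using w by auto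
    then show ?thesis
      by (simp add: cnj_laurent_map[OF w] B p_def poly_monom diff_divide_distrib)
  qed
  have "degree p \<le> Suc M + d"
    unfolding p_def
  proof (intro degree_diff_le)
    show "degree (monom 1 M * ?G) \<le> Suc M + d"
      using degree_mult_le[of "monom 1 M" ?G] degree_inverted_poly[of d r "\<lambda>j. cnj (a j)"] degree_monom_le[of "1::complex" M] by simp
    show "degree (monom 1 1 * B) \<le> Suc M + d"
      using degree_mult_le[of "monom 1 1" B] dB degree_monom_le[of "1::complex" 1] by simp
  qed
  then have vanish: "(\<forall>j\<le>d. coeff p (Suc M + j) = 0) \<longleftrightarrow> (p = 0 \<or> degree p < Suc M)"
  proof (intro iffI)
    assume dp: "degree p \<le> Suc M + d" and *: "\<forall>j\<le>d. coeff p (Suc M + j) = 0"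
    show "p = 0 \<or> degree p < Suc M"
    proof (rule ccontr)
      assume "\<not> (p = 0 \<or> degree p < Suc M)"
      then have "p \<noteq> 0" "degree p = Suc M + (degree p - Suc M)" by auto
      then show False using *[rule_format, of "degree p - Suc M"] dp by (metis add_le_cancel_left leading_coeff_0_iff)
    qed
  qed (auto simp: coeff_eq_0)
  have cont: "continuous_on (sphere 0 1) ?h" by (rule laurent_map_continuous_on) simp
  have "coeff p (Suc M + j) = fourier_coeff j (\<lambda>w. cnj (?h w)) - fourier_coeff j (\<lambda>w. poly P (?h w))" for j
  proof -
    have "fourier_coeff j (\<lambda>w. cnj (?h w) - poly P (?h w)) = fourier_coeff j (\<lambda>w. poly p w / w ^ Suc M)"
      by (rule fourier_coeff_cong) (simp add: p)
    moreover have "fourier_coeff j (\<lambda>w. cnj (?h w) - poly P (?h w)) = fourier_coeff j (\<lambda>w. cnj (?h w)) - fourier_coeff j (\<lambda>w. poly P (?h w))"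
      by (rule fourier_coeff_diff) (intro continuous_intros cont)+
    ultimately show ?thesis unfolding fourier_coeff_poly_quotient by simp
  qed
  then have "(\<forall>j\<le>d. fourier_coeff j (\<lambda>w. poly P (?h w)) = cnj (a j)) \<longleftrightarrow> (\<forall>j\<le>d. coeff p (Suc M + j) = 0)"
    by (auto simp: fourier_coeff_cnj_laurent_map)
  then show ?thesis using that[of p "Suc M"] p vanish by blast
qed

section \<open>Moments of the loop as exterior integrals\<close>

lemma loop_integral_monomial:
  assumes r: "r > 0" and nonzero: "\<forall>w. norm w \<ge> 1 \<longrightarrow> laurent_map d r a w \<noteq> 0"
  shows "contour_integral (boundary_loop (laurent_map d r a)) (\<lambda>z. z ^ i / z ^ k) = (if k = Suc i then 2 * of_real pi * \<i> else 0)"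
proof (cases "k \<le> i")
  case True
  have nz: "laurent_map d r a w \<noteq> 0" if "norm w = 1" for w using nonzero that by simp
  have "contour_integral (boundary_loop (laurent_map d r a)) (\<lambda>z. z ^ i / z ^ k) = contour_integral (boundary_loop (laurent_map d r a)) (\<lambda>z. z ^ (i - k))"
    by (rule contour_integral_eq) (use True nz in \<open>auto simp: boundary_loop_facts power_diff\<close>)
  also have "\<dots> = 0"
    by (rule contour_integral_unique, rule Cauchy_theorem_convex_simple[of _ UNIV])
      (auto simp: boundary_loop_facts intro!: holomorphic_intros)
  finally show ?thesis using True by simp
next
  case False
  then obtain n where n: "k = i + Suc n" by (metis add_Suc_right less_imp_Suc_add not_le)
  have "contour_integral (boundary_loop (laurent_map d r a)) (\<lambda>z. z ^ i / z ^ k)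
     = contour_integral unit_circle (\<lambda>w. w ^ 0 / w ^ 0 * (laurent_deriv d r a w / laurent_map d r a w ^ Suc n))"
    unfolding boundary_loop_facts
  proof (rule circle_integral_cong)
    fix w :: complex assume "norm w = 1"
    then show "laurent_deriv d r a w * (laurent_map d r a w ^ i / laurent_map d r a w ^ k)
       = w ^ 0 / w ^ 0 * (laurent_deriv d r a w / laurent_map d r a w ^ Suc n)"
      using nonzero[rule_format, of w] by (simp add: n power_add)
  qed
  also have "\<dots> = (if Suc n + 0 = Suc 0 then 2 * of_real pi * \<i> * of_real r / of_real r ^ Suc n else 0)"
    by (rule exterior_residue[OF r nonzero]) auto
  finally show ?thesis using r by (auto simp: n)
qed

lemma loop_integral_poly:
  assumes r: "r > 0" and nonzero: "\<forall>w. norm w \<ge> 1 \<longrightarrow> laurent_map d r a w \<noteq> 0" and k: "k \<ge> 1"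
  shows "contour_integral (boundary_loop (laurent_map d r a)) (\<lambda>z. poly P z / z ^ k) = 2 * of_real pi * \<i> * coeff P (k - 1)"
proof -
  let ?\<gamma> = "boundary_loop (laurent_map d r a)"
  have int: "(\<lambda>z. z ^ i / z ^ k) contour_integrable_on ?\<gamma>" for i
  proof (rule contour_integrable_holomorphic_simple[of _ "-{0}"])
    show "path_image ?\<gamma> \<subseteq> - {0}" using nonzero by (auto simp: boundary_loop_facts)
  qed (auto intro!: holomorphic_intros simp: boundary_loop_facts)
  have "contour_integral ?\<gamma> (\<lambda>z. poly P z / z ^ k) = contour_integral ?\<gamma> (\<lambda>z. \<Sum>i\<le>degree P. coeff P i * (z ^ i / z ^ k))"
    by (simp add: poly_altdef sum_divide_distrib)
  also have "\<dots> = (\<Sum>i\<le>degree P. contour_integral ?\<gamma> (\<lambda>z. coeff P i * (z ^ i / z ^ k)))"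
    by (intro contour_integral_sum contour_integrable_lmul int finite_atMost)
  also have "\<dots> = (\<Sum>i\<le>degree P. if i = k - 1 then coeff P i * (2 * of_real pi * \<i>) else 0)"
    unfolding contour_integral_lmul[OF int] loop_integral_monomial[OF r nonzero] using k by (intro sum.cong) auto
  also have "\<dots> = 2 * of_real pi * \<i> * coeff P (k - 1)"
    by (auto simp: coeff_eq_0)
  finally show ?thesis .
qed

text \<open>The value \<open>2 pi i * coeff P (k - 1)\<close> is the integral of
  \<open>P z / z ^ k\<close> over the loop. Subtracting it leaves the exterior integral of the
  defect, and the triangular criterion turns infinitely many moment equations into
  \<open>d + 1\<close> coefficient equations.\<close>

lemma moments_iff_fourier:
  assumes r: "r > 0" and nonzero: "\<forall>w. norm w \<ge> 1 \<longrightarrow> laurent_map d r a w \<noteq> 0" and P: "degree P \<le> d"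
  shows "(\<forall>k\<ge>1. contour_integral (boundary_loop (laurent_map d r a)) (\<lambda>z. cnj z / z ^ k) = 2 * of_real pi * \<i> * coeff P (k - 1))
     \<longleftrightarrow> (\<forall>j\<le>d. fourier_coeff j (\<lambda>w. poly P (laurent_map d r a w)) = cnj (a j))"
proof -
  let ?h = "laurent_map d r a"
  let ?\<gamma> = "boundary_loop ?h"
  obtain p M where p: "\<And>w. norm w = 1 \<Longrightarrow> cnj (?h w) - poly P (?h w) = poly p w / w ^ M"
    and iff: "(\<forall>j\<le>d. fourier_coeff j (\<lambda>w. poly P (?h w)) = cnj (a j)) \<longleftrightarrow> (p = 0 \<or> degree p < M)"
    using schwarz_defect[OF P] by metis
  have key: "contour_integral ?\<gamma> (\<lambda>z. cnj z / z ^ k) - 2 * of_real pi * \<i> * coeff P (k - 1)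
     = contour_integral unit_circle (\<lambda>w. poly p w / w ^ M * (laurent_deriv d r a w / ?h w ^ k))" if k: "k \<ge> 1" for k
  proof -
    have cont: "continuous_on (sphere 0 1) ?h" "continuous_on (sphere 0 1) (laurent_deriv d r a)"
      by (auto intro: laurent_map_continuous_on laurent_deriv_continuous_on)
    have "contour_integral ?\<gamma> (\<lambda>z. cnj z / z ^ k) - 2 * of_real pi * \<i> * coeff P (k - 1)
       = contour_integral ?\<gamma> (\<lambda>z. cnj z / z ^ k) - contour_integral ?\<gamma> (\<lambda>z. poly P z / z ^ k)"
      by (simp add: loop_integral_poly[OF r nonzero k])
    also have "\<dots> = contour_integral unit_circle (\<lambda>w. laurent_deriv d r a w * (cnj (?h w) / ?h w ^ k) - laurent_deriv d r a w * (poly P (?h w) / ?h w ^ k))"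
      unfolding boundary_loop_facts using nonzero
      by (intro contour_integral_diff[symmetric] circle_integrable continuous_intros cont) auto
    also have "\<dots> = contour_integral unit_circle (\<lambda>w. poly p w / w ^ M * (laurent_deriv d r a w / ?h w ^ k))"
      by (rule circle_integral_cong) (simp only: p[symmetric], simp add: algebra_simps diff_divide_distrib)
    finally show ?thesis .
  qed
  have "contour_integral ?\<gamma> (\<lambda>z. cnj z / z ^ k) = 2 * of_real pi * \<i> * coeff P (k - 1)
     \<longleftrightarrow> contour_integral unit_circle (\<lambda>w. poly p w / w ^ M * (laurent_deriv d r a w / ?h w ^ k)) = 0" if "k \<ge> 1" for k
    unfolding key[OF that, symmetric] by (rule eq_iff_diff_eq_0)
  then show ?thesis
    unfolding iff exterior_integrals_vanish_iff[OF r nonzero, symmetric] by blast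
qed

text \<open>Translating the curve changes only \<open>a 0\<close>; this transfers statements about
  the origin to any inside point.\<close>

lemma laurent_map_shift:
  "laurent_map d r (a(0 := a 0 - z)) w = laurent_map d r a w - z"
  "laurent_deriv d r (a(0 := a 0 - z)) w = laurent_deriv d r a w"
proof -
  have "(\<Sum>j\<le>d. (a(0 := a 0 - z)) j / w ^ j) = (\<Sum>j\<le>d. a j / w ^ j) - z"
    by (subst (1 2) sum.atMost_shift) (simp add: diff_divide_distrib)
  then show "laurent_map d r (a(0 := a 0 - z)) w = laurent_map d r a w - z"
    by (simp add: laurent_map_def)
  show "laurent_deriv d r (a(0 := a 0 - z)) w = laurent_deriv d r a w"
    unfolding laurent_deriv_def by (intro arg_cong2[of _ _ _ _ "(-)"] sum.cong) auto
qed

text \<open>The polynomial part obeys Cauchy's formula. The defect vanishes at infinity, and for the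
  curve translated by \<open>z0\<close> its Cauchy integral is the exterior integral with
  \<open>k = 1\<close>, hence 0. Together with the Cauchy-Pompeiu bound this makes \<open>P\<close>
  close to \<open>cnj z\<close> throughout the inside.\<close>

lemma Cauchy_integral_cnj_eq_poly:
  assumes r: "r > 0" and P: "degree P \<le> d"
    and wn: "winding_number (boundary_loop (laurent_map d r a)) z0 = 1"
    and notin: "z0 \<notin> laurent_map d r a ` sphere 0 1"
    and fourier: "\<forall>j\<le>d. fourier_coeff j (\<lambda>w. poly P (laurent_map d r a w)) = cnj (a j)"
  shows "contour_integral (boundary_loop (laurent_map d r a)) (\<lambda>z. cnj z / (z - z0)) = 2 * of_real pi * \<i> * poly P z0"
proof -
  let ?h = "laurent_map d r a"
  let ?\<gamma> = "boundary_loop ?h"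
  define b where "b = a(0 := a 0 - z0)"
  note shift = laurent_map_shift[of d r a z0, folded b_def]
  obtain p M where p: "\<And>w. norm w = 1 \<Longrightarrow> cnj (?h w) - poly P (?h w) = poly p w / w ^ M"
    and deg: "p = 0 \<or> degree p < M"
    using schwarz_defect[OF P] fourier by metis
  have "boundary_loop (laurent_map d r b) = (\<lambda>x. ?\<gamma> x - z0)"
    by (simp add: boundary_loop_def fun_eq_iff shift)
  then have "winding_number (boundary_loop (laurent_map d r b)) 0 = 1"
    using wn winding_number_offset[of ?\<gamma> z0] by simp
  moreover have "0 \<notin> laurent_map d r b ` sphere 0 1" using notin by (force simp: shift)
  ultimately have nonzero: "\<forall>w. norm w \<ge> 1 \<longrightarrow> laurent_map d r b w \<noteq> 0"
    using laurent_map_nonzero_exterior[OF r] by blast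
  have nz: "?h w \<noteq> z0" if "norm w = 1" for w using notin that by auto
  have cont: "continuous_on (sphere 0 1) ?h" "continuous_on (sphere 0 1) (laurent_deriv d r a)"
    by (auto intro: laurent_map_continuous_on laurent_deriv_continuous_on)
  have "((\<lambda>z. poly P z / (z - z0)) has_contour_integral (2 * pi * \<i> * winding_number ?\<gamma> z0 * poly P z0)) ?\<gamma>"
    by (rule Cauchy_integral_formula_convex_simple[of UNIV]) (use notin in \<open>auto simp: boundary_loop_facts intro!: holomorphic_intros\<close>)
  then have "contour_integral ?\<gamma> (\<lambda>z. poly P z / (z - z0)) = 2 * of_real pi * \<i> * poly P z0"
    by (simp add: contour_integral_unique wn)
  moreover have "contour_integral ?\<gamma> (\<lambda>z. cnj z / (z - z0)) - contour_integral ?\<gamma> (\<lambda>z. poly P z / (z - z0))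
     = contour_integral unit_circle (\<lambda>w. laurent_deriv d r a w * (cnj (?h w) / (?h w - z0)) - laurent_deriv d r a w * (poly P (?h w) / (?h w - z0)))"
    unfolding boundary_loop_facts using nz
    by (intro contour_integral_diff[symmetric] circle_integrable continuous_intros cont) auto
  moreover have "\<dots> = contour_integral unit_circle (\<lambda>w. poly p w / w ^ M * (laurent_deriv d r b w / laurent_map d r b w ^ 1))"
    by (rule circle_integral_cong) (simp only: p[symmetric] shift power_one_right, simp add: algebra_simps diff_divide_distrib)
  moreover have "\<dots> = 0"
    by (rule exterior_integrals_vanish_iff[OF r nonzero, THEN iffD2, OF deg, rule_format, OF order_refl])
  ultimately show ?thesis by simp
qed

section \<open>Moment equations and the a priori bound\<close>

text \<open>Index \<open>i\<close> belongs to the moment number \<open>i + 1\<close>. The first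
  moment is a separate argument because \<delta> has to be chosen before it.\<close>

definition moment_poly :: "nat \<Rightarrow> (nat \<Rightarrow> complex) \<Rightarrow> complex \<Rightarrow> complex poly" where
  "moment_poly d t t1 = (\<Sum>i\<le>d. monom (of_nat (Suc i) * (if i = 0 then t1 else t (Suc i))) i)"

text \<open>It depends on \<open>d\<close> and \<open>t\<close> alone, so bounds for it are uniform
  in \<open>t0\<close> and \<open>t1\<close>; for \<open>d = 1\<close> it is zero.\<close>

definition moment_poly_tail :: "nat \<Rightarrow> (nat \<Rightarrow> complex) \<Rightarrow> complex poly" where
  "moment_poly_tail d t = (\<Sum>i=2..d. monom (of_nat (Suc i) * t (Suc i)) (i - 2))"

lemma coeff_moment_poly:
  "coeff (moment_poly d t t1) i = (if i \<le> d then of_nat (Suc i) * (if i = 0 then t1 else t (Suc i)) else 0)"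
  by (simp add: moment_poly_def coeff_sum)

lemma degree_moment_poly: "degree (moment_poly d t t1) \<le> d"
  by (rule degree_le) (simp add: coeff_moment_poly)

lemma poly_moment_poly:
  assumes "d \<ge> 1"
  shows "poly (moment_poly d t t1) z = t1 + 2 * t 2 * z + z\<^sup>2 * poly (moment_poly_tail d t) z"
proof -
  have "{..d} = {0, 1} \<union> {2..d}" using assms by auto
  then have "poly (moment_poly d t t1) z = t1 + 2 * t 2 * z + (\<Sum>i=2..d. of_nat (Suc i) * t (Suc i) * z ^ i)"
    by (simp add: moment_poly_def poly_sum poly_monom sum.union_disjoint numeral_2_eq_2)
  also have "(\<Sum>i=2..d. of_nat (Suc i) * t (Suc i) * z ^ i) = z\<^sup>2 * poly (moment_poly_tail d t) z"
    unfolding moment_poly_tail_def poly_sum poly_monom sum_distrib_left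
  proof (rule sum.cong)
    fix i assume "i \<in> {2..d}"
    then have "z ^ i = z\<^sup>2 * z ^ (i - 2)"
      by (metis le_add_diff_inverse power_add atLeastAtMost_iff)
    then show "of_nat (Suc i) * t (Suc i) * z ^ i = z\<^sup>2 * (of_nat (Suc i) * t (Suc i) * z ^ (i - 2))"
      by (simp only: mult_ac)
  qed simp
  finally show ?thesis .
qed

lemma exterior_moments_iff:
  "(\<forall>k\<ge>1. exterior_moment g k = (if k = 1 then t1 else if k \<le> d + 1 then t k else 0))
   \<longleftrightarrow> (\<forall>k\<ge>1. contour_integral g (\<lambda>z. cnj z / z ^ k) = 2 * of_real pi * \<i> * coeff (moment_poly d t t1) (k - 1))"
proof -
  have "exterior_moment g k = (if k = 1 then t1 else if k \<le> d + 1 then t k else 0)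
    \<longleftrightarrow> contour_integral g (\<lambda>z. cnj z / z ^ k) = 2 * of_real pi * \<i> * coeff (moment_poly d t t1) (k - 1)" if k: "k \<ge> 1" for k
  proof -
    define m where "m = (if k = 1 then t1 else if k \<le> d + 1 then t k else 0)"
    have "coeff (moment_poly d t t1) (k - 1) = of_nat k * m"
      using k by (auto simp: coeff_moment_poly m_def)
    moreover have "exterior_moment g k = m \<longleftrightarrow> contour_integral g (\<lambda>z. cnj z / z ^ k) = m * (2 * of_real pi * \<i> * of_nat k)"
      unfolding exterior_moment_def using k by (subst divide_eq_eq) auto
    ultimately show ?thesis unfolding m_def by (simp only: mult_ac)
  qed
  then show ?thesis by blast
qed

lemma loop_winding_inside:
  assumes "inj_on (laurent_map d r a) (sphere 0 1)"
    and "positively_oriented (boundary_loop (laurent_map d r a))"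
    and "z \<in> inside (laurent_map d r a ` sphere 0 1)"
  shows "winding_number (boundary_loop (laurent_map d r a)) z = 1"
  using assms by (simp add: positively_oriented_def boundary_loop_facts)

lemma area_laurent_curve:
  assumes inj: "inj_on (laurent_map d r a) (sphere 0 1)"
    and pos: "positively_oriented (boundary_loop (laurent_map d r a))"
  shows "measure lebesgue (inside (laurent_map d r a ` sphere 0 1)) = pi * (r\<^sup>2 - (\<Sum>j\<le>d. j * (norm (a j))\<^sup>2))"
proof -
  let ?g = "boundary_loop (laurent_map d r a)"
  have "2 * \<i> * of_real (measure lebesgue (inside (path_image ?g))) = contour_integral ?g cnj"
    by (rule area_inside[OF boundary_loop_facts(5,6,1) simple_path_boundary_loop[OF inj] boundary_loop_facts(3)])
      (use pos in \<open>simp add: positively_oriented_def\<close>)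
  then have "2 * \<i> * of_real (measure lebesgue (inside (path_image ?g)))
     = 2 * \<i> * of_real (pi * (r\<^sup>2 - (\<Sum>j\<le>d. j * (norm (a j))\<^sup>2)))"
    by (simp only: contour_integral_cnj_boundary_loop of_real_mult mult_ac)
  then have "complex_of_real (measure lebesgue (inside (path_image ?g))) = of_real (pi * (r\<^sup>2 - (\<Sum>j\<le>d. j * (norm (a j))\<^sup>2)))"
    by (subst (asm) mult_left_cancel) auto
  then show ?thesis unfolding of_real_eq_iff by (simp only: boundary_loop_facts)
qed

lemma connected_subset_cball_of_gap:
  fixes D :: "complex set"
  assumes "connected D" "0 \<in> D" "r1 < r0" "0 \<le> r1"
    and gap: "\<And>z. z \<in> D \<Longrightarrow> norm z \<le> r0 \<Longrightarrow> norm z \<le> r1"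
  shows "D \<subseteq> cball 0 r1"
proof
  fix z assume z: "z \<in> D"
  show "z \<in> cball 0 r1"
  proof (rule ccontr)
    assume "z \<notin> cball 0 r1"
    then have "norm z > r0" using gap[OF z] by force
    have "connected (norm ` D)"
      using assms(1) by (intro connected_continuous_image continuous_intros)
    moreover have "0 \<in> norm ` D" "norm z \<in> norm ` D" using assms(2) z by force+
    ultimately have "r0 \<in> norm ` D"
      using \<open>norm z > r0\<close> assms(3,4) unfolding connected_iff_interval by (meson less_imp_le order_trans)
    then show False using gap assms(3) by force
  qed
qed

text \<open>The affine part of the polynomial is \<open>t1 + 2 * t 2 * z\<close>, which cannot stay close to \<open>cnj z\<close> on
  a small circle of fixed radius; hence there is a gap in the possible values of \<open>norm z\<close>, and
  connectedness leaves only the small ones.\<close>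

lemma a_priori_disc:
  assumes d: "d \<ge> 1" and t2: "norm (t 2) < 1 / 2"
  obtains \<delta> \<kappa> :: real where "\<delta> > 0" "\<kappa> > 0"
    "\<And>t0 t1 D. 0 < t0 \<Longrightarrow> t0 < \<delta> \<Longrightarrow> norm t1 \<le> sqrt t0 \<Longrightarrow> connected D \<Longrightarrow> 0 \<in> D \<Longrightarrow>
       (\<And>z. z \<in> D \<Longrightarrow> norm (cnj z - poly (moment_poly d t t1) z) \<le> 3 * sqrt t0) \<Longrightarrow> D \<subseteq> cball 0 (\<kappa> * sqrt t0)"
proof -
  let ?R = "moment_poly_tail d t"
  define T where "T = norm (t 2)"
  have "bounded (poly ?R ` cball 0 1)"
    by (intro compact_imp_bounded compact_continuous_image continuous_intros) auto
  then obtain B where B: "B > 0" "\<And>z. norm z \<le> 1 \<Longrightarrow> norm (poly ?R z) \<le> B"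
    by (auto simp: bounded_pos)
  \<comment> \<open>For \<open>norm z \<le> r0\<close> the tail takes at most half of the margin
    \<open>1 - 2 * T\<close>. The other half, times \<open>norm z\<close>, is bounded by
    \<open>3 * sqrt t0 + sqrt t0\<close>, which gives \<open>8 / (1 - 2 * T)\<close>.\<close>
  define \<kappa> where "\<kappa> = 8 / (1 - 2 * T)"
  define r0 where "r0 = min 1 ((1 - 2 * T) / (2 * B))"
  have T: "0 \<le> T" "1 - 2 * T > 0" using t2 by (auto simp: T_def)
  have \<kappa>: "\<kappa> > 0" and r0: "r0 > 0" using T B by (auto simp: \<kappa>_def r0_def)
  show ?thesis
  proof
    \<comment> \<open>This choice of \<delta> makes \<open>\<kappa> * sqrt t0 < r0\<close>, so that
      there is a true gap between the two radii.\<close>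
    show "(r0 / \<kappa>)\<^sup>2 > 0" "\<kappa> > 0" using \<kappa> r0 by auto
    fix t0 :: real and t1 D
    assume t0: "0 < t0" "t0 < (r0 / \<kappa>)\<^sup>2" and t1: "norm t1 \<le> sqrt t0" and D: "connected D" "0 \<in> D"
      and bound: "\<And>z. z \<in> D \<Longrightarrow> norm (cnj z - poly (moment_poly d t t1) z) \<le> 3 * sqrt t0"
    have "sqrt t0 < r0 / \<kappa>"
      using t0 \<kappa> r0 by (metis divide_pos_pos less_imp_le real_sqrt_abs real_sqrt_less_mono abs_of_nonneg)
    then have lt: "\<kappa> * sqrt t0 < r0" using \<kappa> by (simp add: field_simps)
    show "D \<subseteq> cball 0 (\<kappa> * sqrt t0)"
    proof (rule connected_subset_cball_of_gap[OF D lt])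
      fix z assume z: "z \<in> D" "norm z \<le> r0"
      then have z1: "norm z \<le> 1" and zB: "B * norm z \<le> (1 - 2 * T) / 2"
        using B(1) by (auto simp: r0_def field_simps)
      have "norm (z\<^sup>2 * poly ?R z) = (norm z)\<^sup>2 * norm (poly ?R z)" by (simp add: norm_mult norm_power)
      also have "\<dots> \<le> (norm z)\<^sup>2 * B" using B(2)[OF z1] by (intro mult_left_mono) auto
      also have "\<dots> = norm z * (B * norm z)" by (simp add: power2_eq_square)
      also have "\<dots> \<le> norm z * ((1 - 2 * T) / 2)" using zB by (intro mult_left_mono) auto
      finally have tail: "norm (z\<^sup>2 * poly ?R z) \<le> norm z * ((1 - 2 * T) / 2)" .
      have "norm z = norm (cnj z)" by simp
      also have "cnj z = (cnj z - poly (moment_poly d t t1) z) + (t1 + 2 * t 2 * z + z\<^sup>2 * poly ?R z)"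
        by (simp add: poly_moment_poly[OF d])
      also have "norm \<dots> \<le> 3 * sqrt t0 + (sqrt t0 + 2 * T * norm z + norm z * ((1 - 2 * T) / 2))"
        using bound[OF z(1)] t1 tail
        by (intro norm_triangle_le add_mono) (auto simp: norm_mult T_def)
      finally have "norm z * ((1 - 2 * T) / 2) \<le> 4 * sqrt t0" by (simp add: field_simps)
      then show "norm z \<le> \<kappa> * sqrt t0" using T(2) by (simp add: \<kappa>_def field_simps)
    qed (use \<kappa> t0 in auto)
  qed
qed

section \<open>The geometric problem and the coefficient equations\<close>

definition solves_moment_problem ::
  "nat \<Rightarrow> (nat \<Rightarrow> complex) \<Rightarrow> real \<Rightarrow> complex \<Rightarrow> (complex \<Rightarrow> complex) \<Rightarrow> complex set \<Rightarrow> bool" where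
  "solves_moment_problem d t t0 t1 h C \<longleftrightarrow> pos_polynomial_curve_param d h C \<and> 0 \<in> inside C \<and>
     measure lebesgue (inside C) = pi * t0 \<and>
     (\<forall>k\<ge>1. exterior_moment (boundary_loop h) k = (if k = 1 then t1 else if k \<le> d + 1 then t k else 0))"

text \<open>The coefficient equations follow as soon as the origin is inside; they identify the
  Cauchy integral of \<open>cnj\<close> with the moment polynomial, and only then can the
  Cauchy-Pompeiu bound confine the inside to a small disc. The curve, as frontier of the inside,
  lies in the same disc, and the Fourier coefficients of \<open>cnj h\<close> are bounded by its
  maximum on the circle.\<close>

lemma solution_imp_equations:
  assumes d: "d \<ge> 1" and t2: "norm (t 2) < 1 / 2"
  obtains \<delta> \<kappa> :: real where "\<delta> > 0" "\<kappa> > 0"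
    "\<forall>t0 t1 h C. 0 < t0 \<and> t0 < \<delta> \<and> norm t1 \<le> sqrt t0 \<and> solves_moment_problem d t t0 t1 h C \<longrightarrow>
       (\<exists>r a. r > 0 \<and> C = laurent_map d r a ` sphere 0 1 \<and> t0 = r\<^sup>2 - (\<Sum>j\<le>d. j * (norm (a j))\<^sup>2) \<and>
         (\<forall>j\<le>d. norm (a j) \<le> \<kappa> * sqrt t0) \<and>
         (\<forall>j\<le>d. fourier_coeff j (\<lambda>w. poly (moment_poly d t t1) (laurent_map d r a w)) = cnj (a j)))"
proof -
  obtain \<delta> \<kappa> :: real where \<delta>: "\<delta> > 0" and \<kappa>: "\<kappa> > 0" and disc:
    "\<And>t0 t1 D. 0 < t0 \<Longrightarrow> t0 < \<delta> \<Longrightarrow> norm t1 \<le> sqrt t0 \<Longrightarrow> connected D \<Longrightarrow> 0 \<in> D \<Longrightarrow>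
       (\<And>z. z \<in> D \<Longrightarrow> norm (cnj z - poly (moment_poly d t t1) z) \<le> 3 * sqrt t0) \<Longrightarrow> D \<subseteq> cball 0 (\<kappa> * sqrt t0)"
    using a_priori_disc[of d t, OF d t2] by metis
  show ?thesis
  proof (rule that[OF \<delta> \<kappa>], intro allI impI, elim conjE)
    fix t0 t1 h C
    assume t0: "0 < t0" "t0 < \<delta>" and t1: "norm t1 \<le> sqrt t0" and sol: "solves_moment_problem d t t0 t1 h C"
    then have h: "pos_polynomial_curve_param d h C" and zero: "0 \<in> inside C"
      and area: "measure lebesgue (inside C) = pi * t0"
      and moments: "\<forall>k\<ge>1. exterior_moment (boundary_loop h) k = (if k = 1 then t1 else if k \<le> d + 1 then t k else 0)"
      by (simp_all add: solves_moment_problem_def)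
    from h obtain r a where r: "r > 0" and ha: "h = laurent_map d r a" and inj: "inj_on h (sphere 0 1)"
      and C: "C = h ` sphere 0 1" and pos: "positively_oriented (boundary_loop h)"
      unfolding pos_polynomial_curve_param_def polynomial_parametrisation_def by blast
    let ?P = "moment_poly d t t1"
    let ?g = "boundary_loop (laurent_map d r a)"
    have wn: "winding_number ?g z = 1" if "z \<in> inside C" for z
      using loop_winding_inside[of d r a z] inj pos that by (simp add: ha C)
    have notC: "z \<notin> laurent_map d r a ` sphere 0 1" if "z \<in> inside C" for z
      using that inside_no_overlap[of C] unfolding C ha by blast
    have nonzero: "\<forall>w. norm w \<ge> 1 \<longrightarrow> laurent_map d r a w \<noteq> 0"
      using laurent_map_nonzero_exterior[OF r wn[OF zero] notC[OF zero]] by blast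
    have "\<forall>k\<ge>1. contour_integral ?g (\<lambda>z. cnj z / z ^ k) = 2 * of_real pi * \<i> * coeff ?P (k - 1)"
      using moments unfolding exterior_moments_iff by (simp add: ha)
    then have fourier: "\<forall>j\<le>d. fourier_coeff j (\<lambda>w. poly ?P (laurent_map d r a w)) = cnj (a j)"
      unfolding moments_iff_fourier[OF r nonzero degree_moment_poly] .
    have simple: "simple_path ?g" using simple_path_boundary_loop inj by (simp add: ha)
    have pim: "path_image ?g = C" by (simp add: boundary_loop_facts C ha)
    have jordan: "connected (inside C)" "frontier (inside C) = C"
      using Jordan_inside_outside[OF simple boundary_loop_facts(3)] by (simp_all add: pim)
    have "inside C \<subseteq> cball 0 (\<kappa> * sqrt t0)"
    proof (rule disc[OF t0 t1 jordan(1) zero])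
      fix z assume z: "z \<in> inside C"
      have "norm (cnj z - contour_integral ?g (\<lambda>\<zeta>. cnj \<zeta> / (\<zeta> - z)) / (2 * of_real pi * \<i>)) \<le> 3 * sqrt t0"
        by (rule Cauchy_integral_cnj_bound[OF boundary_loop_facts(5,6,1) simple boundary_loop_facts(3)])
          (use wn area t0 z in \<open>auto simp: pim\<close>)
      also have "contour_integral ?g (\<lambda>\<zeta>. cnj \<zeta> / (\<zeta> - z)) / (2 * of_real pi * \<i>) = poly ?P z"
        by (subst Cauchy_integral_cnj_eq_poly[OF r degree_moment_poly wn[OF z] notC[OF z] fourier]) simp
      finally show "norm (cnj z - poly ?P z) \<le> 3 * sqrt t0" .
    qed
    then have "C \<subseteq> cball 0 (\<kappa> * sqrt t0)"
      using jordan(2) by (metis closed_cball closure_minimal frontier_def Diff_subset subset_trans)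
    then have "norm (laurent_map d r a w) \<le> \<kappa> * sqrt t0" if "norm w = 1" for w
    proof -
      have "laurent_map d r a w \<in> C" using that by (simp add: C ha)
      with \<open>C \<subseteq> cball 0 (\<kappa> * sqrt t0)\<close> show ?thesis by (auto dest: subsetD)
    qed
    then have "norm (fourier_coeff j (\<lambda>w. cnj (laurent_map d r a w))) \<le> \<kappa> * sqrt t0" for j
      by (intro norm_fourier_coeff_le continuous_intros laurent_map_continuous_on) auto
    then have "norm (a j) \<le> \<kappa> * sqrt t0" if "j \<le> d" for j
      using that fourier_coeff_cnj_laurent_map[of j d r a] by (metis complex_mod_cnj)
    moreover have "t0 = r\<^sup>2 - (\<Sum>j\<le>d. j * (norm (a j))\<^sup>2)"
      using area area_laurent_curve[of d r a] inj pos by (simp add: C ha)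
    ultimately show "\<exists>r a. r > 0 \<and> C = laurent_map d r a ` sphere 0 1 \<and> t0 = r\<^sup>2 - (\<Sum>j\<le>d. j * (norm (a j))\<^sup>2) \<and>
         (\<forall>j\<le>d. norm (a j) \<le> \<kappa> * sqrt t0) \<and>
         (\<forall>j\<le>d. fourier_coeff j (\<lambda>w. poly ?P (laurent_map d r a w)) = cnj (a j))"
      using r ha C fourier by blast
  qed
qed

text \<open>Winding number 1 at the origin alone decides two things: the origin is inside, as
  outside points have winding number 0, and the orientation is positive, as the winding number of a
  Jordan curve is constantly 1 or constantly -1 on the inside.\<close>

lemma equations_imp_solution:
  assumes r: "r > 0" and t0: "t0 = r\<^sup>2 - (\<Sum>j\<le>d. j * (norm (a j))\<^sup>2)"
    and inj: "inj_on (laurent_map d r a) (sphere 0 1)"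
    and regular: "\<forall>w\<in>sphere 0 1. laurent_deriv d r a w \<noteq> 0"
    and notin: "0 \<notin> laurent_map d r a ` sphere 0 1"
    and wn: "winding_number (boundary_loop (laurent_map d r a)) 0 = 1"
    and fourier: "\<forall>j\<le>d. fourier_coeff j (\<lambda>w. poly (moment_poly d t t1) (laurent_map d r a w)) = cnj (a j)"
  defines "C \<equiv> laurent_map d r a ` sphere 0 1"
  shows "solves_moment_problem d t t0 t1 (laurent_map d r a) C"
proof -
  let ?g = "boundary_loop (laurent_map d r a)"
  have pim: "path_image ?g = C" by (simp add: boundary_loop_facts C_def)
  have simple: "simple_path ?g" by (rule simple_path_boundary_loop[OF inj])
  have zero: "0 \<in> inside C"
  proof (rule ccontr)
    assume "0 \<notin> inside C"
    then have "0 \<in> outside (path_image ?g)" using notin unfolding pim C_def by (metis ComplI UnE inside_Un_outside)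
    then have "winding_number ?g 0 = 0"
      using winding_number_zero_in_outside boundary_loop_facts(2,3) by blast
    then show False using wn by simp
  qed
  have pos: "positively_oriented ?g"
    by (rule simple_closed_path_winding_number_inside[OF simple])
      (use zero wn in \<open>auto simp: positively_oriented_def pim\<close>)
  have "\<forall>w\<in>sphere 0 1. deriv (laurent_map d r a) w \<noteq> 0"
  proof
    fix w :: complex assume w: "w \<in> sphere 0 1"
    then have "w \<noteq> 0" by auto
    then show "deriv (laurent_map d r a) w \<noteq> 0" using regular w by (simp add: deriv_laurent_map)
  qed
  then have "pos_polynomial_curve_param d (laurent_map d r a) C"
    unfolding pos_polynomial_curve_param_def polynomial_parametrisation_def
    using r inj pos by (auto simp: C_def)
  moreover have "measure lebesgue (inside C) = pi * t0"
    using area_laurent_curve[OF inj pos] by (simp add: C_def t0)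
  moreover have "\<forall>w. norm w \<ge> 1 \<longrightarrow> laurent_map d r a w \<noteq> 0"
    using laurent_map_nonzero_exterior[OF r wn notin] by blast
  then have "\<forall>k\<ge>1. exterior_moment ?g k = (if k = 1 then t1 else if k \<le> d + 1 then t k else 0)"
    unfolding exterior_moments_iff using moments_iff_fourier[OF r _ degree_moment_poly] fourier by blast
  ultimately show ?thesis using zero unfolding solves_moment_problem_def by blast
qed

section \<open>The fixed point problem\<close>

text \<open>The weight \<open>j\<close> suppresses index 0 in the sum, so \<open>b 0\<close> is
  added separately. Entries beyond \<open>d\<close> are not seen: on sequences this is a seminorm,
  and equalities derived from it hold for \<open>j \<le> d\<close>.\<close>

definition weighted_norm :: "nat \<Rightarrow> (nat \<Rightarrow> complex) \<Rightarrow> real" where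
  "weighted_norm d b = norm (b 0) + (\<Sum>j\<le>d. j * norm (b j))"

lemma weighted_norm_nonneg: "0 \<le> weighted_norm d b"
  by (simp add: weighted_norm_def add_nonneg_nonneg sum_nonneg)

lemma norm_le_weighted_norm:
  assumes "j \<le> d" shows "norm (b j) \<le> weighted_norm d b"
proof (cases j)
  case 0
  then show ?thesis by (simp add: weighted_norm_def sum_nonneg)
next
  case (Suc n)
  have "norm (b j) \<le> j * norm (b j)" using Suc by (simp add: mult_le_cancel_right1)
  also have "\<dots> \<le> (\<Sum>j\<le>d. j * norm (b j))"
    using assms by (intro member_le_sum) auto
  finally show ?thesis by (simp add: weighted_norm_def add_increasing)
qed

lemma weighted_norm_triangle:
  "weighted_norm d (\<lambda>j. a j - c j) \<le> weighted_norm d (\<lambda>j. a j - b j) + weighted_norm d (\<lambda>j. b j - c j)"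
proof -
  have n: "norm (a j - c j) \<le> norm (a j - b j) + norm (b j - c j)" for j
    using norm_triangle_ineq[of "a j - b j" "b j - c j"] by simp
  have "(\<Sum>j\<le>d. j * norm (a j - c j)) \<le> (\<Sum>j\<le>d. j * norm (a j - b j) + j * norm (b j - c j))"
    by (intro sum_mono) (simp only: distrib_left[symmetric], intro mult_left_mono n, simp)
  then show ?thesis using n[of 0] by (simp add: weighted_norm_def sum.distrib)
qed

lemma weighted_norm_minus_commute:
  "weighted_norm d (\<lambda>j. a j - b j) = weighted_norm d (\<lambda>j. b j - a j)"
  by (simp add: weighted_norm_def norm_minus_commute)

lemma weighted_norm_le_diff:
  "weighted_norm d a \<le> weighted_norm d (\<lambda>j. a j - b j) + weighted_norm d b"
  using weighted_norm_triangle[of d a "\<lambda>_. 0" b] by simp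

lemma weighted_norm_mono:
  assumes "\<And>j. j \<le> d \<Longrightarrow> norm (a j) \<le> norm (b j)"
  shows "weighted_norm d a \<le> weighted_norm d b"
  unfolding weighted_norm_def using assms by (intro add_mono sum_mono mult_left_mono) auto

lemma tendsto_weighted_norm_zero:
  assumes "\<And>j. j \<le> d \<Longrightarrow> (\<lambda>n. x n j) \<longlonglongrightarrow> y j"
  shows "(\<lambda>n. weighted_norm d (\<lambda>j. x n j - y j)) \<longlonglongrightarrow> 0"
proof -
  have n: "(\<lambda>n. norm (x n j - y j)) \<longlonglongrightarrow> 0" if "j \<le> d" for j
    using assms[OF that] by (simp add: LIM_zero tendsto_norm_zero)
  have "(\<lambda>n. norm (x n 0 - y 0) + (\<Sum>j\<le>d. j * norm (x n j - y j))) \<longlonglongrightarrow> 0 + (\<Sum>j\<le>d. real j * 0)"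
    by (intro tendsto_add tendsto_sum tendsto_mult tendsto_const n) auto
  then show ?thesis by (simp add: weighted_norm_def)
qed

text \<open>Picard iteration from the zero sequence, carried out by components: convergence follows
  for each index up to \<open>d\<close>, which is also the range of the conclusion.\<close>

lemma weighted_norm_Banach:
  fixes \<Phi> :: "(nat \<Rightarrow> complex) \<Rightarrow> nat \<Rightarrow> complex"
  assumes q: "0 \<le> q" "q < 1" and K: "0 \<le> K"
    and self: "\<And>b. weighted_norm d b \<le> K \<Longrightarrow> weighted_norm d (\<Phi> b) \<le> K"
    and contr: "\<And>b c. weighted_norm d b \<le> K \<Longrightarrow> weighted_norm d c \<le> K \<Longrightarrow>
       weighted_norm d (\<lambda>j. \<Phi> b j - \<Phi> c j) \<le> q * weighted_norm d (\<lambda>j. b j - c j)"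
  shows "\<exists>b. weighted_norm d b \<le> K \<and> (\<forall>j\<le>d. \<Phi> b j = b j)"
proof -
  let ?N = "weighted_norm d"
  define x where "x n = (\<Phi> ^^ n) (\<lambda>_. 0)" for n
  have x_Suc: "x (Suc n) = \<Phi> (x n)" for n by (simp add: x_def)
  have xK: "?N (x n) \<le> K" for n
  proof (induction n)
    case 0 show ?case using K by (simp add: x_def weighted_norm_def)
  next
    case (Suc n) then show ?case by (simp add: x_Suc self)
  qed
  define A where "A = ?N (\<lambda>j. x 1 j - x 0 j)"
  have step: "?N (\<lambda>j. x (Suc n) j - x n j) \<le> A * q ^ n" for n
  proof (induction n)
    case 0 show ?case by (simp add: A_def)
  next
    case (Suc n)
    have "?N (\<lambda>j. x (Suc (Suc n)) j - x (Suc n) j) \<le> q * ?N (\<lambda>j. x (Suc n) j - x n j)"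
      unfolding x_Suc[of "Suc n"] x_Suc[of n] using contr[OF xK[of "Suc n"] xK[of n]] by (simp add: x_Suc)
    also have "\<dots> \<le> q * (A * q ^ n)" using Suc q by (intro mult_left_mono) auto
    finally show ?case by (simp add: mult_ac)
  qed
  have conv: "convergent (\<lambda>n. x n j)" if j: "j \<le> d" for j
  proof -
    have "summable (\<lambda>n. x (Suc n) j - x n j)"
    proof (rule summable_comparison_test')
      show "summable (\<lambda>n. A * q ^ n)" using q by (intro summable_mult summable_geometric) auto
      show "norm (x (Suc n) j - x n j) \<le> A * q ^ n" for n
        using norm_le_weighted_norm[OF j, of "\<lambda>j. x (Suc n) j - x n j"] step[of n] by simp
    qed
    then have "convergent (\<lambda>n. \<Sum>i<n. x (Suc i) j - x i j)" by (simp add: summable_iff_convergent)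
    moreover have "(\<lambda>n. \<Sum>i<n. x (Suc i) j - x i j) = (\<lambda>n. x n j - x 0 j)"
      using sum_lessThan_telescope[of "\<lambda>n. x n j"] by auto
    ultimately have "convergent (\<lambda>n. x n j - x 0 j)" by simp
    from convergent_add[OF this convergent_const[of "x 0 j"]] show ?thesis by simp
  qed
  define y where "y j = lim (\<lambda>n. x n j)" for j
  have y: "(\<lambda>n. x n j) \<longlonglongrightarrow> y j" if "j \<le> d" for j
    unfolding y_def using conv[OF that] by (simp only: convergent_LIMSEQ_iff)
  have lim: "(\<lambda>n. ?N (\<lambda>j. x n j - y j)) \<longlonglongrightarrow> 0" using y by (rule tendsto_weighted_norm_zero)
  have yK: "?N y \<le> K"
  proof (rule LIMSEQ_le_const)
    show "(\<lambda>n. ?N (\<lambda>j. x n j - y j) + K) \<longlonglongrightarrow> K" using tendsto_add[OF lim tendsto_const[of K]] by simp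
    have "?N y \<le> ?N (\<lambda>j. x n j - y j) + K" for n
      using weighted_norm_le_diff[of d y "x n"] weighted_norm_minus_commute[of d y "x n"] xK[of n] by simp
    then show "\<exists>N. \<forall>n\<ge>N. ?N y \<le> ?N (\<lambda>j. x n j - y j) + K" by blast
  qed
  have "?N (\<lambda>j. \<Phi> y j - y j) \<le> 0"
  proof (rule LIMSEQ_le_const)
    show "(\<lambda>n. q * ?N (\<lambda>j. x n j - y j) + ?N (\<lambda>j. x (Suc n) j - y j)) \<longlonglongrightarrow> 0"
      using tendsto_add[OF tendsto_mult[OF tendsto_const[of q] lim] LIMSEQ_Suc[OF lim]] by simp
    have "?N (\<lambda>j. \<Phi> y j - y j) \<le> q * ?N (\<lambda>j. x n j - y j) + ?N (\<lambda>j. x (Suc n) j - y j)" for n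
      using weighted_norm_triangle[of d "\<Phi> y" y "\<Phi> (x n)"] contr[OF yK xK[of n]] weighted_norm_minus_commute[of d y "x n"]
      by (simp add: x_Suc)
    then show "\<exists>N. \<forall>n\<ge>N. ?N (\<lambda>j. \<Phi> y j - y j) \<le> q * ?N (\<lambda>j. x n j - y j) + ?N (\<lambda>j. x (Suc n) j - y j)" by blast
  qed
  then have "\<forall>j\<le>d. \<Phi> y j = y j"
    using norm_le_weighted_norm[of _ d "\<lambda>j. \<Phi> y j - y j"] by (metis norm_le_zero_iff order_trans right_minus_eq)
  then show ?thesis using yK by blast
qed

section \<open>Lipschitz bounds for the remainder and the radius\<close>

text \<open>The point is uniformity in the scale \<open>s\<close>, which is made small only after
  the constant is fixed. The Horner induction preserves it because each step brings a factor
  \<open>s * z\<close> with \<open>s \<le> 1\<close>.\<close>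

lemma scaled_poly_Lipschitz:
  fixes R :: "complex poly"
  assumes M: "M \<ge> 0"
  shows "\<exists>L\<ge>0. \<forall>s::real. 0 \<le> s \<and> s \<le> 1 \<longrightarrow> (\<forall>z z'. norm z \<le> M \<and> norm z' \<le> M \<longrightarrow>
     norm (poly R (of_real s * z)) \<le> L \<and> norm (poly R (of_real s * z) - poly R (of_real s * z')) \<le> L * norm (z - z'))"
proof (induction R)
  case 0 show ?case by (intro exI[of _ 0]) auto
next
  case (pCons c R)
  then obtain L where L0: "L \<ge> 0" and L: "\<forall>s::real. 0 \<le> s \<and> s \<le> 1 \<longrightarrow> (\<forall>z z'. norm z \<le> M \<and> norm z' \<le> M \<longrightarrow>
     norm (poly R (of_real s * z)) \<le> L \<and> norm (poly R (of_real s * z) - poly R (of_real s * z')) \<le> L * norm (z - z'))"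
    by (elim exE conjE)
  show ?case
  proof (intro exI[of _ "norm c + L + M * L"] conjI allI impI)
    fix s :: real and z z' :: complex assume s: "0 \<le> s \<and> s \<le> 1" and z: "norm z \<le> M \<and> norm z' \<le> M"
    let ?p = "poly R (of_real s * z)" and ?p' = "poly R (of_real s * z')"
    have b: "norm ?p \<le> L" and l: "norm (?p - ?p') \<le> L * norm (z - z')"
      using L[rule_format, OF s z] by auto
    have s1: "s * X \<le> X" if "X \<ge> 0" for X using s that by (simp add: mult_left_le_one_le)
    have "norm (poly (pCons c R) (of_real s * z)) \<le> norm c + s * (norm z * norm ?p)"
      using s by (simp, intro order_trans[OF norm_triangle_ineq]) (simp add: norm_mult mult_ac)
    also have "\<dots> \<le> norm c + norm z * norm ?p" using s1[of "norm z * norm ?p"] by simp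
    also have "\<dots> \<le> norm c + M * L" using z b M by (intro add_left_mono mult_mono) auto
    finally show "norm (poly (pCons c R) (of_real s * z)) \<le> norm c + L + M * L" using L0 by simp
    have "poly (pCons c R) (of_real s * z) - poly (pCons c R) (of_real s * z') = of_real s * ((z - z') * ?p + z' * (?p - ?p'))"
      by (simp add: algebra_simps)
    then have "norm (poly (pCons c R) (of_real s * z) - poly (pCons c R) (of_real s * z')) = s * norm ((z - z') * ?p + z' * (?p - ?p'))"
      using s by (simp add: norm_mult)
    also have "\<dots> \<le> norm ((z - z') * ?p + z' * (?p - ?p'))" using s1 by simp
    also have "\<dots> \<le> norm (z - z') * norm ?p + norm z' * norm (?p - ?p')"
      by (intro order_trans[OF norm_triangle_ineq]) (simp add: norm_mult)
    also have "\<dots> \<le> norm (z - z') * L + M * (L * norm (z - z'))"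
      using b l z M by (intro add_mono mult_left_mono mult_mono) auto
    also have "\<dots> \<le> (norm c + L + M * L) * norm (z - z')" by (simp add: algebra_simps)
    finally show "norm (poly (pCons c R) (of_real s * z) - poly (pCons c R) (of_real s * z')) \<le> (norm c + L + M * L) * norm (z - z')" .
  qed (use L0 M in auto)
qed

lemma scaled_remainder_Lipschitz:
  fixes R :: "complex poly"
  assumes M: "M \<ge> 0"
  shows "\<exists>L\<ge>0. \<forall>s::real. 0 \<le> s \<and> s \<le> 1 \<longrightarrow> (\<forall>z z'. norm z \<le> M \<and> norm z' \<le> M \<longrightarrow>
     norm (z\<^sup>2 * poly R (of_real s * z)) \<le> L \<and> norm (z\<^sup>2 * poly R (of_real s * z) - z'\<^sup>2 * poly R (of_real s * z')) \<le> L * norm (z - z'))"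
proof -
  obtain L where L0: "L \<ge> 0" and L: "\<forall>s::real. 0 \<le> s \<and> s \<le> 1 \<longrightarrow> (\<forall>z z'. norm z \<le> M \<and> norm z' \<le> M \<longrightarrow>
     norm (poly R (of_real s * z)) \<le> L \<and> norm (poly R (of_real s * z) - poly R (of_real s * z')) \<le> L * norm (z - z'))"
    using scaled_poly_Lipschitz[OF M, of R] by (elim exE conjE)
  show ?thesis
  proof (intro exI[of _ "M\<^sup>2 * L + 2 * M * L"] conjI allI impI)
    fix s :: real and z z' :: complex assume s: "0 \<le> s \<and> s \<le> 1" and z: "norm z \<le> M \<and> norm z' \<le> M"
    let ?p = "poly R (of_real s * z)" and ?p' = "poly R (of_real s * z')"
    have b: "norm ?p \<le> L" and l: "norm (?p - ?p') \<le> L * norm (z - z')"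
      using L[rule_format, OF s z] by auto
    have "norm (z\<^sup>2 * ?p) \<le> M\<^sup>2 * L" unfolding norm_mult norm_power
      using z b by (intro mult_mono power_mono) auto
    then show "norm (z\<^sup>2 * ?p) \<le> M\<^sup>2 * L + 2 * M * L" using M L0 by (simp add: add_increasing2)
    have "z\<^sup>2 * ?p - z'\<^sup>2 * ?p' = (z + z') * (z - z') * ?p + z'\<^sup>2 * (?p - ?p')"
      by (simp add: algebra_simps power2_eq_square)
    also have "norm \<dots> \<le> norm (z + z') * norm (z - z') * norm ?p + (norm z')\<^sup>2 * norm (?p - ?p')"
      by (intro order_trans[OF norm_triangle_ineq]) (simp add: norm_mult norm_power)
    also have "\<dots> \<le> (2 * M) * norm (z - z') * L + M\<^sup>2 * (L * norm (z - z'))"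
      using b l z M norm_triangle_ineq[of z z'] by (intro add_mono mult_mono power_mono) auto
    finally show "norm (z\<^sup>2 * ?p - z'\<^sup>2 * ?p') \<le> (M\<^sup>2 * L + 2 * M * L) * norm (z - z')"
      by (simp add: algebra_simps)
  qed (use L0 M in auto)
qed

text \<open>Positive root \<open>\<rho>\<close> of the area equation divided by \<open>t0\<close>,
  that is, of \<open>\<rho>\<^sup>2 - \<Sum> j * (norm (b j))\<^sup>2 = 1\<close>. It removes
  \<open>r\<close> from the unknowns.\<close>

definition scaled_radius :: "nat \<Rightarrow> (nat \<Rightarrow> complex) \<Rightarrow> real" where
  "scaled_radius d b = sqrt (1 + (\<Sum>j\<le>d. j * (norm (b j))\<^sup>2))"

lemma scaled_radius_ge_1: "1 \<le> scaled_radius d b"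
  by (simp add: scaled_radius_def sum_nonneg)

lemma scaled_radius_sq: "(scaled_radius d b)\<^sup>2 = 1 + (\<Sum>j\<le>d. j * (norm (b j))\<^sup>2)"
  unfolding scaled_radius_def by (rule real_sqrt_pow2) (simp add: add_nonneg_nonneg sum_nonneg)

lemma norm_le_scaled_radius:
  assumes "1 \<le> j" "j \<le> d"
  shows "norm (b j) \<le> scaled_radius d b"
proof (rule power2_le_imp_le)
  have "(norm (b j))\<^sup>2 \<le> j * (norm (b j))\<^sup>2" using assms(1) by (simp add: mult_le_cancel_right1)
  also have "\<dots> \<le> (\<Sum>j\<le>d. j * (norm (b j))\<^sup>2)" using assms(2) by (intro member_le_sum) auto
  finally show "(norm (b j))\<^sup>2 \<le> (scaled_radius d b)\<^sup>2" unfolding scaled_radius_sq by simp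
qed (use scaled_radius_ge_1[of d b] in linarith)

text \<open>Multiplied by the sum of the two radii, the difference becomes one of squares, and for
  \<open>j \<ge> 1\<close> each \<open>norm (b j) + norm (c j)\<close> is at most that sum. The
  constant 1 keeps the contraction factor at \<open>2 * norm (t 2)\<close> plus a small
  term.\<close>

lemma scaled_radius_Lipschitz:
  "\<bar>scaled_radius d b - scaled_radius d c\<bar> \<le> (\<Sum>j\<le>d. j * norm (b j - c j))"
proof -
  let ?B = "scaled_radius d b" and ?C = "scaled_radius d c"
  have pos: "?B + ?C > 0" using scaled_radius_ge_1[of d b] scaled_radius_ge_1[of d c] by linarith
  have "\<bar>?B - ?C\<bar> * (?B + ?C) = \<bar>?B\<^sup>2 - ?C\<^sup>2\<bar>"
    using pos by (simp add: power2_eq_square square_diff_square_factored abs_mult mult.commute)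
  also have "\<dots> = \<bar>\<Sum>j\<le>d. j * ((norm (b j))\<^sup>2 - (norm (c j))\<^sup>2)\<bar>"
    by (simp add: scaled_radius_sq right_diff_distrib sum_subtractf)
  also have "\<dots> \<le> (\<Sum>j\<le>d. \<bar>j * ((norm (b j))\<^sup>2 - (norm (c j))\<^sup>2)\<bar>)" by (rule sum_abs)
  also have "\<dots> \<le> (\<Sum>j\<le>d. j * norm (b j - c j) * (?B + ?C))"
  proof (rule sum_mono)
    fix j assume j: "j \<in> {..d}"
    show "\<bar>j * ((norm (b j))\<^sup>2 - (norm (c j))\<^sup>2)\<bar> \<le> j * norm (b j - c j) * (?B + ?C)"
    proof (cases "j = 0")
      case False
      then have le: "norm (b j) + norm (c j) \<le> ?B + ?C"
        using j by (intro add_mono norm_le_scaled_radius) auto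
      have "\<bar>(norm (b j))\<^sup>2 - (norm (c j))\<^sup>2\<bar> = \<bar>norm (b j) - norm (c j)\<bar> * (norm (b j) + norm (c j))"
        by (simp add: power2_eq_square square_diff_square_factored abs_mult mult.commute)
      also have "\<dots> \<le> norm (b j - c j) * (?B + ?C)"
        using norm_triangle_ineq3[of "b j" "c j"] le by (intro mult_mono) auto
      finally show ?thesis by (simp add: abs_mult mult.assoc mult_left_mono)
    qed simp
  qed
  finally have "\<bar>?B - ?C\<bar> * (?B + ?C) \<le> (\<Sum>j\<le>d. j * norm (b j - c j)) * (?B + ?C)"
    by (simp add: sum_distrib_right)
  then show ?thesis using pos by (simp add: mult_le_cancel_right)
qed

lemma scaled_radius_le: "scaled_radius d b \<le> 1 + (\<Sum>j\<le>d. j * norm (b j))"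
  using scaled_radius_Lipschitz[of d b "\<lambda>_. 0"] by (simp add: scaled_radius_def)

lemma norm_laurent_map_le:
  assumes "norm w = 1"
  shows "norm (laurent_map d r a w) \<le> \<bar>r\<bar> + weighted_norm d a"
proof -
  have "norm (\<Sum>j\<le>d. a j / w ^ j) \<le> (\<Sum>j\<le>d. norm (a j))"
    by (rule sum_norm_le) (simp add: assms norm_divide norm_power)
  also have "\<dots> = norm (a 0) + (\<Sum>j\<in>{..d} - {0}. norm (a j))"
    by (subst sum.remove[of _ 0]) auto
  also have "(\<Sum>j\<in>{..d} - {0}. norm (a j)) \<le> (\<Sum>j\<in>{..d} - {0}. j * norm (a j))"
    by (rule sum_mono) (auto simp: mult_le_cancel_right1)
  also have "\<dots> \<le> (\<Sum>j\<le>d. j * norm (a j))" by (rule sum_mono2) auto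
  finally have "norm (\<Sum>j\<le>d. a j / w ^ j) \<le> weighted_norm d a" by (simp add: weighted_norm_def)
  moreover have "norm (of_real r * w) = \<bar>r\<bar>" using assms by (simp add: norm_mult)
  ultimately show ?thesis
    unfolding laurent_map_def by (intro order_trans[OF norm_triangle_ineq]) simp
qed

lemma laurent_map_diff:
  "laurent_map d r a w - laurent_map d r' a' w = laurent_map d (r - r') (\<lambda>j. a j - a' j) w"
  by (simp add: laurent_map_def algebra_simps diff_divide_distrib sum_subtractf)

lemma laurent_map_scale:
  "laurent_map d (s * r) (\<lambda>j. of_real s * a j) w = of_real s * laurent_map d r a w"
  by (simp add: laurent_map_def algebra_simps sum_distrib_left)

lemma fourier_coeff_laurent_map:
  "fourier_coeff j (laurent_map d r a) = (if j = 0 then a 0 else if j = 1 then of_real r else 0)"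
proof -
  define A where "A = monom (of_real r) (Suc d) + (\<Sum>i\<le>d. monom (a i) (d - i))"
  have "fourier_coeff j (laurent_map d r a) = fourier_coeff j (\<lambda>w. poly A w / w ^ d)"
  proof (rule fourier_coeff_cong)
    fix w :: complex assume "norm w = 1"
    then have "w \<noteq> 0" by auto
    then show "laurent_map d r a w = poly A w / w ^ d"
      by (simp add: A_def laurent_map_def poly_sum poly_monom add_divide_distrib sum_divide_distrib power_diff)
  qed
  also have "\<dots> = coeff A (d + j)" by (rule fourier_coeff_poly_quotient)
  also have "coeff (\<Sum>i\<le>d. monom (a i) (d - i)) (d + j) = (\<Sum>i\<le>d. if i = 0 then (if j = 0 then a 0 else 0) else 0)"
    unfolding coeff_sum by (intro sum.cong) auto
  then have "coeff A (d + j) = (if j = 0 then a 0 else if j = 1 then of_real r else 0)"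
    by (auto simp: A_def)
  finally show ?thesis .
qed

text \<open>\<open>A\<close> and \<open>B\<close> are main terms at the indices 0 and 1,
  \<open>D\<close> is an error common to all indices; its factor in the second claim is the weighted
  norm of the constant sequence 1.\<close>

lemma weighted_norm_bound:
  assumes d: "d \<ge> 1" and "0 \<le> A" "0 \<le> B"
    and x: "\<And>j. j \<le> d \<Longrightarrow> norm (x j) \<le> (if j = 0 then A else if j = 1 then B else 0) + D"
  shows "(\<Sum>j\<le>d. j * norm (x j)) \<le> B + (\<Sum>j\<le>d. real j) * D"
    and "weighted_norm d x \<le> A + B + (1 + (\<Sum>j\<le>d. real j)) * D"
proof -
  have "(\<Sum>j\<le>d. j * norm (x j)) \<le> (\<Sum>j\<le>d. (if j = 1 then B else 0) + j * D)"
  proof (rule sum_mono)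
    fix j assume "j \<in> {..d}"
    then show "j * norm (x j) \<le> (if j = 1 then B else 0) + j * D"
      using x[of j] mult_left_mono[of "norm (x j)" D "real j"] by (cases "j = 0") (auto split: if_splits)
  qed
  also have "\<dots> = B + (\<Sum>j\<le>d. real j) * D"
    using d by (simp add: sum.distrib sum_distrib_right)
  finally show *: "(\<Sum>j\<le>d. j * norm (x j)) \<le> B + (\<Sum>j\<le>d. real j) * D" .
  show "weighted_norm d x \<le> A + B + (1 + (\<Sum>j\<le>d. real j)) * D"
    using * x[of 0] by (simp add: weighted_norm_def algebra_simps)
qed

section \<open>The coefficient iteration\<close>

text \<open>Write \<open>H\<close> for the scaled map and \<open>R\<close> for the tail. Dividing
  the moment polynomial at \<open>s * H\<close> by \<open>s\<close> gives
  \<open>\<tau> + 2 * t 2 * H + s * (H\<^sup>2 * R (s * H))\<close>; this is a coefficient of the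
  last product, without the factor \<open>s\<close>.\<close>

definition scaled_remainder :: "nat \<Rightarrow> (nat \<Rightarrow> complex) \<Rightarrow> real \<Rightarrow> (nat \<Rightarrow> complex) \<Rightarrow> nat \<Rightarrow> complex" where
  "scaled_remainder d t s b j = fourier_coeff j (\<lambda>w. (laurent_map d (scaled_radius d b) b w)\<^sup>2 *
     poly (moment_poly_tail d t) (of_real s * laurent_map d (scaled_radius d b) b w))"

text \<open>The scaled map has only two nonnegative powers, with coefficients \<open>b 0\<close> and
  the radius, so the affine part acts at the indices 0 and 1 alone. For \<open>s = 0\<close> a fixed
  point is an ellipse with \<open>b 1 = 2 * cnj (t 2) * \<rho>\<close>, where \<open>\<rho>\<close>
  is its scaled radius.\<close>

definition coeff_iteration ::
  "nat \<Rightarrow> (nat \<Rightarrow> complex) \<Rightarrow> real \<Rightarrow> complex \<Rightarrow> (nat \<Rightarrow> complex) \<Rightarrow> nat \<Rightarrow> complex" where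
  "coeff_iteration d t s \<tau> b j = cnj ((if j = 0 then \<tau> + 2 * t 2 * b 0 else if j = 1 then 2 * t 2 * of_real (scaled_radius d b) else 0)
     + of_real s * scaled_remainder d t s b j)"

lemma fourier_coeff_moment_poly:
  assumes d: "d \<ge> 1"
  shows "fourier_coeff j (\<lambda>w. poly (moment_poly d t (of_real s * \<tau>))
       (laurent_map d (s * scaled_radius d b) (\<lambda>j. of_real s * b j) w)) = of_real s * cnj (coeff_iteration d t s \<tau> b j)"
proof -
  let ?H = "laurent_map d (scaled_radius d b) b"
  let ?G = "\<lambda>w. (?H w)\<^sup>2 * poly (moment_poly_tail d t) (of_real s * ?H w)"
  have cH: "continuous_on (sphere 0 1) ?H" by (rule laurent_map_continuous_on) simp
  then have cG: "continuous_on (sphere 0 1) ?G" by (intro continuous_intros)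
  have const: "fourier_coeff j (\<lambda>w. \<tau>) = (if j = 0 then \<tau> else 0)"
    using fourier_coeff_poly_quotient[of j "[:\<tau>:]" 0] by (cases j) auto
  have "(\<lambda>w. poly (moment_poly d t (of_real s * \<tau>)) (laurent_map d (s * scaled_radius d b) (\<lambda>j. of_real s * b j) w))
      = (\<lambda>w. of_real s * ((\<tau> + (2 * t 2) * ?H w) + of_real s * ?G w))"
    by (simp add: fun_eq_iff laurent_map_scale poly_moment_poly[OF d] algebra_simps power2_eq_square)
  then have "fourier_coeff j (\<lambda>w. poly (moment_poly d t (of_real s * \<tau>)) (laurent_map d (s * scaled_radius d b) (\<lambda>j. of_real s * b j) w))
     = fourier_coeff j (\<lambda>w. of_real s * ((\<tau> + (2 * t 2) * ?H w) + of_real s * ?G w))" by simp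
  also have "\<dots> = of_real s * fourier_coeff j (\<lambda>w. (\<tau> + (2 * t 2) * ?H w) + of_real s * ?G w)"
    by (intro fourier_coeff_cmult continuous_intros cH)
  also have "fourier_coeff j (\<lambda>w. (\<tau> + (2 * t 2) * ?H w) + of_real s * ?G w)
     = fourier_coeff j (\<lambda>w. \<tau> + (2 * t 2) * ?H w) + fourier_coeff j (\<lambda>w. of_real s * ?G w)"
    by (intro fourier_coeff_add continuous_intros cH)
  also have "fourier_coeff j (\<lambda>w. \<tau> + (2 * t 2) * ?H w) = fourier_coeff j (\<lambda>w. \<tau>) + fourier_coeff j (\<lambda>w. (2 * t 2) * ?H w)"
    by (intro fourier_coeff_add continuous_intros cH)
  also have "fourier_coeff j (\<lambda>w. (2 * t 2) * ?H w) = 2 * t 2 * fourier_coeff j ?H"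
    by (intro fourier_coeff_cmult cH)
  also have "fourier_coeff j (\<lambda>w. of_real s * ?G w) = of_real s * scaled_remainder d t s b j"
    unfolding scaled_remainder_def by (intro fourier_coeff_cmult cG)
  finally show ?thesis
    by (simp add: const fourier_coeff_laurent_map coeff_iteration_def)
qed

text \<open>On the circle the scaled map is bounded by \<open>1 + 2 * K\<close>, as its radius is at
  most \<open>1 + K\<close>. It is Lipschitz in the coefficients with constant 2: one unit from the
  radius and one from the coefficients themselves.\<close>

lemma scaled_remainder_bounds:
  assumes K: "K \<ge> 0"
  obtains L where "L \<ge> 0"
    "\<forall>s b j. 0 \<le> s \<and> s \<le> 1 \<and> weighted_norm d b \<le> K \<longrightarrow> norm (scaled_remainder d t s b j) \<le> L"
    "\<forall>s b c j. 0 \<le> s \<and> s \<le> 1 \<and> weighted_norm d b \<le> K \<and> weighted_norm d c \<le> K \<longrightarrow>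
       norm (scaled_remainder d t s b j - scaled_remainder d t s c j) \<le> L * (2 * weighted_norm d (\<lambda>j. b j - c j))"
proof -
  let ?R = "moment_poly_tail d t"
  obtain L where L0: "L \<ge> 0" and L: "\<forall>s::real. 0 \<le> s \<and> s \<le> 1 \<longrightarrow> (\<forall>z z'. norm z \<le> 1 + 2 * K \<and> norm z' \<le> 1 + 2 * K \<longrightarrow>
     norm (z\<^sup>2 * poly ?R (of_real s * z)) \<le> L \<and> norm (z\<^sup>2 * poly ?R (of_real s * z) - z'\<^sup>2 * poly ?R (of_real s * z')) \<le> L * norm (z - z'))"
    using scaled_remainder_Lipschitz[of "1 + 2 * K" ?R] K by auto
  define H where "H b = laurent_map d (scaled_radius d b) b" for b
  have cH: "continuous_on (sphere 0 1) (H b)" for b unfolding H_def by (rule laurent_map_continuous_on) simp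
  have HK: "norm (H b w) \<le> 1 + 2 * K" if "weighted_norm d b \<le> K" "norm w = 1" for b w
  proof -
    have "scaled_radius d b \<le> 1 + weighted_norm d b"
      using scaled_radius_le[of d b] norm_ge_zero[of "b 0"] unfolding weighted_norm_def by linarith
    then show ?thesis
      using norm_laurent_map_le[OF that(2), of d "scaled_radius d b" b] that(1) scaled_radius_ge_1[of d b] unfolding H_def by simp
  qed
  have Hdiff: "norm (H b w - H c w) \<le> 2 * weighted_norm d (\<lambda>j. b j - c j)" if "norm w = 1" for b c w
  proof -
    have "norm (H b w - H c w) \<le> \<bar>scaled_radius d b - scaled_radius d c\<bar> + weighted_norm d (\<lambda>j. b j - c j)"
      unfolding H_def laurent_map_diff by (rule norm_laurent_map_le[OF that])
    moreover have "\<bar>scaled_radius d b - scaled_radius d c\<bar> \<le> weighted_norm d (\<lambda>j. b j - c j)"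
      using scaled_radius_Lipschitz[of d b c] by (simp add: weighted_norm_def add_increasing)
    ultimately show ?thesis by simp
  qed
  have sr: "scaled_remainder d t s b j = fourier_coeff j (\<lambda>w. (H b w)\<^sup>2 * poly ?R (of_real s * H b w))" for s b j
    by (simp add: scaled_remainder_def H_def)
  show ?thesis
  proof (rule that[OF L0]; intro allI impI; elim conjE)
    fix s b j assume s: "0 \<le> s" "s \<le> (1::real)" and b: "weighted_norm d b \<le> K"
    show "norm (scaled_remainder d t s b j) \<le> L"
      unfolding sr using L[rule_format, of s] s HK[OF b] by (intro norm_fourier_coeff_le continuous_intros cH) auto
  next
    fix s b c j assume s: "0 \<le> s" "s \<le> (1::real)" and b: "weighted_norm d b \<le> K" and c: "weighted_norm d c \<le> K"
    have "scaled_remainder d t s b j - scaled_remainder d t s c j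
      = fourier_coeff j (\<lambda>w. (H b w)\<^sup>2 * poly ?R (of_real s * H b w) - (H c w)\<^sup>2 * poly ?R (of_real s * H c w))"
      unfolding sr by (intro fourier_coeff_diff[symmetric] continuous_intros cH)
    also have "norm \<dots> \<le> L * (2 * weighted_norm d (\<lambda>j. b j - c j))"
    proof (intro norm_fourier_coeff_le continuous_intros cH)
      fix w :: complex assume w: "norm w = 1"
      have "norm ((H b w)\<^sup>2 * poly ?R (of_real s * H b w) - (H c w)\<^sup>2 * poly ?R (of_real s * H c w)) \<le> L * norm (H b w - H c w)"
        using L[rule_format, of s] s HK[OF b w] HK[OF c w] by auto
      also have "\<dots> \<le> L * (2 * weighted_norm d (\<lambda>j. b j - c j))"
        using Hdiff[OF w] L0 by (intro mult_left_mono) auto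
      finally show "norm ((H b w)\<^sup>2 * poly ?R (of_real s * H b w) - (H c w)\<^sup>2 * poly ?R (of_real s * H c w)) \<le> L * (2 * weighted_norm d (\<lambda>j. b j - c j))" .
    qed
    finally show "norm (scaled_remainder d t s b j - scaled_remainder d t s c j) \<le> L * (2 * weighted_norm d (\<lambda>j. b j - c j))" .
  qed
qed

lemma coeff_iteration_self_map:
  assumes d: "d \<ge> 1" and \<tau>: "norm \<tau> \<le> 1" and s: "0 \<le> s"
    and R: "\<And>j. norm (scaled_remainder d t s b j) \<le> L"
  shows "weighted_norm d (coeff_iteration d t s \<tau> b)
     \<le> 1 + 2 * norm (t 2) * (1 + weighted_norm d b) + (1 + (\<Sum>j\<le>d. real j)) * (s * L)"
proof -
  have "weighted_norm d (coeff_iteration d t s \<tau> b)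
    \<le> (1 + 2 * norm (t 2) * norm (b 0)) + 2 * norm (t 2) * scaled_radius d b + (1 + (\<Sum>j\<le>d. real j)) * (s * L)"
  proof (rule weighted_norm_bound(2)[OF d])
    fix j :: nat
    have "norm (of_real s * scaled_remainder d t s b j) \<le> s * L"
      using R[of j] s by (simp add: norm_mult mult_left_mono)
    moreover have "norm (if j = 0 then \<tau> + 2 * t 2 * b 0 else if j = 1 then 2 * t 2 * of_real (scaled_radius d b) else 0)
       \<le> (if j = 0 then 1 + 2 * norm (t 2) * norm (b 0) else if j = 1 then 2 * norm (t 2) * scaled_radius d b else 0)"
      using \<tau> norm_triangle_ineq[of \<tau> "2 * t 2 * b 0"] scaled_radius_ge_1[of d b] by (simp add: norm_mult)
    ultimately show "norm (coeff_iteration d t s \<tau> b j) \<le> (if j = 0 then 1 + 2 * norm (t 2) * norm (b 0) else if j = 1 then 2 * norm (t 2) * scaled_radius d b else 0) + s * L"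
      unfolding coeff_iteration_def complex_mod_cnj by (rule norm_triangle_mono[OF _, rotated])
  qed (use scaled_radius_ge_1[of d b] in auto)
  moreover have "2 * norm (t 2) * scaled_radius d b \<le> 2 * norm (t 2) * (1 + (\<Sum>j\<le>d. j * norm (b j)))"
    by (intro mult_left_mono scaled_radius_le) auto
  ultimately show ?thesis by (simp add: weighted_norm_def algebra_simps)
qed

text \<open>The main terms at the indices 0 and 1 use complementary parts of the weighted norm,
  \<open>norm (b 0 - c 0)\<close> and the sum that controls the radius, so
  \<open>2 * norm (t 2)\<close> is paid only once.\<close>

lemma coeff_iteration_contraction:
  assumes d: "d \<ge> 1" and s: "0 \<le> s"
    and R: "\<And>j. norm (scaled_remainder d t s b j - scaled_remainder d t s c j) \<le> L * (2 * weighted_norm d (\<lambda>j. b j - c j))"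
  shows "weighted_norm d (\<lambda>j. coeff_iteration d t s \<tau> b j - coeff_iteration d t s \<tau> c j)
     \<le> (2 * norm (t 2) + 2 * ((1 + (\<Sum>j\<le>d. real j)) * (s * L))) * weighted_norm d (\<lambda>j. b j - c j)"
proof -
  let ?N = "weighted_norm d (\<lambda>j. b j - c j)"
  have "weighted_norm d (\<lambda>j. coeff_iteration d t s \<tau> b j - coeff_iteration d t s \<tau> c j)
    \<le> 2 * norm (t 2) * norm (b 0 - c 0) + 2 * norm (t 2) * \<bar>scaled_radius d b - scaled_radius d c\<bar> + (1 + (\<Sum>j\<le>d. real j)) * (s * (L * (2 * ?N)))"
  proof (rule weighted_norm_bound(2)[OF d])
    fix j :: nat
    let ?m = "(if j = 0 then 2 * t 2 * (b 0 - c 0) else if j = 1 then 2 * t 2 * of_real (scaled_radius d b - scaled_radius d c) else 0)"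
    have eq: "coeff_iteration d t s \<tau> b j - coeff_iteration d t s \<tau> c j = cnj (?m + of_real s * (scaled_remainder d t s b j - scaled_remainder d t s c j))"
      by (simp add: coeff_iteration_def algebra_simps)
    have "norm (of_real s * (scaled_remainder d t s b j - scaled_remainder d t s c j)) \<le> s * (L * (2 * ?N))"
      using R[of j] s by (simp add: norm_mult mult_left_mono)
    moreover have "norm ?m \<le> (if j = 0 then 2 * norm (t 2) * norm (b 0 - c 0) else if j = 1 then 2 * norm (t 2) * \<bar>scaled_radius d b - scaled_radius d c\<bar> else 0)"
      by (simp add: norm_mult del: of_real_diff)
    ultimately show "norm (coeff_iteration d t s \<tau> b j - coeff_iteration d t s \<tau> c j)
      \<le> (if j = 0 then 2 * norm (t 2) * norm (b 0 - c 0) else if j = 1 then 2 * norm (t 2) * \<bar>scaled_radius d b - scaled_radius d c\<bar> else 0) + s * (L * (2 * ?N))"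
      unfolding eq complex_mod_cnj by (rule norm_triangle_mono[OF _, rotated])
  qed auto
  moreover have "2 * norm (t 2) * \<bar>scaled_radius d b - scaled_radius d c\<bar> \<le> 2 * norm (t 2) * (\<Sum>j\<le>d. j * norm (b j - c j))"
    by (intro mult_left_mono scaled_radius_Lipschitz) auto
  moreover have "2 * norm (t 2) * norm (b 0 - c 0) + 2 * norm (t 2) * (\<Sum>j\<le>d. j * norm (b j - c j)) = 2 * norm (t 2) * ?N"
    by (simp add: weighted_norm_def algebra_simps)
  ultimately show ?thesis by (simp add: algebra_simps)
qed

section \<open>Perturbed ellipses\<close>

text \<open>On the unit circle \<open>1 / w ^ j\<close> has Lipschitz constant \<open>j\<close>. So
  the part other than \<open>r * w\<close> is Lipschitz with a constant below \<open>r\<close> and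
  cannot offset a change of \<open>r * w\<close>; the same sum bounds its derivative.\<close>

lemma laurent_map_inj_regular:
  assumes "(\<Sum>j\<le>d. j * norm (a j)) < r"
  shows "inj_on (laurent_map d r a) (sphere 0 1)" and "\<forall>w\<in>sphere 0 1. laurent_deriv d r a w \<noteq> 0"
proof -
  have r: "r > 0" by (rule le_less_trans[OF _ assms]) (simp add: sum_nonneg)
  show "inj_on (laurent_map d r a) (sphere 0 1)"
  proof (rule inj_onI, rule ccontr)
    fix w w' :: complex assume w: "w \<in> sphere 0 1" "w' \<in> sphere 0 1" and eq: "laurent_map d r a w = laurent_map d r a w'" and ne: "w \<noteq> w'"
    have nw: "norm w = 1" "norm w' = 1" "w \<noteq> 0" "w' \<noteq> 0" using w by auto
    have "of_real r * (w - w') = (\<Sum>j\<le>d. a j / w' ^ j - a j / w ^ j)"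
      using eq by (simp add: laurent_map_def algebra_simps sum_subtractf)
    then have "r * norm (w - w') = norm (\<Sum>j\<le>d. a j / w' ^ j - a j / w ^ j)"
      using r by (metis abs_of_pos norm_mult norm_of_real)
    also have "\<dots> \<le> (\<Sum>j\<le>d. j * norm (a j) * norm (w - w'))"
    proof (rule sum_norm_le)
      fix j
      have "a j / w' ^ j - a j / w ^ j = a j * (w ^ j - w' ^ j) / (w ^ j * w' ^ j)"
        using nw by (simp add: field_simps)
      then have "norm (a j / w' ^ j - a j / w ^ j) = norm (a j) * norm (w ^ j - w' ^ j)"
        using nw by (simp add: norm_mult norm_divide norm_power)
      also have "\<dots> \<le> norm (a j) * (j * norm (w - w'))"
        using nw by (intro mult_left_mono norm_power_diff) auto
      finally show "norm (a j / w' ^ j - a j / w ^ j) \<le> j * norm (a j) * norm (w - w')" by (simp add: mult_ac)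
    qed
    also have "\<dots> = (\<Sum>j\<le>d. j * norm (a j)) * norm (w - w')" by (simp add: sum_distrib_right)
    finally show False using assms ne by (simp add: mult_le_cancel_right)
  qed
  show "\<forall>w\<in>sphere 0 1. laurent_deriv d r a w \<noteq> 0"
  proof (intro ballI notI)
    fix w :: complex assume w: "w \<in> sphere 0 1" and "laurent_deriv d r a w = 0"
    then have "of_real r = (\<Sum>j\<le>d. of_nat j * a j / w ^ Suc j)" by (simp add: laurent_deriv_def)
    then have "r = norm (\<Sum>j\<le>d. of_nat j * a j / w ^ Suc j)" using r by (metis abs_of_pos norm_of_real)
    also have "\<dots> \<le> (\<Sum>j\<le>d. j * norm (a j))"
      by (rule sum_norm_le) (use w in \<open>simp add: norm_divide norm_mult norm_power\<close>)
    finally show False using assms by simp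
  qed
qed

text \<open>The real-linear map \<open>z \<mapsto> z - (a1 / r) * cnj z\<close> preserves the winding number about 0 because
  \<open>norm a1 < r\<close>; it takes the ellipse \<open>r w + a1 / w\<close> to a round circle.\<close>

lemma winding_number_near_ellipse:
  assumes r: "r > 0" and a1: "norm (a 1) < r"
    and close: "\<And>w. norm w = 1 \<Longrightarrow> norm (of_real r * laurent_map d r a w - a 1 * cnj (laurent_map d r a w) - of_real (r\<^sup>2 - (norm (a 1))\<^sup>2) * w)
       < r\<^sup>2 - (norm (a 1))\<^sup>2"
  shows "0 \<notin> laurent_map d r a ` sphere 0 1" and "winding_number (boundary_loop (laurent_map d r a)) 0 = 1"
proof -
  let ?h = "laurent_map d r a"
  let ?g = "boundary_loop ?h"
  \<comment> \<open>The image of \<open>r w + a 1 / w\<close> is a circle of this radius, as the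
    terms in \<open>1 / w\<close> cancel and \<open>r - (norm (a 1))\<^sup>2 / r\<close> remains as
    factor of \<open>w\<close>; \<open>close\<close> is stated after multiplication by
    \<open>r\<close>.\<close>
  define \<rho> where "\<rho> = (r\<^sup>2 - (norm (a 1))\<^sup>2) / r"
  have pos: "r\<^sup>2 - (norm (a 1))\<^sup>2 > 0" using r a1 by (simp add: power_strict_mono)
  then have \<rho>: "\<rho> > 0" using r by (simp add: \<rho>_def)
  define g' where "g' x = ?g x - a 1 / of_real r * cnj (?g x)" for x
  have nz: "?h w \<noteq> 0" if "norm w = 1" for w
  proof
    assume "?h w = 0"
    then have "norm (of_real (r\<^sup>2 - (norm (a 1))\<^sup>2) * w) < r\<^sup>2 - (norm (a 1))\<^sup>2" using close[OF that] by simp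
    then show False using that pos by (simp only: norm_mult norm_of_real) simp
  qed
  then show "0 \<notin> ?h ` sphere 0 1" by (metis imageE mem_sphere_0)
  have "continuous_on {0..1} ?g" using boundary_loop_facts(2)[of d r a] by (simp add: path_def)
  then have path_g': "path g'" unfolding path_def g'_def using r by (intro continuous_intros) auto
  have ends: "pathfinish g' = pathstart g'"
    using boundary_loop_facts(3)[of d r a] by (simp add: g'_def pathfinish_def pathstart_def)
  \<comment> \<open>Rouche-type comparison: the change is smaller than \<open>norm (?g x)\<close>
    because \<open>norm (a 1) < r\<close>. The comparison with the round circle below rests on
    \<open>close\<close>.\<close>
  have "winding_number g' 0 = winding_number ?g 0"
  proof (rule winding_number_nearby_loops_eq)
    fix x :: real
    have gx: "?g x \<noteq> 0" using nz[of "unit_circle x"] by (simp add: boundary_loop_def)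
    have "norm (g' x - ?g x) = norm (a 1) / r * norm (?g x)"
      using r by (simp add: g'_def norm_mult norm_divide)
    also have "\<dots> < norm (?g x - 0)" using a1 r gx by (simp add: field_simps)
    finally show "norm (g' x - ?g x) < norm (?g x - 0)" .
  qed (use boundary_loop_facts path_g' ends in auto)
  moreover have "winding_number g' 0 = winding_number (circlepath 0 \<rho>) 0"
  proof (rule winding_number_nearby_loops_eq)
    fix x :: real
    let ?w = "unit_circle x"
    have c: "circlepath 0 \<rho> x = of_real \<rho> * ?w" by (simp add: circlepath)
    have "of_real r * (g' x - circlepath 0 \<rho> x) = of_real r * ?h ?w - a 1 * cnj (?h ?w) - of_real (r\<^sup>2 - (norm (a 1))\<^sup>2) * ?w"
    proof -
      have "of_real r * of_real \<rho> = complex_of_real (r\<^sup>2 - (norm (a 1))\<^sup>2)"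
        using r unfolding of_real_mult[symmetric] \<rho>_def by simp
      then have "of_real (r\<^sup>2 - (norm (a 1))\<^sup>2) * ?w = of_real r * circlepath 0 \<rho> x"
        unfolding c mult.assoc[symmetric] by (simp only:)
      moreover have "of_real r * g' x = of_real r * ?h ?w - a 1 * cnj (?h ?w)"
        using r by (simp add: g'_def boundary_loop_def algebra_simps)
      ultimately show ?thesis by (simp only: right_diff_distrib)
    qed
    then have "r * norm (g' x - circlepath 0 \<rho> x) < r\<^sup>2 - (norm (a 1))\<^sup>2"
      using close[of ?w] r by (metis abs_of_pos norm_mult norm_of_real norm_unit_circle)
    then have "norm (g' x - circlepath 0 \<rho> x) < \<rho>" using r by (simp add: \<rho>_def field_simps)
    then show "norm (g' x - circlepath 0 \<rho> x) < norm (circlepath 0 \<rho> x - 0)"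
      using \<rho> by (simp add: c norm_mult)
  qed (use path_g' ends in auto)
  ultimately show "winding_number ?g 0 = 1" using \<rho> by (simp add: winding_number_circlepath_centre)
qed

text \<open>The remainder measures the deviation from an ellipse. In the second claim the main term
  on the left is \<open>\<rho> * cnj \<tau>\<close>, and the right-hand side is at least 1 by the
  area equation. The bound on \<open>\<tau>\<close> limits the main term to \<open>5 / 6\<close>,
  and the conditions on \<epsilon> keep the errors below the remaining \<open>1 / 6\<close>.\<close>

lemma near_ellipse_estimates:
  fixes d t s \<tau> b
  defines "\<rho> \<equiv> scaled_radius d b"
  assumes d: "d \<ge> 1" and T: "norm (t 2) < 1 / 2" and s: "0 \<le> s"
    and fixpoint: "\<forall>j\<le>d. coeff_iteration d t s \<tau> b j = b j"
    and R: "\<And>j. norm (scaled_remainder d t s b j) \<le> L"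
    and K: "weighted_norm d b \<le> K" and \<tau>: "(norm \<tau>)\<^sup>2 < 1 / 2 - norm (t 2)"
    and \<epsilon>: "(1 + (\<Sum>j\<le>d. real j)) * (s * L) \<le> \<epsilon>" "\<epsilon> \<le> (1 - 2 * norm (t 2)) / 4" "\<epsilon> * (24 * (1 + K)) \<le> 1"
  shows "(\<Sum>j\<le>d. j * norm (b j)) < \<rho>"
    and "norm w = 1 \<Longrightarrow> norm (of_real \<rho> * laurent_map d \<rho> b w - b 1 * cnj (laurent_map d \<rho> b w) - of_real (\<rho>\<^sup>2 - (norm (b 1))\<^sup>2) * w)
       < \<rho>\<^sup>2 - (norm (b 1))\<^sup>2"
proof -
  define T where "T = norm (t 2)"
  define \<eta> where "\<eta> = s * L"
  define e where "e j = of_real s * scaled_remainder d t s b j" for j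
  have e: "norm (e j) \<le> \<eta>" for j using R[of j] s by (simp add: e_def \<eta>_def norm_mult mult_left_mono)
  have \<eta>0: "\<eta> \<ge> 0" using e[of 0] norm_ge_zero[of "e 0"] by linarith
  have \<rho>1: "\<rho> \<ge> 1" unfolding \<rho>_def by (rule scaled_radius_ge_1)
  have T01: "0 \<le> T" "2 * T < 1" using T by (auto simp: T_def)
  have K0: "K \<ge> 0" using K weighted_norm_nonneg[of d b] by linarith
  have b_eq: "b j = cnj ((if j = 0 then \<tau> + 2 * t 2 * b 0 else if j = 1 then 2 * t 2 * of_real \<rho> else 0) + e j)" if "j \<le> d" for j
    using fixpoint[rule_format, OF that] by (simp only: coeff_iteration_def e_def \<rho>_def)
  define S where "S = (\<Sum>j\<le>d. j * norm (b j))"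
  have sumj: "(\<Sum>j\<le>d. real j) \<ge> 0" by (simp add: sum_nonneg)
  have W: "(\<Sum>j\<le>d. real j) * \<eta> + \<eta> \<le> \<epsilon>" using \<epsilon>(1) by (simp add: \<eta>_def algebra_simps)
  have \<epsilon>0: "\<epsilon> \<ge> 0" using W sumj \<eta>0 by (meson add_nonneg_nonneg mult_nonneg_nonneg order_trans)
  \<comment> \<open>Index 0 has weight 0 in \<open>S\<close>, so \<open>norm (b 0)\<close> itself
    can serve as the main term there.\<close>
  have "S \<le> 2 * T * \<rho> + (\<Sum>j\<le>d. real j) * \<eta>"
    unfolding S_def
  proof (rule weighted_norm_bound(1)[OF d norm_ge_zero[of "b 0"]])
    fix j assume j: "j \<le> d"
    have "norm (b j) \<le> norm (2 * t 2 * of_real \<rho>) + norm (e j)" if "j = 1"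
      using b_eq[OF j] that by (simp only: complex_mod_cnj) (use norm_triangle_ineq[of "2 * t 2 * of_real \<rho>" "e j"] in simp)
    moreover have "norm (b j) = norm (e j)" if "j \<noteq> 0" "j \<noteq> 1" using b_eq[OF j] that by simp
    ultimately show "norm (b j) \<le> (if j = 0 then norm (b 0) else if j = 1 then 2 * T * \<rho> else 0) + \<eta>"
      using e[of j] \<eta>0 \<rho>1 by (auto simp: norm_mult T_def)
  qed (use T01 \<rho>1 in auto)
  also have "\<dots> \<le> 2 * T * \<rho> + \<epsilon>" using W \<eta>0 by simp
  also have "\<dots> \<le> (2 * T + \<epsilon>) * \<rho>" using \<epsilon>0 \<rho>1 by (simp add: distrib_right mult_le_cancel_left1)
  finally have S: "S \<le> (2 * T + \<epsilon>) * \<rho>" .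
  have q: "0 \<le> 2 * T + \<epsilon>" "2 * T + \<epsilon> < 1" "1 - (2 * T + \<epsilon>) \<ge> 3 * (1 - 2 * T) / 4"
    using T01 \<epsilon>0 \<epsilon>(2) by (auto simp: T_def)
  have "(2 * T + \<epsilon>) * \<rho> < 1 * \<rho>" using q \<rho>1 by (intro mult_strict_right_mono) auto
  then show "(\<Sum>j\<le>d. j * norm (b j)) < \<rho>" using S by (simp add: S_def)
  have S0: "S \<ge> 0" by (simp add: S_def sum_nonneg)
  \<comment> \<open>Since \<open>norm (b j) \<le> S\<close> for \<open>j \<ge> 1\<close>, the area
    equation gives \<open>\<rho>\<^sup>2 \<le> 1 + S\<^sup>2\<close>; with \<open>S\<close> below a
    fixed fraction of \<open>\<rho>\<close> this bounds the radius.\<close>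
  have "(\<Sum>j\<le>d. j * (norm (b j))\<^sup>2) \<le> (\<Sum>j\<le>d. (j * norm (b j)) * S)"
  proof (rule sum_mono)
    fix j assume j: "j \<in> {..d}"
    show "j * (norm (b j))\<^sup>2 \<le> (j * norm (b j)) * S"
    proof (cases "j = 0")
      case False
      then have "norm (b j) \<le> j * norm (b j)" by (simp add: mult_le_cancel_right1)
      also have "\<dots> \<le> S" unfolding S_def using j by (intro member_le_sum) auto
      finally show ?thesis unfolding power2_eq_square mult.assoc by (intro mult_left_mono) auto
    qed simp
  qed
  also have "\<dots> = S\<^sup>2" by (simp add: S_def power2_eq_square sum_distrib_right)
  also have "\<dots> \<le> ((2 * T + \<epsilon>) * \<rho>)\<^sup>2" using S S0 by (rule power_mono)
  also have "\<dots> = (2 * T + \<epsilon>)\<^sup>2 * \<rho>\<^sup>2" by (rule power_mult_distrib)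
  also have "\<dots> \<le> (2 * T + \<epsilon>) * \<rho>\<^sup>2"
    using q by (intro mult_right_mono) (auto simp: power2_eq_square mult_left_le_one_le)
  finally have "\<rho>\<^sup>2 * (1 - (2 * T + \<epsilon>)) \<le> 1"
    unfolding \<rho>_def scaled_radius_sq by (simp add: algebra_simps)
  moreover have "\<rho>\<^sup>2 * (3 * (1 - 2 * T) / 4) \<le> \<rho>\<^sup>2 * (1 - (2 * T + \<epsilon>))" using q by (intro mult_left_mono) auto
  ultimately have \<rho>T: "\<rho>\<^sup>2 * (3 * (1 - 2 * T) / 4) \<le> 1" by linarith
  \<comment> \<open>The factor \<open>1 - 2 * T\<close> in the bound of \<open>\<tau>\<close>
    offsets the possible growth of the radius and leaves \<open>2 / 3\<close>; \<open>5 / 6\<close>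
    is a rational number above its square root.\<close>
  have \<rho>\<tau>: "\<rho> * norm \<tau> \<le> 5 / 6"
  proof (rule power2_le_imp_le)
    have "(\<rho> * norm \<tau>)\<^sup>2 = \<rho>\<^sup>2 * (norm \<tau>)\<^sup>2" by (rule power_mult_distrib)
    also have "\<dots> \<le> \<rho>\<^sup>2 * ((1 - 2 * T) / 2)" using \<tau> by (intro mult_left_mono) (auto simp: T_def)
    also have "\<dots> = 2 / 3 * (\<rho>\<^sup>2 * (3 * (1 - 2 * T) / 4))" by simp
    also have "\<dots> \<le> 2 / 3 * 1" using \<rho>T by (intro mult_left_mono) auto
    also have "\<dots> \<le> (5 / 6)\<^sup>2" by (simp add: power2_eq_square)
    finally show "(\<rho> * norm \<tau>)\<^sup>2 \<le> (5 / 6)\<^sup>2" .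
  qed simp
  have det: "\<rho>\<^sup>2 - (norm (b 1))\<^sup>2 \<ge> 1"
  proof -
    have "real 1 * (norm (b 1))\<^sup>2 \<le> (\<Sum>j\<le>d. j * (norm (b j))\<^sup>2)"
      using d by (intro member_le_sum[of 1 _ "\<lambda>j. real j * (norm (b j))\<^sup>2"]) auto
    then show ?thesis unfolding \<rho>_def scaled_radius_sq by simp
  qed
  have bK: "norm (b j) \<le> K" if "j \<le> d" for j using norm_le_weighted_norm[OF that, of b] K by linarith
  have \<rho>K: "\<rho> \<le> 1 + K"
    using scaled_radius_le[of d b] K norm_ge_zero[of "b 0"] unfolding \<rho>_def weighted_norm_def by linarith
  show "norm (of_real \<rho> * laurent_map d \<rho> b w - b 1 * cnj (laurent_map d \<rho> b w) - of_real (\<rho>\<^sup>2 - (norm (b 1))\<^sup>2) * w)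
       < \<rho>\<^sup>2 - (norm (b 1))\<^sup>2" if w: "norm w = 1"
  proof -
    have w0: "w \<noteq> 0" using w by auto
    have cw: "cnj w = 1 / w"
      using w w0 by (metis complex_norm_square nonzero_eq_divide_eq mult.commute of_real_1 power_one)
    have split: "{..d} = {0, 1} \<union> {2..d}" using d by auto
    define V where "V = (\<Sum>j=2..d. b j / w ^ j)"
    have h: "laurent_map d \<rho> b w = of_real \<rho> * w + b 0 + b 1 / w + V"
      unfolding laurent_map_def split V_def by (subst sum.union_disjoint) auto
    have ch: "cnj (laurent_map d \<rho> b w) = of_real \<rho> / w + cnj (b 0) + cnj (b 1) * w + cnj V"
      unfolding h by (simp add: cw)
    have nb: "of_real ((norm (b 1))\<^sup>2) = b 1 * cnj (b 1)" by (rule complex_norm_square)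
    have "of_real \<rho> * laurent_map d \<rho> b w - b 1 * cnj (laurent_map d \<rho> b w) - of_real (\<rho>\<^sup>2 - (norm (b 1))\<^sup>2) * w
      = (of_real \<rho> * b 0 - b 1 * cnj (b 0)) + (of_real \<rho> * V - b 1 * cnj V)"
      unfolding ch unfolding h unfolding of_real_diff nb using w0 by (simp add: algebra_simps power2_eq_square)
    \<comment> \<open>The terms with \<open>t 2\<close> in \<open>b 0\<close> and in
      \<open>b 1\<close> cancel.\<close>
    also have "of_real \<rho> * b 0 - b 1 * cnj (b 0) = of_real \<rho> * cnj \<tau> + of_real \<rho> * cnj (e 0) - cnj (e 1) * cnj (b 0)"
    proof -
      have "b 0 = cnj \<tau> + 2 * cnj (t 2) * cnj (b 0) + cnj (e 0)" using b_eq[of 0] by simp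
      then have 1: "of_real \<rho> * b 0 = of_real \<rho> * (cnj \<tau> + 2 * cnj (t 2) * cnj (b 0) + cnj (e 0))" by (rule arg_cong)
      have 2: "b 1 = 2 * cnj (t 2) * of_real \<rho> + cnj (e 1)" using b_eq[of 1] d by simp
      show ?thesis unfolding 1 unfolding 2 by (simp add: algebra_simps)
    qed
    \<comment> \<open>The errors \<open>e 0\<close> and \<open>e 1\<close> contribute
      \<open>(1 + 2 * K) * \<eta>\<close>, and each of the \<open>d - 1\<close> terms of
      \<open>V\<close> as much again. The constant 24 makes the total error at most
      \<open>1 / 12\<close>.\<close>
    also have "norm (of_real \<rho> * cnj \<tau> + of_real \<rho> * cnj (e 0) - cnj (e 1) * cnj (b 0) + (of_real \<rho> * V - b 1 * cnj V))
       \<le> (5 / 6 + (1 + K) * \<eta> + \<eta> * K) + ((1 + K) * ((d - 1) * \<eta>) + K * ((d - 1) * \<eta>))"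
    proof (intro norm_triangle_le add_mono norm_triangle_le_diff)
      show "norm (of_real \<rho> * cnj \<tau>) \<le> 5 / 6" using \<rho>\<tau> \<rho>1 by (simp add: norm_mult)
      show "norm (of_real \<rho> * cnj (e 0)) \<le> (1 + K) * \<eta>"
        using \<rho>K \<rho>1 e[of 0] K0 by (simp add: norm_mult mult_mono)
      show "norm (cnj (e 1) * cnj (b 0)) \<le> \<eta> * K" using e[of 1] bK[of 0] \<eta>0 by (simp add: norm_mult mult_mono)
      have "norm V \<le> (\<Sum>j=2..d. \<eta>)" unfolding V_def
      proof (rule sum_norm_le)
        fix j assume "j \<in> {2..d}"
        then have "norm (b j) = norm (e j)" using b_eq[of j] by simp
        then show "norm (b j / w ^ j) \<le> \<eta>" using e[of j] w by (simp add: norm_divide norm_power)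
      qed
      then have V: "norm V \<le> (d - 1) * \<eta>" using d by (simp add: of_nat_diff)
      show "norm (of_real \<rho> * V) \<le> (1 + K) * ((d - 1) * \<eta>)"
        unfolding norm_mult using \<rho>K \<rho>1 V K0 by (intro mult_mono) auto
      show "norm (b 1 * cnj V) \<le> K * ((d - 1) * \<eta>)"
        unfolding norm_mult complex_mod_cnj using bK[of 1] d V K0 by (intro mult_mono) auto
    qed
    also have "\<dots> = 5 / 6 + (1 + 2 * K) * (d * \<eta>)" using d by (simp add: of_nat_diff algebra_simps)
    also have "\<dots> < 1"
    proof -
      have "real d \<le> (\<Sum>j\<le>d. real j)" by (rule member_le_sum) auto
      then have "d * \<eta> \<le> \<epsilon>" using W \<eta>0 mult_right_mono[of "real d" "\<Sum>j\<le>d. real j" \<eta>] by linarith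
      then have "(1 + 2 * K) * (d * \<eta>) \<le> (1 + 2 * K) * \<epsilon>" using K0 by (intro mult_left_mono) auto
      moreover have "24 * ((1 + K) * \<epsilon>) \<le> 1" using \<epsilon>(3) by (simp add: mult_ac)
      moreover have "(1 + 2 * K) * \<epsilon> \<le> 2 * ((1 + K) * \<epsilon>)" using \<epsilon>0 by (simp add: algebra_simps)
      ultimately show ?thesis by linarith
    qed
    finally show ?thesis using det by linarith
  qed
qed

section \<open>Choice of the constants, existence and uniqueness\<close>

theorem theorem2p5:
  fixes d :: nat and t :: "nat \<Rightarrow> complex"
  assumes "d \<ge> 1" and "norm (t 2) < 1 / 2"
  shows "\<exists>\<delta>>0. \<forall>(t0::real) (t1::complex).
    0 < t0 \<and> t0 < \<delta> \<and> (norm t1)\<^sup>2 < t0 * (1 / 2 - norm (t 2)) \<longrightarrow>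
    (\<exists>!C. \<exists>h. pos_polynomial_curve_param d h C \<and>
       0 \<in> inside C \<and>
       measure lebesgue (inside C) = pi * t0 \<and>
       (\<forall>k\<ge>1. exterior_moment (boundary_loop h) k =
          (if k = 1 then t1 else if k \<le> d + 1 then t k else 0)))"
proof -
  note d = assms(1) and t2 = assms(2)
  define T where "T = norm (t 2)"
  define W where "W = 1 + (\<Sum>j\<le>d. real j)"
  have W1: "W \<ge> 1" by (simp add: W_def sum_nonneg)
  have T: "0 \<le> T" "2 * T < 1" using t2 by (auto simp: T_def)
  obtain \<delta>0 \<kappa> :: real where \<delta>0: "\<delta>0 > 0" and \<kappa>: "\<kappa> > 0" and necessary:
    "\<forall>t0 t1 h C. 0 < t0 \<and> t0 < \<delta>0 \<and> norm t1 \<le> sqrt t0 \<and> solves_moment_problem d t t0 t1 h C \<longrightarrow>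
       (\<exists>r a. r > 0 \<and> C = laurent_map d r a ` sphere 0 1 \<and> t0 = r\<^sup>2 - (\<Sum>j\<le>d. j * (norm (a j))\<^sup>2) \<and>
         (\<forall>j\<le>d. norm (a j) \<le> \<kappa> * sqrt t0) \<and>
         (\<forall>j\<le>d. fourier_coeff j (\<lambda>w. poly (moment_poly d t t1) (laurent_map d r a w)) = cnj (a j)))"
    by (rule solution_imp_equations[of d t, OF d t2], rule that)
  \<comment> \<open>The first entry places the scaled coefficients of every solution in the ball, as
    uniqueness requires; the second makes the ball invariant, through
    \<open>3 + 2 * T * K \<le> K\<close>.\<close>
  define K where "K = max (\<kappa> * W) (3 / (1 - 2 * T))"
  have K: "K \<ge> \<kappa> * W" "K \<ge> 3 / (1 - 2 * T)" "K \<ge> 0"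
    using \<kappa> W1 by (auto simp: K_def le_max_iff_disj)
  have K3: "3 + 2 * T * K \<le> K" using K(2) T by (simp add: field_simps)
  obtain L where L0: "L \<ge> 0" and
    L1: "\<forall>s b j. 0 \<le> s \<and> s \<le> 1 \<and> weighted_norm d b \<le> K \<longrightarrow> norm (scaled_remainder d t s b j) \<le> L" and
    L2: "\<forall>s b c j. 0 \<le> s \<and> s \<le> 1 \<and> weighted_norm d b \<le> K \<and> weighted_norm d c \<le> K \<longrightarrow>
       norm (scaled_remainder d t s b j - scaled_remainder d t s c j) \<le> L * (2 * weighted_norm d (\<lambda>j. b j - c j))"
    by (rule scaled_remainder_bounds[OF K(3), of d t], rule that)
  \<comment> \<open>The first entry keeps the contraction factor
    \<open>2 * T + 2 * \<epsilon>\<close> below 1 and enters the bound of the radius; the second is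
    the error budget for the position of the origin.\<close>
  define \<epsilon> where "\<epsilon> = min ((1 - 2 * T) / 4) (1 / (24 * (1 + K)))"
  have \<epsilon>: "\<epsilon> > 0" "\<epsilon> \<le> (1 - 2 * T) / 4" "\<epsilon> * (24 * (1 + K)) \<le> 1"
  proof -
    show "\<epsilon> > 0" using T K(3) by (simp add: \<epsilon>_def add_nonneg_pos)
    show "\<epsilon> \<le> (1 - 2 * T) / 4" unfolding \<epsilon>_def by (rule min.cobounded1)
    have "\<epsilon> * (24 * (1 + K)) \<le> 1 / (24 * (1 + K)) * (24 * (1 + K))"
      unfolding \<epsilon>_def using K(3) by (intro mult_right_mono min.cobounded2) auto
    then show "\<epsilon> * (24 * (1 + K)) \<le> 1" using K(3) by simp
  qed
  \<comment> \<open>From \<open>s < s0\<close> follow \<open>s \<le> 1\<close> and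
    \<open>W * (s * L) \<le> \<epsilon>\<close>; the summand 1 keeps the denominator positive when
    \<open>L = 0\<close>.\<close>
  define s0 where "s0 = min 1 (\<epsilon> / (W * L + 1))"
  have WL: "W * L \<ge> 0" using W1 L0 by simp
  have s0: "s0 > 0" using \<epsilon>(1) WL by (simp add: s0_def)
  define q where "q = 2 * T + 2 * \<epsilon>"
  have q: "0 \<le> q" "q < 1" using T \<epsilon> by (auto simp: q_def)
  show ?thesis
  proof (intro exI[of _ "min \<delta>0 (s0\<^sup>2)"] conjI allI impI)
    show "min \<delta>0 (s0\<^sup>2) > 0" using \<delta>0 s0 by simp
    fix t0 :: real and t1 :: complex
    assume asm: "0 < t0 \<and> t0 < min \<delta>0 (s0\<^sup>2) \<and> (norm t1)\<^sup>2 < t0 * (1 / 2 - norm (t 2))"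
    then have t0: "0 < t0" "t0 < \<delta>0" "t0 < s0\<^sup>2" and t1: "(norm t1)\<^sup>2 < t0 * (1 / 2 - T)" by (auto simp: T_def)
    define s where "s = sqrt t0"
    have s_sq: "s\<^sup>2 = t0" and s: "0 < s" using t0(1) by (auto simp: s_def)
    have "s < s0" using t0(3) s0 unfolding s_sq[symmetric] by (rule power_less_imp_less_base[OF _ less_imp_le])
    then have s1: "s \<le> 1" and "s * (W * L + 1) \<le> \<epsilon>" using WL by (auto simp: s0_def field_simps)
    then have s\<epsilon>: "W * (s * L) \<le> \<epsilon>" using s by (simp add: algebra_simps)
    \<comment> \<open>In the length unit \<open>s\<close> the hypothesis on \<open>t1\<close>
      becomes a bound on \<open>\<tau>\<close> that is free of \<open>t0\<close>.\<close>
    define \<tau> where "\<tau> = t1 / of_real s"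
    have t1_eq: "t1 = of_real s * \<tau>" using s by (simp add: \<tau>_def)
    have \<tau>: "(norm \<tau>)\<^sup>2 < 1 / 2 - T"
      using t1 s unfolding \<tau>_def norm_divide power_divide by (simp add: s_sq t0 divide_less_eq mult.commute)
    have \<tau>1: "norm \<tau> \<le> 1"
      by (rule power2_le_imp_le) (use \<tau> T in auto)
    have t1s: "norm t1 \<le> sqrt t0" using \<tau>1 s by (simp add: t1_eq norm_mult s_def[symmetric] mult_le_cancel_left1)
    let ?\<Phi> = "coeff_iteration d t s \<tau>"
    let ?N = "weighted_norm d"
    have R1: "norm (scaled_remainder d t s b j) \<le> L" if "?N b \<le> K" for b j
      using L1 s s1 that by simp
    have R2: "norm (scaled_remainder d t s b j - scaled_remainder d t s c j) \<le> L * (2 * ?N (\<lambda>j. b j - c j))"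
      if "?N b \<le> K" "?N c \<le> K" for b c j
      using L2 s s1 that by simp
    have self: "?N (?\<Phi> b) \<le> K" if "?N b \<le> K" for b
    proof -
      have "?N (?\<Phi> b) \<le> 1 + 2 * T * (1 + ?N b) + W * (s * L)"
        unfolding T_def W_def using coeff_iteration_self_map[OF d \<tau>1 less_imp_le[OF s] R1[OF that]] .
      also have "\<dots> \<le> 1 + 2 * T * (1 + K) + 1"
        using that T s\<epsilon> \<epsilon>(2) by (intro add_mono mult_left_mono) auto
      also have "\<dots> \<le> K" using K3 T by (simp add: algebra_simps)
      finally show ?thesis .
    qed
    have contr: "?N (\<lambda>j. ?\<Phi> b j - ?\<Phi> c j) \<le> q * ?N (\<lambda>j. b j - c j)" if "?N b \<le> K" "?N c \<le> K" for b c
    proof -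
      have "?N (\<lambda>j. ?\<Phi> b j - ?\<Phi> c j) \<le> (2 * T + 2 * (W * (s * L))) * ?N (\<lambda>j. b j - c j)"
        unfolding T_def W_def using coeff_iteration_contraction[OF d less_imp_le[OF s] R2[OF that]] .
      also have "\<dots> \<le> q * ?N (\<lambda>j. b j - c j)"
        using s\<epsilon> by (intro mult_right_mono weighted_norm_nonneg) (auto simp: q_def)
      finally show ?thesis .
    qed
    let ?solves = "solves_moment_problem d t t0 t1"
    have "\<exists>C h. ?solves h C"
    proof -
      obtain b where bK: "?N b \<le> K" and fixpoint: "\<forall>j\<le>d. ?\<Phi> b j = b j"
        using weighted_norm_Banach[OF q K(3) self contr] by blast
      define \<rho> where "\<rho> = scaled_radius d b"
      have \<rho>1: "\<rho> \<ge> 1" unfolding \<rho>_def by (rule scaled_radius_ge_1)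
      note est = near_ellipse_estimates[OF d t2 less_imp_le[OF s] fixpoint R1[OF bK] bK
          \<tau>[unfolded T_def] s\<epsilon>[unfolded W_def] \<epsilon>(2,3)[unfolded T_def], folded \<rho>_def]
      define r a where "r = s * \<rho>" and "a j = of_real s * b j" for j
      have r: "r > 0" using s \<rho>1 by (simp add: r_def)
      have na: "norm (a j) = s * norm (b j)" for j using s by (simp add: a_def norm_mult)
      have hw: "laurent_map d r a w = of_real s * laurent_map d \<rho> b w" for w
        unfolding r_def a_def by (rule laurent_map_scale)
      have sum_lt: "(\<Sum>j\<le>d. j * norm (a j)) < r"
      proof -
        have "(\<Sum>j\<le>d. j * norm (a j)) = s * (\<Sum>j\<le>d. j * norm (b j))" by (simp add: na sum_distrib_left mult_ac)
        then show ?thesis using est(1) s by (simp add: r_def)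
      qed
      have a1: "norm (a 1) < r"
      proof -
        have "real 1 * norm (a 1) \<le> (\<Sum>j\<le>d. j * norm (a j))"
          using d by (intro member_le_sum[of 1 _ "\<lambda>j. real j * norm (a j)"]) auto
        then show ?thesis using sum_lt by simp
      qed
      have det: "r\<^sup>2 - (norm (a 1))\<^sup>2 = s\<^sup>2 * (\<rho>\<^sup>2 - (norm (b 1))\<^sup>2)"
        by (simp add: r_def na power_mult_distrib right_diff_distrib)
      have close: "norm (of_real r * laurent_map d r a w - a 1 * cnj (laurent_map d r a w) - of_real (r\<^sup>2 - (norm (a 1))\<^sup>2) * w)
         < r\<^sup>2 - (norm (a 1))\<^sup>2" if "norm w = 1" for w
      proof -
        have "of_real r * laurent_map d r a w - a 1 * cnj (laurent_map d r a w) - of_real (r\<^sup>2 - (norm (a 1))\<^sup>2) * w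
          = of_real (s\<^sup>2) * (of_real \<rho> * laurent_map d \<rho> b w - b 1 * cnj (laurent_map d \<rho> b w) - of_real (\<rho>\<^sup>2 - (norm (b 1))\<^sup>2) * w)"
          unfolding det hw of_real_mult by (simp add: r_def a_def power2_eq_square algebra_simps)
        then have "norm (of_real r * laurent_map d r a w - a 1 * cnj (laurent_map d r a w) - of_real (r\<^sup>2 - (norm (a 1))\<^sup>2) * w)
          = s\<^sup>2 * norm (of_real \<rho> * laurent_map d \<rho> b w - b 1 * cnj (laurent_map d \<rho> b w) - of_real (\<rho>\<^sup>2 - (norm (b 1))\<^sup>2) * w)"
          by (simp only: norm_mult norm_of_real abs_power2)
        also have "\<dots> < s\<^sup>2 * (\<rho>\<^sup>2 - (norm (b 1))\<^sup>2)" using est(2)[OF that] s by (intro mult_strict_left_mono) auto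
        finally show ?thesis unfolding det .
      qed
      have area: "t0 = r\<^sup>2 - (\<Sum>j\<le>d. j * (norm (a j))\<^sup>2)"
        unfolding na power_mult_distrib r_def \<rho>_def scaled_radius_sq
        by (simp add: s_sq algebra_simps sum_distrib_left)
      have fourier: "\<forall>j\<le>d. fourier_coeff j (\<lambda>w. poly (moment_poly d t t1) (laurent_map d r a w)) = cnj (a j)"
        using fixpoint unfolding t1_eq r_def a_def \<rho>_def by (simp add: fourier_coeff_moment_poly[OF d])
      have "?solves (laurent_map d r a) (laurent_map d r a ` sphere 0 1)"
        by (rule equations_imp_solution[OF r area laurent_map_inj_regular[OF sum_lt] winding_number_near_ellipse[OF r a1 close] fourier])
      then show ?thesis by blast
    qed
    moreover have "C = C'" if sols: "?solves h C" "?solves h' C'" for h h' C C'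
    proof -
      \<comment> \<open>Uniqueness concerns the point set, while its parametrisations may differ. It
        is enough that every solution has some parametrisation whose scaled coefficients form a
        fixed point in the ball.\<close>
      have rep: "\<exists>b. ?N b \<le> K \<and> (\<forall>j\<le>d. ?\<Phi> b j = b j) \<and> C = laurent_map d (s * scaled_radius d b) (\<lambda>j. of_real s * b j) ` sphere 0 1"
        if sol: "?solves h C" for h C
      proof -
        obtain r a where r: "r > 0" and C: "C = laurent_map d r a ` sphere 0 1" and area: "t0 = r\<^sup>2 - (\<Sum>j\<le>d. j * (norm (a j))\<^sup>2)"
          and bound: "\<forall>j\<le>d. norm (a j) \<le> \<kappa> * sqrt t0"
          and fourier: "\<forall>j\<le>d. fourier_coeff j (\<lambda>w. poly (moment_poly d t t1) (laurent_map d r a w)) = cnj (a j)"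
        proof -
          have "0 < t0 \<and> t0 < \<delta>0 \<and> norm t1 \<le> sqrt t0 \<and> ?solves h C" using t0 t1s sol by blast
          from necessary[THEN spec, THEN spec, THEN spec, THEN spec, THEN mp, OF this] show ?thesis
            by (elim exE conjE) (rule that)
        qed
        define b where "b j = a j / of_real s" for j
        have a: "a = (\<lambda>j. of_real s * b j)" using s by (simp add: b_def)
        have "s\<^sup>2 * (scaled_radius d b)\<^sup>2 = r\<^sup>2"
          unfolding scaled_radius_sq using area s
          by (simp add: a norm_mult power_mult_distrib s_sq[symmetric] algebra_simps sum_distrib_left)
        \<comment> \<open>The sign of \<open>r\<close> selects the positive root of the area
          equation.\<close>
        then have r_eq: "r = s * scaled_radius d b"
          using r s scaled_radius_ge_1[of d b] by (simp add: power_mult_distrib[symmetric] power2_eq_iff_nonneg)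
        have "?N b \<le> W * \<kappa>"
        proof -
          have nb: "norm (b j) \<le> \<kappa>" if "j \<le> d" for j
            using bound[rule_format, OF that] s by (simp add: s_def[symmetric] b_def norm_divide divide_le_eq)
          then have "?N b \<le> 0 + 0 + W * \<kappa>"
            unfolding W_def by (intro weighted_norm_bound(2)[OF d]) auto
          then show ?thesis by simp
        qed
        then have "?N b \<le> K" using K(1) by (simp add: mult.commute)
        moreover have "?\<Phi> b j = b j" if "j \<le> d" for j
        proof -
          have "of_real s * cnj (?\<Phi> b j) = of_real s * cnj (b j)"
            using fourier[rule_format, OF that] fourier_coeff_moment_poly[OF d, of j t s \<tau> b] unfolding t1_eq r_eq a by simp
          then show ?thesis using s by simp
        qed
        ultimately show ?thesis using C unfolding r_eq a by blast
      qed
      obtain b c where b: "?N b \<le> K" "\<forall>j\<le>d. ?\<Phi> b j = b j" and C: "C = laurent_map d (s * scaled_radius d b) (\<lambda>j. of_real s * b j) ` sphere 0 1"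
        and c: "?N c \<le> K" "\<forall>j\<le>d. ?\<Phi> c j = c j" and C': "C' = laurent_map d (s * scaled_radius d c) (\<lambda>j. of_real s * c j) ` sphere 0 1"
        using rep[OF sols(1)] rep[OF sols(2)] by (elim exE conjE) (rule that)
      have "?N (\<lambda>j. b j - c j) \<le> ?N (\<lambda>j. ?\<Phi> b j - ?\<Phi> c j)"
        using b(2) c(2) by (intro weighted_norm_mono) simp
      also have "\<dots> \<le> q * ?N (\<lambda>j. b j - c j)" by (rule contr[OF b(1) c(1)])
      finally have "(1 - q) * ?N (\<lambda>j. b j - c j) \<le> 0" by (simp add: algebra_simps)
      then have N0: "?N (\<lambda>j. b j - c j) \<le> 0" using q(2) by (simp add: mult_le_0_iff)
      have bc: "b j = c j" if "j \<le> d" for j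
        using norm_le_weighted_norm[OF that, of "\<lambda>j. b j - c j"] N0 by (metis norm_le_zero_iff order_trans right_minus_eq)
      have "scaled_radius d b = scaled_radius d c" by (simp add: scaled_radius_def bc)
      then have "laurent_map d (s * scaled_radius d b) (\<lambda>j. of_real s * b j) = laurent_map d (s * scaled_radius d c) (\<lambda>j. of_real s * c j)"
        by (simp add: fun_eq_iff laurent_map_def bc)
      then show ?thesis using C C' by simp
    qed
    ultimately show "\<exists>!C. \<exists>h. pos_polynomial_curve_param d h C \<and> 0 \<in> inside C \<and> measure lebesgue (inside C) = pi * t0 \<and>
       (\<forall>k\<ge>1. exterior_moment (boundary_loop h) k = (if k = 1 then t1 else if k \<le> d + 1 then t k else 0))"
      unfolding solves_moment_problem_def[symmetric] by blast
  qed
qed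

end
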